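(* Let $Q^{(0)}\in H^1_+\setminus\{0\}$ be a minimizer of $I_2^{(0)}$ over $H^1_+\setminus\{0\}$ with $\|Q^{(0)}\|_{L^2}=\sqrt[4]{3J_2^{(0)}}$. Then $\sup\mathcal{E}<\|Q^{(0)}\|_{L^2}=\sqrt[4]{3J_2^{(0)}}$. Precisely, there exists $u\in C(\mathbb{R};H^1_+)$ solving $i\partial_tu+\partial_x^2u=-\Pi(|u|^4u)$ such that $\|u(0)\|_{L^2}<\|Q^{(0)}\|_{L^2}$ and $u$ $L^2$-scatters neither forward nor backward in time.
   Context: $\Pi:L^2(\mathbb{R})\to L^2(\mathbb{R})$ is the Szegő projector onto nonnegative frequencies, $\Pi(f)(x)=\frac{1}{2\pi}\int_0^{+\infty}e^{ix\xi}\hat f(\xi)\,\mathrm{d}\xi$; $L^2_+=\Pi(L^2(\mathbb{R}))$ (complex-valued functions) and $H^1_+=H^1(\mathbb{R})\cap L^2_+$. The equation $i\partial_t u+\partial_x^2u=-\Pi(|u|^4u)$ has, for each $u_0\in H^1_+$, a unique global solution $u\in C(\mathbb{R};H^1_+)$ with $u(0)=u_0$. A global solution $u$ is said to $L^2$-scatter forward (resp. backward) in time if there is $u_+\in L^2_+$ (resp. $u_-\in L^2_+$) with $\lim_{t\to+\infty}\|e^{it\partial_x^2}u_+-u(t)\|_{L^2}=0$ (resp. $\lim_{t\to-\infty}\|e^{it\partial_x^2}u_--u(t)\|_{L^2}=0$). $\mathcal{E}\subset(0,+\infty)$ is the set of all $\epsilon>0$ such that for every $u_0\in H^1_+$ with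 $\|u_0\|_{L^2}<\epsilon$, the corresponding solution $L^2$-scatters both forward and backward in time. For $f\in H^1_+\setminus\{0\}$, $I_2^{(0)}(f)=\|\partial_xf\|_{L^2}^2\|f\|_{L^2}^4/\|f\|_{L^6}^6$, and $J_2^{(0)}=\inf_{f\in H^1_+\setminus\{0\}}I_2^{(0)}(f)$. *)

theory Defs
  imports "HOL-Analysis.Analysis"
begin

text \<open>Elements of \<open>L\<^sup>2(\<real>)\<close> are represented by Borel functions \<open>real \<Rightarrow> complex\<close>; everything below
  depends only on their classes modulo equality almost everywhere. Operators on \<open>L\<^sup>2\<close>
  (Fourier transform, weak derivative, projector, propagator) choose a representative of the value.\<close>

definition L2 :: "(real \<Rightarrow> complex) set" where
  "L2 = {f \<in> borel_measurable lborel. integrable lborel (\<lambda>x. (cmod (f x))\<^sup>2)}"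

definition lp_norm :: "nat \<Rightarrow> (real \<Rightarrow> complex) \<Rightarrow> real" where
  "lp_norm p f = root p (LINT x|lborel. cmod (f x) ^ p)"

text \<open>The distance is an extended integral, so that convergence cannot hold spuriously
  through the value 0 of the Bochner integral on non-integrable functions.\<close>
definition L2_limit :: "(real \<Rightarrow> real \<Rightarrow> complex) \<Rightarrow> (real \<Rightarrow> complex) \<Rightarrow> bool" where
  "L2_limit F g \<longleftrightarrow> g \<in> L2 \<and>
     ((\<lambda>N. \<integral>\<^sup>+x. ennreal ((cmod (F N x - g x))\<^sup>2) \<partial>lborel) \<longlongrightarrow> 0) at_top"

text \<open>\<open>\<integral> exp(-ix\<xi>) f(x) dx\<close>, as a limit in \<open>L\<^sup>2\<close> of truncated integrals.\<close>
definition fourier :: "(real \<Rightarrow> complex) \<Rightarrow> real \<Rightarrow> complex" where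
  "fourier f = (SOME g. L2_limit (\<lambda>N \<xi>. LINT x:{-N..N}|lborel. cis (- (x * \<xi>)) * f x) g)"

definition szego :: "(real \<Rightarrow> complex) \<Rightarrow> real \<Rightarrow> complex" where
  "szego f = (SOME g. L2_limit
     (\<lambda>N x. 1 / (2 * of_real pi) * (LINT \<xi>:{0..N}|lborel. cis (x * \<xi>) * fourier f \<xi>)) g)"

definition L2_plus :: "(real \<Rightarrow> complex) set" where
  "L2_plus = {f \<in> L2. \<exists>h\<in>L2. AE x in lborel. f x = szego h x}"

definition test_function :: "(real \<Rightarrow> real) \<Rightarrow> bool" where
  "test_function \<phi> \<longleftrightarrow>
     (\<forall>n x. (deriv ^^ n) \<phi> field_differentiable (at x)) \<and> compact (closure {x. \<phi> x \<noteq> 0})"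

text \<open>Real test functions suffice, by linearity.\<close>
definition has_weak_deriv :: "(real \<Rightarrow> complex) \<Rightarrow> (real \<Rightarrow> complex) \<Rightarrow> bool" where
  "has_weak_deriv f g \<longleftrightarrow> (\<forall>\<phi>. test_function \<phi> \<longrightarrow>
     (LINT x|lborel. f x * of_real (deriv \<phi> x)) = - (LINT x|lborel. g x * of_real (\<phi> x)))"

definition weak_deriv :: "(real \<Rightarrow> complex) \<Rightarrow> real \<Rightarrow> complex" where
  "weak_deriv f = (SOME g. g \<in> L2 \<and> has_weak_deriv f g)"

definition H1 :: "(real \<Rightarrow> complex) set" where
  "H1 = {f \<in> L2. \<exists>g\<in>L2. has_weak_deriv f g}"

definition H1_norm :: "(real \<Rightarrow> complex) \<Rightarrow> real" where
  "H1_norm f = sqrt ((lp_norm 2 f)\<^sup>2 + (lp_norm 2 (weak_deriv f))\<^sup>2)"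

definition H1_plus :: "(real \<Rightarrow> complex) set" where
  "H1_plus = H1 \<inter> L2_plus"

text \<open>The equation \<open>i \<partial>\<^sub>t u + \<partial>\<^sub>x\<^sup>2 u = -\<Pi>(|u|\<^sup>4u)\<close> is understood in the sense of distributions. As
  \<open>u \<in> C(\<real>; H\<^sup>1)\<close>, this may be tested in \<open>x\<close> at each time: all pairings other than the one with
  \<open>\<partial>\<^sub>t u\<close> are continuous in \<open>t\<close>, so \<open>t \<mapsto> \<langle>u(t), \<phi>\<rangle>\<close> is continuously differentiable.\<close>
definition global_solution :: "(real \<Rightarrow> real \<Rightarrow> complex) \<Rightarrow> bool" where
  "global_solution u \<longleftrightarrow>
     (\<forall>t. u t \<in> H1_plus) \<and>
     (\<forall>t. ((\<lambda>s. H1_norm (\<lambda>x. u s x - u t x)) \<longlongrightarrow> 0) (at t)) \<and>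
     (\<forall>\<phi> t. test_function \<phi> \<longrightarrow>
        (\<exists>D. ((\<lambda>s. LINT x|lborel. u s x * of_real (\<phi> x)) has_vector_derivative D) (at t) \<and>
             \<i> * D + (LINT x|lborel. u t x * of_real (deriv (deriv \<phi>) x)) =
             - (LINT x|lborel. szego (\<lambda>y. of_real (cmod (u t y) ^ 4) * u t y) x * of_real (\<phi> x))))"

text \<open>The free propagator \<open>exp(it\<partial>\<^sub>x\<^sup>2)\<close>.\<close>
definition free_schroedinger :: "real \<Rightarrow> (real \<Rightarrow> complex) \<Rightarrow> real \<Rightarrow> complex" where
  "free_schroedinger t f =
     (SOME g. g \<in> L2 \<and> (AE \<xi> in lborel. fourier g \<xi> = cis (- (t * \<xi>\<^sup>2)) * fourier f \<xi>))"

definition L2_scatters_forward :: "(real \<Rightarrow> real \<Rightarrow> complex) \<Rightarrow> bool" where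
  "L2_scatters_forward u \<longleftrightarrow> (\<exists>v\<in>L2_plus.
     ((\<lambda>t. lp_norm 2 (\<lambda>x. free_schroedinger t v x - u t x)) \<longlongrightarrow> 0) at_top)"

definition L2_scatters_backward :: "(real \<Rightarrow> real \<Rightarrow> complex) \<Rightarrow> bool" where
  "L2_scatters_backward u \<longleftrightarrow> (\<exists>v\<in>L2_plus.
     ((\<lambda>t. lp_norm 2 (\<lambda>x. free_schroedinger t v x - u t x)) \<longlongrightarrow> 0) at_bot)"

text \<open>The solution with initial datum \<open>u\<^sub>0 \<in> H\<^sup>1\<^sub>+\<close> exists and is unique (modulo null sets in \<open>x\<close>),
  so quantifying over all solutions with that datum refers to exactly this solution.\<close>
definition scattering_thresholds :: "real set" where
  "scattering_thresholds = {\<epsilon>. 0 < \<epsilon> \<and> (\<forall>u0\<in>H1_plus. lp_norm 2 u0 < \<epsilon> \<longrightarrow>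
     (\<forall>u. global_solution u \<and> (AE x in lborel. u 0 x = u0 x) \<longrightarrow>
        L2_scatters_forward u \<and> L2_scatters_backward u))}"

definition H1_plus_nonzero :: "(real \<Rightarrow> complex) set" where
  "H1_plus_nonzero = {f \<in> H1_plus. \<not> (AE x in lborel. f x = 0)}"

definition I2 :: "(real \<Rightarrow> complex) \<Rightarrow> real" where
  "I2 f = (lp_norm 2 (weak_deriv f))\<^sup>2 * lp_norm 2 f ^ 4 / lp_norm 6 f ^ 6"

definition J2 :: real where
  "J2 = (INF f\<in>H1_plus_nonzero. I2 f)"

end

theory Submission
  imports Defs "HOL-Probability.Probability" "HOL-Complex_Analysis.Great_Picard"
begin

text \<open>For \<open>f \<in> H\<^sup>1\<^sub>+\<close> let \<open>M = \<parallel>f\<parallel>\<^sup>2\<close>, \<open>K = \<parallel>f'\<parallel>\<^sup>2\<close> and \<open>P = \<langle>-if', f\<rangle>\<close> in \<open>L\<^sup>2\<close>, and let \<open>N\<close> be the sixth power of the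
  \<open>L\<^sup>6\<close> norm. As frequencies are nonnegative, \<open>P > 0\<close>. Hence \<open>(K - P + M/2) M\<^sup>2 / N\<close> takes at a suitable dilation
  of \<open>Q\<close> a value below \<open>J\<^sub>2 = inf K M\<^sup>2 / N\<close>. Such a value rules out the loss of compactness of a minimising sequence
  by spreading; with \<open>q = K - P + M/2\<close>, the inequality \<open>(q + q') (M + M')\<^sup>2 \<ge> q M\<^sup>2 + q' M'\<^sup>2 + q M'\<^sup>2\<close> rules out
  splitting. So a minimiser exists. Its multiple \<open>f\<close> with \<open>M\<^sup>2\<close> equal to three times the minimum solves
  \<open>-f'' + if' + \<omega>f = \<Pi>(|f|\<^sup>4 f)\<close> for some \<open>\<omega>\<close>, whence \<open>u(t, x) = exp(i\<omega>t) f(x - t)\<close> is a solution with mass below that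
  of \<open>Q\<close>. It does not scatter: undoing the free evolution leaves the phase \<open>exp(it(\<xi>\<^sup>2 - \<xi> + \<omega>))\<close> in front of
  the Fourier transform of \<open>f\<close>, so that there is no limit.\<close>

section \<open>Hilbert spaces\<close>

text \<open>The constant 1/2 in K - P + M/2 is one choice among many. With c M in its place the
  symbol is (\<xi> - 1/2)^2 + c - 1/4, positive definite for c > 1/4, and dilation by \<mu> turns
  the quotient into (K - P/\<mu> + c M/\<mu>^2) M^2/N. At \<mu> = M/P this lies below K M^2/N as
  soon as c < 1, and for c = 1/2 this dilation is the best one. As \<mu> grows the quotient tends to
  K M^2/N: the value J2 is the level at which sequences concentrate in space and spread in
  frequency, their masses tending to 0 under the constraint N = 1. The factor 3 comes from the
  degrees. With q = K - P + M/2 and N = 1 the first variation has 3 q M in front of the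
  nonlinearity; after division by M the factor 3 q is absorbed into the amplitude, which gives the
  squared mass the value 3 q M^2. The operators of the statement are choices of representatives,
  awkward to compute with. The argument therefore runs on the Fourier side, where derivative,
  projector and propagator are multiplications and only the sixth power needs the space
  variable.\<close>

lemma linear_coeff_zero:
  fixes a b :: real
  assumes "\<And>t. t\<^sup>2 * a + 2 * t * b \<ge> 0"
  shows "b = 0"
proof (rule ccontr)
  assume b: "b \<noteq> 0"
  define c where "c = \<bar>a\<bar> + 1"
  have c: "c > 0" "a < c" by (auto simp: c_def)
  have "(- b / c)\<^sup>2 * a + 2 * (- b / c) * b = b\<^sup>2 / c\<^sup>2 * (a - 2 * c)"
    using c by (simp add: power2_eq_square field_simps)
  moreover have "b\<^sup>2 / c\<^sup>2 * (a - 2 * c) < 0"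
    using b c by (intro mult_pos_neg) auto
  ultimately show False using assms[of "- b / c"] by simp
qed

text \<open>The representer minimises \<open>E u\<close>, which is the squared distance to it up to
  a constant. The parallelogram law makes a minimising sequence Cauchy, and the first-order
  condition at the limit is the representation. Linearity and boundedness are asked on
  \<open>V\<close> only, which is all that is known of the limit functional in the weak compactness
  argument.\<close>

lemma riesz_on_subspace:
  fixes V :: "'a::{real_inner,complete_space} set" and \<Lambda> :: "'a \<Rightarrow> real"
  assumes V: "subspace V" "closed V"
    and add: "\<And>u v. u \<in> V \<Longrightarrow> v \<in> V \<Longrightarrow> \<Lambda> (u + v) = \<Lambda> u + \<Lambda> v"
    and scale: "\<And>c u. u \<in> V \<Longrightarrow> \<Lambda> (c *\<^sub>R u) = c * \<Lambda> u"
    and bound: "\<And>u. u \<in> V \<Longrightarrow> \<bar>\<Lambda> u\<bar> \<le> C * norm u"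
  obtains v where "v \<in> V" "\<And>u. u \<in> V \<Longrightarrow> \<Lambda> u = inner v u"
proof -
  define E where "E u = (norm u)\<^sup>2 - 2 * \<Lambda> u" for u
  have E_lower: "E u \<ge> - C\<^sup>2" if "u \<in> V" for u
  proof -
    have "0 \<le> (norm u - C)\<^sup>2" by simp
    moreover have "\<Lambda> u \<le> C * norm u" using bound[OF that] by simp
    ultimately show ?thesis unfolding E_def power2_diff by (simp add: mult.commute)
  qed
  have bdd: "bdd_below (E ` V)" using E_lower by (intro bdd_belowI2[of _ "- C\<^sup>2"]) auto
  have V0: "V \<noteq> {}" using V(1) subspace_0 by blast
  define I where "I = Inf (E ` V)"
  have I_le: "I \<le> E u" if "u \<in> V" for u unfolding I_def using bdd that by (rule cINF_lower)
  have "\<exists>u\<in>V. E u < I + 1 / Suc n" for n :: nat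
    using cINF_less_iff[OF V0 bdd, of "I + 1 / Suc n"] by (auto simp: I_def)
  then obtain u where uV: "\<And>n. u n \<in> V" and uE: "\<And>n::nat. E (u n) < I + 1 / Suc n" by metis
  \<comment> \<open>The midpoint of \<open>x\<close> and \<open>y\<close> lies in \<open>V\<close>,
    so \<open>E\<close> is at least \<open>I\<close> there; the parallelogram law turns this into a
    bound on \<open>x - y\<close>.\<close>
  have par: "(norm (x - y))\<^sup>2 \<le> 2 * E x + 2 * E y - 4 * I" if "x \<in> V" "y \<in> V" for x y
  proof -
    have m: "(1/2) *\<^sub>R (x + y) \<in> V" using that V(1) by (simp add: subspace_add subspace_scale)
    have xy: "x + y \<in> V" using that V(1) by (simp add: subspace_add)
    have L: "\<Lambda> ((1/2) *\<^sub>R (x + y)) = (\<Lambda> x + \<Lambda> y) / 2" using scale[OF xy, of "1/2"] add that by simp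
    have half: "a - 2 * (b / 2) = a - b" for a b :: real by simp
    have "norm ((1/2) *\<^sub>R (x + y)) = norm (x + y) / 2" unfolding norm_scaleR by simp
    then have "(norm ((1/2) *\<^sub>R (x + y)))\<^sup>2 = (norm (x + y))\<^sup>2 / 4" by (simp only: power_divide) simp
    then have "E ((1/2) *\<^sub>R (x + y)) = (norm (x + y))\<^sup>2 / 4 - (\<Lambda> x + \<Lambda> y)"
      using half[of _ "\<Lambda> x + \<Lambda> y"] unfolding E_def L by simp
    moreover have "(norm (x - y))\<^sup>2 + (norm (x + y))\<^sup>2 = 2 * (norm x)\<^sup>2 + 2 * (norm y)\<^sup>2"
      by (simp add: power2_norm_eq_inner inner_simps inner_commute)
    ultimately show ?thesis using I_le[OF m] by (simp add: E_def)
  qed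
  have "Cauchy u"
  proof (rule metric_CauchyI)
    fix e :: real assume e: "e > 0"
    obtain N :: nat where N: "4 / e\<^sup>2 < N" using reals_Archimedean2 by blast
    show "\<exists>M. \<forall>m\<ge>M. \<forall>n\<ge>M. dist (u m) (u n) < e"
    proof (intro exI[of _ N] allI impI)
      fix m n assume mn: "N \<le> m" "N \<le> n"
      have N0: "real N > 0" by (rule le_less_trans[OF _ N]) auto
      have "1 / Suc k < 1 / real N" if "N \<le> k" for k using that N0 by (simp add: field_simps)
      then have "E (u k) < I + 1 / N" if "N \<le> k" for k
        using that uE[of k] by (meson add_strict_left_mono less_trans)
      from this[OF mn(1)] this[OF mn(2)] have "(norm (u m - u n))\<^sup>2 < 4 / N"
        using par[OF uV uV, of m n] by (simp add: field_simps)
      also have "4 / N < e\<^sup>2" using N e N0 by (simp add: field_simps)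
      finally show "dist (u m) (u n) < e" unfolding dist_norm using e by (simp add: power_less_imp_less_base)
    qed
  qed
  then obtain v where v: "u \<longlonglongrightarrow> v" using Cauchy_convergent convergent_def by blast
  have vV: "v \<in> V" using V(2) uV v closed_sequential_limits by blast
  have "(\<lambda>n. \<Lambda> (u n - v)) \<longlonglongrightarrow> 0"
  proof (rule Lim_null_comparison)
    show "\<forall>\<^sub>F n in sequentially. norm (\<Lambda> (u n - v)) \<le> C * norm (u n - v)"
      using bound uV vV V(1) by (intro always_eventually) (auto simp: subspace_diff)
    have "(\<lambda>n. C * norm (u n - v)) \<longlonglongrightarrow> C * norm (v - v)"
      by (intro tendsto_intros v)
    then show "(\<lambda>n. C * norm (u n - v)) \<longlonglongrightarrow> 0" by simp
  qed
  moreover have "\<Lambda> (u n) = \<Lambda> (u n - v) + \<Lambda> v" for n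
    using add[of "u n - v" v] uV vV V(1) by (simp add: subspace_diff)
  ultimately have "(\<lambda>n. \<Lambda> (u n)) \<longlonglongrightarrow> 0 + \<Lambda> v"
    by (simp only:) (intro tendsto_intros)
  then have "(\<lambda>n. E (u n)) \<longlonglongrightarrow> E v" unfolding E_def by (intro tendsto_intros v) simp
  moreover have "(\<lambda>n. I + 1 / Suc n) \<longlonglongrightarrow> I + 0"
    by (intro tendsto_intros LIMSEQ_inverse_real_of_nat[simplified inverse_eq_divide])
  ultimately have "E v \<le> I + 0" by (rule LIMSEQ_le) (use uE less_imp_le in blast)
  then have Ev: "E v \<le> E w" if "w \<in> V" for w using I_le[OF that] by simp
  have "\<Lambda> w = inner v w" if w: "w \<in> V" for w
  proof -
    have "t\<^sup>2 * (norm w)\<^sup>2 + 2 * t * (inner v w - \<Lambda> w) \<ge> 0" for t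
    proof -
      have tw: "t *\<^sub>R w \<in> V" "v + t *\<^sub>R w \<in> V" using V(1) w vV by (simp_all add: subspace_add subspace_scale)
      have "E (v + t *\<^sub>R w) = E v + t\<^sup>2 * (norm w)\<^sup>2 + 2 * t * (inner v w - \<Lambda> w)"
        unfolding E_def add[OF vV tw(1)] scale[OF w]
        unfolding power2_norm_eq_inner inner_simps
        by (simp add: inner_commute power2_eq_square algebra_simps)
      then show ?thesis using Ev[OF tw(2)] by simp
    qed
    from linear_coeff_zero[OF this] show ?thesis by simp
  qed
  then show thesis using that vV by blast
qed

text \<open>Representing \<open>inner w\<close> on \<open>V\<close> gives the orthogonal projection
  \<open>v\<close> of \<open>w\<close>, and \<open>w - v\<close> is orthogonal to \<open>V\<close>.
  Density of a subspace is later obtained by applying this to its closure.\<close>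

lemma closed_subspace_eq_UNIV:
  fixes V :: "'a::{real_inner,complete_space} set"
  assumes "subspace V" "closed V" and orth: "\<And>w. (\<And>u. u \<in> V \<Longrightarrow> inner w u = 0) \<Longrightarrow> w = 0"
  shows "V = UNIV"
proof -
  have "w \<in> V" for w
  proof -
    obtain v where v: "v \<in> V" "\<And>u. u \<in> V \<Longrightarrow> inner w u = inner v u"
      by (rule riesz_on_subspace[OF assms(1,2), of "inner w" "norm w"])
         (auto simp: inner_simps Cauchy_Schwarz_ineq2)
    then have "w - v = 0" by (intro orth) (simp add: inner_simps)
    then show ?thesis using v by simp
  qed
  then show ?thesis by blast
qed

text \<open>No separability is assumed: the diagonal argument is run against the countably many
  vectors \<open>h n\<close> themselves. The test vectors along which the inner products converge
  form a closed subspace containing every \<open>h n\<close>, and the part of any other test vector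
  orthogonal to that subspace is not seen by the sequence.\<close>

lemma bounded_weakly_convergent_subsequence:
  fixes h :: "nat \<Rightarrow> 'a::{real_inner,complete_space}"
  assumes "bounded (range h)"
  obtains k v where "strict_mono (k :: nat \<Rightarrow> nat)" "\<And>w. (\<lambda>m. inner w (h (k m))) \<longlonglongrightarrow> inner w v"
proof -
  obtain C where C: "\<And>n. norm (h n) \<le> C" using assms by (auto simp: bounded_iff)
  have C0: "C \<ge> 0" using C norm_ge_zero order_trans by blast
  have ib: "norm (inner u (h n)) \<le> norm u * C" for u n
    using Cauchy_Schwarz_ineq2[of u "h n"] mult_left_mono[OF C[of n] norm_ge_zero[of u]] by simp
  have "norm (inner x (h n)) \<le> C * C" if "x \<in> range h" for x n
  proof -
    have "norm x \<le> C" using that C by auto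
    then have "norm x * C \<le> C * C" using C0 by (rule mult_right_mono)
    then show ?thesis using ib[of x n] by (rule order_trans[rotated])
  qed
  from function_convergent_subsequence[OF countable_image[OF countableI_type], of h UNIV "\<lambda>n x. inner x (h n)", OF this]
  obtain k where k: "strict_mono (k :: nat \<Rightarrow> nat)"
      and lim: "\<And>x. x \<in> range h \<Longrightarrow> \<exists>l. (\<lambda>n. inner x (h (k n))) \<longlonglongrightarrow> l"
    by blast
  define V where "V = {u. convergent (\<lambda>n. inner u (h (k n)))}"
  have hV: "h n \<in> V" for n using lim by (auto simp: V_def convergent_def)
  have sub: "subspace V"
    unfolding subspace_def V_def mem_Collect_eq inner_simps
    by (auto intro: convergent_add convergent_const convergent_mult)
  have clo: "closed V"
    unfolding closed_sequential_limits
  proof safe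
    fix x l assume x: "\<forall>n. x n \<in> V" and l: "x \<longlonglongrightarrow> l"
    have "Cauchy (\<lambda>n. inner l (h (k n)))"
    proof (rule metric_CauchyI)
      fix e :: real assume e: "e > 0"
      \<comment> \<open>\<open>C + 1\<close> instead of \<open>C\<close> keeps the quotient
        meaningful when \<open>C\<close> is 0.\<close>
      define d where "d = e / (3 * (C + 1))"
      have d: "d > 0" using e C0 by (simp add: d_def)
      obtain i where i: "norm (x i - l) < d"
        using l d unfolding LIMSEQ_iff by blast
      have dC: "d * C < e / 3"
        using e C0 by (simp add: d_def field_simps)
      have near: "\<bar>inner l (h n) - inner (x i) (h n)\<bar> < e / 3" for n
      proof -
        have "\<bar>inner l (h n) - inner (x i) (h n)\<bar> = norm (inner (x i - l) (h n))"
          by (simp add: inner_simps abs_minus_commute)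
        also have "\<dots> \<le> norm (x i - l) * C" by (rule ib)
        also have "\<dots> \<le> d * C" using i C0 by (intro mult_right_mono) auto
        finally show ?thesis using dC by simp
      qed
      have "Cauchy (\<lambda>n. inner (x i) (h (k n)))" using x by (auto simp: V_def intro: convergent_Cauchy)
      then obtain M where M: "\<And>m n. m \<ge> M \<Longrightarrow> n \<ge> M \<Longrightarrow> dist (inner (x i) (h (k m))) (inner (x i) (h (k n))) < e / 3"
        using e by (meson divide_pos_pos metric_CauchyD zero_less_numeral)
      show "\<exists>M. \<forall>m\<ge>M. \<forall>n\<ge>M. dist (inner l (h (k m))) (inner l (h (k n))) < e"
      proof (intro exI[of _ M] allI impI)
        fix m n assume "M \<le> m" "M \<le> n"
        then show "dist (inner l (h (k m))) (inner l (h (k n))) < e"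
          using M[of m n] near[of "k m"] near[of "k n"] unfolding dist_real_def by linarith
      qed
    qed
    then show "l \<in> V" by (simp add: V_def Cauchy_convergent)
  qed
  define \<Lambda> where "\<Lambda> u = lim (\<lambda>n. inner u (h (k n)))" for u
  have \<Lambda>: "(\<lambda>n. inner u (h (k n))) \<longlonglongrightarrow> \<Lambda> u" if "u \<in> V" for u
    using that by (simp add: V_def \<Lambda>_def convergent_LIMSEQ_iff)
  have L_add: "\<Lambda> (u + v) = \<Lambda> u + \<Lambda> v" if "u \<in> V" "v \<in> V" for u v
  proof (rule LIMSEQ_unique)
    show "(\<lambda>n. inner (u + v) (h (k n))) \<longlonglongrightarrow> \<Lambda> (u + v)" using that sub by (intro \<Lambda>) (simp add: subspace_add)
    show "(\<lambda>n. inner (u + v) (h (k n))) \<longlonglongrightarrow> \<Lambda> u + \<Lambda> v"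
      unfolding inner_simps by (intro tendsto_add \<Lambda> that)
  qed
  have L_scale: "\<Lambda> (c *\<^sub>R u) = c * \<Lambda> u" if "u \<in> V" for c u
  proof (rule LIMSEQ_unique)
    show "(\<lambda>n. inner (c *\<^sub>R u) (h (k n))) \<longlonglongrightarrow> \<Lambda> (c *\<^sub>R u)" using that sub by (intro \<Lambda>) (simp add: subspace_scale)
    show "(\<lambda>n. inner (c *\<^sub>R u) (h (k n))) \<longlonglongrightarrow> c * \<Lambda> u"
      unfolding inner_simps by (intro tendsto_mult tendsto_const \<Lambda> that)
  qed
  have L_bd: "\<bar>\<Lambda> u\<bar> \<le> C * norm u" if "u \<in> V" for u
  proof (rule LIMSEQ_le_const2)
    show "(\<lambda>n. \<bar>inner u (h (k n))\<bar>) \<longlonglongrightarrow> \<bar>\<Lambda> u\<bar>" by (intro tendsto_rabs \<Lambda> that)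
    show "\<exists>N. \<forall>n\<ge>N. \<bar>inner u (h (k n))\<bar> \<le> C * norm u" using ib by (simp add: mult.commute)
  qed
  obtain v where v: "v \<in> V" "\<And>u. u \<in> V \<Longrightarrow> \<Lambda> u = inner v u"
    using riesz_on_subspace[OF sub clo L_add L_scale L_bd] by blast
  have "(\<lambda>m. inner w (h (k m))) \<longlonglongrightarrow> inner w v" for w
  proof -
    \<comment> \<open>\<open>w'\<close> is the projection of \<open>w\<close> on \<open>V\<close>;
      both have the same inner products with the sequence and with its limit.\<close>
    obtain w' where w': "w' \<in> V" "\<And>u. u \<in> V \<Longrightarrow> inner w u = inner w' u"
      by (rule riesz_on_subspace[OF sub clo, of "inner w" "norm w"])
         (auto simp: inner_simps Cauchy_Schwarz_ineq2)
    have "(\<lambda>m. inner w' (h (k m))) \<longlonglongrightarrow> \<Lambda> w'" by (rule \<Lambda>[OF w'(1)])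
    moreover have "\<Lambda> w' = inner w v" using v(2)[OF w'(1)] w'(2)[OF v(1)] by (simp add: inner_commute)
    moreover have "inner w' (h (k m)) = inner w (h (k m))" for m using w'(2)[OF hV] by simp
    ultimately show ?thesis by simp
  qed
  with k show thesis using that by blast
qed

section \<open>The Hilbert space of square integrable functions\<close>

lemma L2_measurable [measurable_dest]: "f \<in> L2 \<Longrightarrow> f \<in> borel_measurable lborel"
  by (simp add: L2_def)

lemma L2_integrable_power2: "f \<in> L2 \<Longrightarrow> integrable lborel (\<lambda>x. (cmod (f x))\<^sup>2)"
  by (simp add: L2_def)

lemma L2_dominated:
  assumes "g \<in> L2" "f \<in> borel_measurable lborel" "AE x in lborel. cmod (f x) \<le> C * cmod (g x)"
  shows "f \<in> L2"
proof -
  have "integrable lborel (\<lambda>x. (cmod (f x))\<^sup>2)"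
  proof (rule Bochner_Integration.integrable_bound)
    show "integrable lborel (\<lambda>x. C\<^sup>2 * (cmod (g x))\<^sup>2)" using L2_integrable_power2[OF assms(1)] by simp
    show "AE x in lborel. norm ((cmod (f x))\<^sup>2) \<le> norm (C\<^sup>2 * (cmod (g x))\<^sup>2)"
      using assms(3)
    proof eventually_elim
      case (elim x)
      then show ?case using power_mono[OF elim, of 2] by (simp add: power_mult_distrib)
    qed
  qed (use assms(2) in measurable)
  then show ?thesis using assms(2) by (simp add: L2_def)
qed

lemma L2_cong_AE: "f \<in> L2 \<Longrightarrow> g \<in> borel_measurable lborel \<Longrightarrow> AE x in lborel. g x = f x \<Longrightarrow> g \<in> L2"
  by (rule L2_dominated[of f g 1]) auto

lemma L2_mult_bounded:
  assumes "g \<in> L2" "b \<in> borel_measurable lborel" "\<And>x. cmod (b x) \<le> C"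
  shows "(\<lambda>x. b x * g x) \<in> L2"
proof (rule L2_dominated[OF assms(1), of _ C])
  show "(\<lambda>x. b x * g x) \<in> borel_measurable lborel"
    using assms(2) L2_measurable[OF assms(1)] by simp
qed (simp add: norm_mult mult_right_mono assms(3))

lemma L2_cmult: "g \<in> L2 \<Longrightarrow> (\<lambda>x. c * g x) \<in> L2"
  by (rule L2_mult_bounded[of _ _ "cmod c"]) auto

lemma cnj_borel_measurable [measurable]: "cnj \<in> borel_measurable borel"
  by (intro borel_measurable_continuous_onI continuous_intros)

lemma L2_cnj: "g \<in> L2 \<Longrightarrow> (\<lambda>x. cnj (g x)) \<in> L2"
  by (rule L2_dominated[of g _ 1]) (auto dest: L2_measurable)

lemma L2_add:
  assumes "f \<in> L2" "g \<in> L2"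
  shows "(\<lambda>x. f x + g x) \<in> L2"
proof -
  have "integrable lborel (\<lambda>x. (cmod (f x + g x))\<^sup>2)"
  proof (rule Bochner_Integration.integrable_bound)
    show "integrable lborel (\<lambda>x. 2 * (cmod (f x))\<^sup>2 + 2 * (cmod (g x))\<^sup>2)"
      using assms[THEN L2_integrable_power2] by simp
    show "AE x in lborel. norm ((cmod (f x + g x))\<^sup>2) \<le> norm (2 * (cmod (f x))\<^sup>2 + 2 * (cmod (g x))\<^sup>2)"
    proof (rule AE_I2)
      fix x
      have "(cmod (f x + g x))\<^sup>2 \<le> (cmod (f x) + cmod (g x))\<^sup>2"
        by (intro power_mono norm_triangle_ineq norm_ge_zero)
      moreover have "0 \<le> (cmod (f x) - cmod (g x))\<^sup>2" by simp
      ultimately show "norm ((cmod (f x + g x))\<^sup>2) \<le> norm (2 * (cmod (f x))\<^sup>2 + 2 * (cmod (g x))\<^sup>2)"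
        by (simp add: power2_sum power2_diff)
    qed
  qed (use assms in measurable)
  moreover have "(\<lambda>x. f x + g x) \<in> borel_measurable lborel" using assms by measurable
  ultimately show ?thesis by (simp add: L2_def)
qed

lemma L2_uminus: "g \<in> L2 \<Longrightarrow> (\<lambda>x. - g x) \<in> L2"
  using L2_cmult[of g "-1"] by simp

lemma L2_diff: "f \<in> L2 \<Longrightarrow> g \<in> L2 \<Longrightarrow> (\<lambda>x. f x - g x) \<in> L2"
  using L2_add[OF _ L2_uminus, of f g] by simp

lemma L2_zero: "(\<lambda>x. 0) \<in> L2"
  by (simp add: L2_def)

lemma L2_integrable_mult:
  assumes "f \<in> L2" "g \<in> L2"
  shows "integrable lborel (\<lambda>x. f x * g x)"
proof (rule Bochner_Integration.integrable_bound)
  show "integrable lborel (\<lambda>x. (cmod (f x))\<^sup>2 + (cmod (g x))\<^sup>2)"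
    using assms[THEN L2_integrable_power2] by simp
  show "AE x in lborel. norm (f x * g x) \<le> norm ((cmod (f x))\<^sup>2 + (cmod (g x))\<^sup>2)"
  proof (rule AE_I2)
    fix x
    have "0 \<le> (cmod (f x) - cmod (g x))\<^sup>2" "0 \<le> (cmod (f x))\<^sup>2" "0 \<le> (cmod (g x))\<^sup>2" by simp_all
    moreover have "0 \<le> cmod (f x) * cmod (g x)" by simp
    ultimately have "cmod (f x) * cmod (g x) \<le> (cmod (f x))\<^sup>2 + (cmod (g x))\<^sup>2"
      unfolding power2_diff by linarith
    then show "norm (f x * g x) \<le> norm ((cmod (f x))\<^sup>2 + (cmod (g x))\<^sup>2)"
      by (simp add: norm_mult)
  qed
qed (use assms in measurable)

lemma L2_integrable_mult_cnj: "f \<in> L2 \<Longrightarrow> g \<in> L2 \<Longrightarrow> integrable lborel (\<lambda>x. f x * cnj (g x))"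
  by (intro L2_integrable_mult L2_cnj)

definition L2_inner :: "(real \<Rightarrow> complex) \<Rightarrow> (real \<Rightarrow> complex) \<Rightarrow> complex" where
  "L2_inner f g = (LINT x|lborel. f x * cnj (g x))"

lemma lp_norm_2: "lp_norm 2 f = sqrt (LINT x|lborel. (cmod (f x))\<^sup>2)"
  by (simp add: lp_norm_def sqrt_def)

lemma lp_norm_2_power2: "(lp_norm 2 f)\<^sup>2 = (LINT x|lborel. (cmod (f x))\<^sup>2)"
  by (simp add: lp_norm_2)

lemma L2_inner_self: "L2_inner f f = of_real ((lp_norm 2 f)\<^sup>2)"
proof -
  have "f x * cnj (f x) = of_real ((cmod (f x))\<^sup>2)" for x
    by (simp add: complex_norm_square[symmetric])
  then show ?thesis unfolding L2_inner_def lp_norm_2_power2 by (simp only: integral_complex_of_real)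
qed

lemma L2_inner_cong_AE:
  assumes "AE x in lborel. f x = f' x" "AE x in lborel. g x = g' x"
    "f \<in> L2" "f' \<in> L2" "g \<in> L2" "g' \<in> L2"
  shows "L2_inner f g = L2_inner f' g'"
proof -
  have [measurable]: "f \<in> borel_measurable borel" "f' \<in> borel_measurable borel"
    "g \<in> borel_measurable borel" "g' \<in> borel_measurable borel"
    using assms(3-6)[THEN L2_measurable] by simp_all
  show ?thesis
    unfolding L2_inner_def by (rule integral_cong_AE) (use assms(1,2) in \<open>auto\<close>)
qed

lemma L2_inner_add: "f \<in> L2 \<Longrightarrow> g \<in> L2 \<Longrightarrow> h \<in> L2 \<Longrightarrow> L2_inner (\<lambda>x. f x + g x) h = L2_inner f h + L2_inner g h"
  unfolding L2_inner_def by (simp add: distrib_right L2_integrable_mult_cnj)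

lemma L2_inner_diff: "f \<in> L2 \<Longrightarrow> g \<in> L2 \<Longrightarrow> h \<in> L2 \<Longrightarrow> L2_inner (\<lambda>x. f x - g x) h = L2_inner f h - L2_inner g h"
  unfolding L2_inner_def by (simp add: left_diff_distrib L2_integrable_mult_cnj)

lemma L2_inner_cmult: "L2_inner (\<lambda>x. c * f x) h = c * L2_inner f h"
  unfolding L2_inner_def by (simp add: mult.assoc)

lemma L2_inner_commute: "L2_inner f g = cnj (L2_inner g f)"
proof -
  have "cnj (L2_inner g f) = (LINT x|lborel. cnj (g x * cnj (f x)))"
    unfolding L2_inner_def by (simp only: Bochner_Integration.integral_cnj)
  then show ?thesis by (simp add: L2_inner_def mult.commute)
qed

lemma L2_inner_add_right: "f \<in> L2 \<Longrightarrow> g \<in> L2 \<Longrightarrow> h \<in> L2 \<Longrightarrow> L2_inner h (\<lambda>x. f x + g x) = L2_inner h f + L2_inner h g"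
  by (simp add: L2_inner_commute[of h] L2_inner_add)

lemma L2_inner_diff_right: "f \<in> L2 \<Longrightarrow> g \<in> L2 \<Longrightarrow> h \<in> L2 \<Longrightarrow> L2_inner h (\<lambda>x. f x - g x) = L2_inner h f - L2_inner h g"
  by (simp add: L2_inner_commute[of h] L2_inner_diff)

lemma L2_inner_cmult_right: "L2_inner h (\<lambda>x. c * f x) = cnj c * L2_inner h f"
  by (simp add: L2_inner_commute[of h] L2_inner_cmult)

lemma lp_norm_2_zero_iff:
  assumes "f \<in> L2"
  shows "lp_norm 2 f = 0 \<longleftrightarrow> (AE x in lborel. f x = 0)"
  unfolding lp_norm_2 using assms
  by (simp add: integral_nonneg_eq_0_iff_AE L2_integrable_power2)

section \<open>Square integrable functions modulo null sets as a complete inner product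
  space\<close>

definition l2rel :: "(real \<Rightarrow> complex) \<Rightarrow> (real \<Rightarrow> complex) \<Rightarrow> bool" where
  "l2rel f g \<longleftrightarrow> f \<in> L2 \<and> g \<in> L2 \<and> (AE x in lborel. f x = g x)"

\<comment> \<open>The quotient is partial: functions outside \<open>L2\<close> have no class. Its
  purpose is to make completeness and weak compactness available through the type classes for inner
  product spaces.\<close>
quotient_type l2 = "real \<Rightarrow> complex" / partial: l2rel
  morphisms rep_l2 abs_l2
proof (rule part_equivpI)
  show "\<exists>x. l2rel x x" using L2_zero by (auto simp: l2rel_def)
  show "symp l2rel" by (rule sympI) (auto simp: l2rel_def eq_commute)
  show "transp l2rel" by (rule transpI) (auto simp: l2rel_def elim: AE_mp)
qed

lemma rep_l2_L2 [simp]: "rep_l2 h \<in> L2"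
  using Quotient_rep_reflp[OF Quotient_l2] by (auto simp: l2rel_def)

lemma abs_rep_l2 [simp]: "abs_l2 (rep_l2 h) = h"
  by (rule Quotient_abs_rep[OF Quotient_l2])

lemma abs_l2_eq_iff: "f \<in> L2 \<Longrightarrow> g \<in> L2 \<Longrightarrow> abs_l2 f = abs_l2 g \<longleftrightarrow> (AE x in lborel. f x = g x)"
  using Quotient_rel[OF Quotient_l2, of f g] by (auto simp: l2rel_def)

text \<open>The structure is that of a real Hilbert space, with the real part of the complex
  pairing. Imaginary parts are recovered, where they matter, by testing against \<open>\<i>\<close>
  times a function.\<close>

instantiation l2 :: real_inner
begin

lift_definition zero_l2 :: l2 is "\<lambda>x. 0" by (simp add: l2rel_def L2_zero)
lift_definition plus_l2 :: "l2 \<Rightarrow> l2 \<Rightarrow> l2" is "\<lambda>f g x. f x + g x"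
  by (auto simp: l2rel_def L2_add)
lift_definition minus_l2 :: "l2 \<Rightarrow> l2 \<Rightarrow> l2" is "\<lambda>f g x. f x - g x"
  by (auto simp: l2rel_def L2_diff)
lift_definition uminus_l2 :: "l2 \<Rightarrow> l2" is "\<lambda>f x. - f x"
  by (auto simp: l2rel_def L2_uminus)
lift_definition scaleR_l2 :: "real \<Rightarrow> l2 \<Rightarrow> l2" is "\<lambda>c f x. of_real c * f x"
  by (auto simp: l2rel_def L2_cmult)
lift_definition inner_l2 :: "l2 \<Rightarrow> l2 \<Rightarrow> real" is "\<lambda>f g. Re (L2_inner f g)"
  by (auto simp: l2rel_def intro!: arg_cong[of _ _ Re] L2_inner_cong_AE)

definition norm_l2 :: "l2 \<Rightarrow> real" where "norm_l2 h = sqrt (inner h h)"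
definition dist_l2 :: "l2 \<Rightarrow> l2 \<Rightarrow> real" where "dist_l2 g h = norm (g - h)"
definition sgn_l2 :: "l2 \<Rightarrow> l2" where "sgn_l2 h = inverse (norm h) *\<^sub>R h"
definition uniformity_l2 :: "(l2 \<times> l2) filter" where
  "uniformity_l2 = (INF e\<in>{0<..}. principal {(x, y). dist x y < e})"
definition open_l2 :: "l2 set \<Rightarrow> bool" where
  "open_l2 U = (\<forall>x\<in>U. eventually (\<lambda>(x', y). x' = x \<longrightarrow> y \<in> U) uniformity)"

instance
proof
  fix f g h :: l2 and a b :: real
  show "dist f g = norm (f - g)" by (rule dist_l2_def)
  show "f + g + h = f + (g + h)" by transfer (simp add: l2rel_def L2_add add.assoc)
  show "f + g = g + f" by transfer (simp add: l2rel_def L2_add add.commute)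
  show "0 + f = f" by transfer (simp add: l2rel_def)
  show "- f + f = 0" by transfer (simp add: l2rel_def L2_zero)
  show "f - g = f + - g" by transfer (simp add: l2rel_def L2_diff)
  show "a *\<^sub>R (f + g) = a *\<^sub>R f + a *\<^sub>R g"
  proof transfer
    fix a :: real and f g assume "l2rel f f" "l2rel g g"
    then have "f \<in> L2" "g \<in> L2" by (simp_all add: l2rel_def)
    from L2_cmult[OF L2_add[OF this]] show "l2rel (\<lambda>x. of_real a * (f x + g x)) (\<lambda>x. of_real a * f x + of_real a * g x)"
      by (simp add: l2rel_def distrib_left)
  qed
  show "(a + b) *\<^sub>R f = a *\<^sub>R f + b *\<^sub>R f"
  proof transfer
    fix a b :: real and f assume "l2rel f f"
    then have "f \<in> L2" by (simp add: l2rel_def)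
    from L2_cmult[OF this, of "of_real (a + b)"] show "l2rel (\<lambda>x. of_real (a + b) * f x) (\<lambda>x. of_real a * f x + of_real b * f x)"
      by (simp add: l2rel_def distrib_right)
  qed
  show "a *\<^sub>R b *\<^sub>R f = (a * b) *\<^sub>R f"
  proof transfer
    fix a b :: real and f assume "l2rel f f"
    then have "f \<in> L2" by (simp add: l2rel_def)
    from L2_cmult[OF this, of "of_real (a * b)"] show "l2rel (\<lambda>x. of_real a * (of_real b * f x)) (\<lambda>x. of_real (a * b) * f x)"
      by (simp add: l2rel_def mult.assoc)
  qed
  show "1 *\<^sub>R f = f" by transfer (simp add: l2rel_def)
  show "sgn f = inverse (norm f) *\<^sub>R f" by (simp add: sgn_l2_def)
  show "uniformity = (INF e\<in>{0<..}. principal {(x::l2, y). dist x y < e})" by (rule uniformity_l2_def)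
  show "open U = (\<forall>x\<in>U. eventually (\<lambda>(x', y). x' = x \<longrightarrow> y \<in> U) uniformity)" for U :: "l2 set"
    by (rule open_l2_def)
  show "inner f g = inner g f"
    by transfer (subst L2_inner_commute, simp)
  show "inner (f + g) h = inner f h + inner g h" by transfer (simp add: l2rel_def L2_inner_add)
  show "inner (a *\<^sub>R f) g = a * inner f g" by transfer (simp add: L2_inner_cmult)
  show "0 \<le> inner f f" by transfer (simp add: L2_inner_self)
  show "inner f f = 0 \<longleftrightarrow> f = 0" by transfer (simp add: l2rel_def L2_inner_self lp_norm_2_zero_iff L2_zero)
  show "norm f = sqrt (inner f f)" by (rule norm_l2_def)
qed

end

lemma abs_l2_add: "f \<in> L2 \<Longrightarrow> g \<in> L2 \<Longrightarrow> abs_l2 f + abs_l2 g = abs_l2 (\<lambda>x. f x + g x)"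
  by (simp add: plus_l2.abs_eq l2rel_def)

lemma abs_l2_diff: "f \<in> L2 \<Longrightarrow> g \<in> L2 \<Longrightarrow> abs_l2 f - abs_l2 g = abs_l2 (\<lambda>x. f x - g x)"
  by (simp add: minus_l2.abs_eq l2rel_def)

lemma abs_l2_scaleR: "f \<in> L2 \<Longrightarrow> c *\<^sub>R abs_l2 f = abs_l2 (\<lambda>x. of_real c * f x)"
  by (simp add: scaleR_l2.abs_eq l2rel_def)

lemma inner_abs_l2: "f \<in> L2 \<Longrightarrow> g \<in> L2 \<Longrightarrow> inner (abs_l2 f) (abs_l2 g) = Re (L2_inner f g)"
  by (simp add: inner_l2.abs_eq l2rel_def)

lemma norm_abs_l2: "f \<in> L2 \<Longrightarrow> norm (abs_l2 f) = lp_norm 2 f"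
  by (simp add: norm_eq_sqrt_inner inner_abs_l2 L2_inner_self lp_norm_2)

lemma L2_nn_integral:
  "f \<in> L2 \<Longrightarrow> (\<integral>\<^sup>+x. ennreal ((cmod (f x))\<^sup>2) \<partial>lborel) = ennreal ((lp_norm 2 f)\<^sup>2)"
  unfolding lp_norm_2_power2 by (rule nn_integral_eq_integral) (auto dest: L2_integrable_power2)

lemma L2I_nn_integral:
  assumes "f \<in> borel_measurable lborel" "(\<integral>\<^sup>+x. ennreal ((cmod (f x))\<^sup>2) \<partial>lborel) < \<infinity>"
  shows "f \<in> L2"
proof -
  have "integrable lborel (\<lambda>x. (cmod (f x))\<^sup>2)"
    by (rule integrableI_bounded) (use assms in auto)
  then show ?thesis using assms(1) by (simp add: L2_def)
qed

lemma lp_norm_2_nonneg [simp]: "0 \<le> lp_norm 2 f"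
  by (simp add: lp_norm_2)

lemma L2_nn_integral_le:
  assumes "f \<in> L2" "(\<integral>\<^sup>+x. ennreal ((cmod (f x))\<^sup>2) \<partial>lborel) \<le> ennreal (C\<^sup>2)" "C \<ge> 0"
  shows "lp_norm 2 f \<le> C"
proof -
  have "ennreal ((lp_norm 2 f)\<^sup>2) \<le> ennreal (C\<^sup>2)" using assms L2_nn_integral by simp
  then have "(lp_norm 2 f)\<^sup>2 \<le> C\<^sup>2" by (simp add: ennreal_le_iff)
  then show ?thesis using assms(3) by (rule power2_le_imp_le)
qed

text \<open>Riesz--Fischer: along a subsequence with distances below \<open>4\<^sup>-\<^sup>k\<close> the weighted sum of the squared
  increments is integrable, hence the subsequence converges almost everywhere.\<close>
instance l2 :: complete_space
proof
  fix X :: "nat \<Rightarrow> l2" assume X: "Cauchy X"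
  define f where "f n = rep_l2 (X n)" for n
  have f: "f n \<in> L2" for n by (simp add: f_def)
  have Xf: "X n = abs_l2 (f n)" for n by (simp add: f_def)
  have fm [measurable]: "f n \<in> borel_measurable borel" for n using L2_measurable[OF f] by simp
  have dXf: "dist (X n) (X m) = lp_norm 2 (\<lambda>x. f n x - f m x)" for n m
    by (simp add: Xf dist_norm abs_l2_diff f norm_abs_l2 L2_diff)
  have "\<exists>N. \<forall>m\<ge>N. \<forall>n\<ge>N. dist (X m) (X n) < (1/4) ^ k" for k :: nat
    using X by (intro metric_CauchyD) auto
  then obtain N where N: "\<And>k m n. N k \<le> m \<Longrightarrow> N k \<le> n \<Longrightarrow> dist (X m) (X n) < (1/4) ^ k" by metis
  \<comment> \<open>The sum dominates each \<open>N k\<close>, and the summand \<open>k\<close>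
    makes the index strictly increasing.\<close>
  define r where "r k = (\<Sum>i\<le>k. N i) + k" for k
  have rN: "N k \<le> r k" for k unfolding r_def by (rule trans_le_add1) (rule member_le_sum, auto)
  have "r k < r (Suc k)" for k unfolding r_def by simp
  then have r: "strict_mono r" by (simp add: strict_mono_Suc_iff)
  define d where "d k x = f (r (Suc k)) x - f (r k) x" for k x
  have d: "d k \<in> L2" for k unfolding d_def by (intro L2_diff f)
  have dm [measurable]: "d k \<in> borel_measurable borel" for k using L2_measurable[OF d] by simp
  have "lp_norm 2 (d k) \<le> (1/4) ^ k" for k
  proof -
    have "N k \<le> r (Suc k)" using rN[of k] strict_monoD[OF r lessI[of k]] by simp
    from N[OF this rN[of k]] show ?thesis unfolding dXf d_def by simp
  qed
  then have dk: "(lp_norm 2 (d k))\<^sup>2 \<le> (1/16) ^ k" for k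
    using power_mono[of "lp_norm 2 (d k)" "(1/4) ^ k" 2]
    by (simp add: power_mult[symmetric] mult.commute[of k]) (simp add: power_mult power2_eq_square)
  have "(\<integral>\<^sup>+x. (\<Sum>k. ennreal (4 ^ k * (cmod (d k x))\<^sup>2)) \<partial>lborel)
      = (\<Sum>k. \<integral>\<^sup>+x. ennreal (4 ^ k * (cmod (d k x))\<^sup>2) \<partial>lborel)"
    by (rule nn_integral_suminf) measurable
  also have "\<dots> \<le> (\<Sum>k. ennreal ((1/4) ^ k))"
  proof (rule suminf_le)
    fix k
    have "(\<integral>\<^sup>+x. ennreal (4 ^ k * (cmod (d k x))\<^sup>2) \<partial>lborel) = ennreal (4 ^ k) * (\<integral>\<^sup>+x. ennreal ((cmod (d k x))\<^sup>2) \<partial>lborel)"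
      by (simp add: ennreal_mult' nn_integral_cmult)
    also have "\<dots> = ennreal (4 ^ k * (lp_norm 2 (d k))\<^sup>2)"
      by (simp add: L2_nn_integral d ennreal_mult')
    also have "\<dots> \<le> ennreal (4 ^ k * (1/16) ^ k)" using dk by (intro ennreal_leI mult_left_mono) auto
    also have "4 ^ k * (1/16) ^ k = (1/4::real) ^ k" by (simp flip: power_mult_distrib)
    finally show "(\<integral>\<^sup>+x. ennreal (4 ^ k * (cmod (d k x))\<^sup>2) \<partial>lborel) \<le> ennreal ((1/4) ^ k)" .
  qed auto
  also have "\<dots> = ennreal (\<Sum>k. (1/4) ^ k)" by (rule suminf_ennreal2) (auto intro: summable_geometric)
  finally have "(\<integral>\<^sup>+x. (\<Sum>k. ennreal (4 ^ k * (cmod (d k x))\<^sup>2)) \<partial>lborel) < top"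
    using ennreal_less_top by (rule order.strict_trans1)
  then have "(\<integral>\<^sup>+x. (\<Sum>k. ennreal (4 ^ k * (cmod (d k x))\<^sup>2)) \<partial>lborel) \<noteq> \<infinity>" by simp
  then have AEfin: "AE x in lborel. (\<Sum>k. ennreal (4 ^ k * (cmod (d k x))\<^sup>2)) \<noteq> \<infinity>"
    by (intro nn_integral_PInf_AE) measurable
  have conv: "convergent (\<lambda>k. f (r k) x)" if x: "(\<Sum>k. ennreal (4 ^ k * (cmod (d k x))\<^sup>2)) \<noteq> \<infinity>" for x
  proof -
    define B where "B = enn2real (\<Sum>k. ennreal (4 ^ k * (cmod (d k x))\<^sup>2))"
    have B: "ennreal B = (\<Sum>k. ennreal (4 ^ k * (cmod (d k x))\<^sup>2))"
      unfolding B_def using x by (intro ennreal_enn2real) (simp add: less_top)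
    \<comment> \<open>A single term of the series is at most its sum; this is turned below into
      geometric decay of the increments.\<close>
    have "(\<Sum>i\<in>{k}. ennreal (4 ^ i * (cmod (d i x))\<^sup>2)) \<le> ennreal B" for k
      unfolding B by (rule sum_le_suminf) auto
    then have B': "4 ^ k * (cmod (d k x))\<^sup>2 \<le> B" for k by (simp add: B_def)
    have B0: "0 \<le> B" by (simp add: B_def)
    have "cmod (d k x) \<le> sqrt B * (1/2) ^ k" for k
    proof -
      have "(2 ^ k * cmod (d k x))\<^sup>2 = ((2 ^ k)\<^sup>2) * (cmod (d k x))\<^sup>2" by (rule power_mult_distrib)
      also have "(2 ^ k)\<^sup>2 = (4::real) ^ k" by (simp add: power2_eq_square flip: power_mult_distrib)
      finally have "(2 ^ k * cmod (d k x))\<^sup>2 \<le> B" using B'[of k] by simp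
      then have "2 ^ k * cmod (d k x) \<le> sqrt B" by (rule real_le_rsqrt)
      then have "cmod (d k x) \<le> sqrt B / 2 ^ k" by (simp add: pos_le_divide_eq mult.commute)
      then show ?thesis by (simp add: power_one_over)
    qed
    moreover have "summable (\<lambda>k. (1/2::real) ^ k)" by (rule summable_geometric) simp
    then have "summable (\<lambda>k. sqrt B * (1/2) ^ k)" by (rule summable_mult)
    ultimately have "summable (\<lambda>k. d k x)" by (rule summable_comparison_test'[of _ 0, rotated])
    moreover have "(\<Sum>k<n. d k x) = f (r n) x - f (r 0) x" for n
      unfolding d_def by (rule sum_lessThan_telescope)
    ultimately have "convergent (\<lambda>n. f (r n) x - f (r 0) x)" by (simp add: summable_iff_convergent)
    then have "convergent (\<lambda>n. f (r n) x - f (r 0) x + f (r 0) x)" by (intro convergent_add convergent_const)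
    then show ?thesis by simp
  qed
  define g where "g x = lim (\<lambda>k. f (r k) x)" for x
  have g [measurable]: "g \<in> borel_measurable borel" unfolding g_def by measurable
  have lim: "AE x in lborel. (\<lambda>k. f (r k) x) \<longlonglongrightarrow> g x"
    using AEfin by eventually_elim (simp add: conv g_def convergent_LIMSEQ_iff[symmetric])
  \<comment> \<open>Fatou's lemma along the subsequence, at fixed \<open>n\<close>. This one bound
    gives both that \<open>g\<close> is square integrable and that the whole Cauchy sequence
    converges to it, not merely the subsequence.\<close>
  have close: "(\<lambda>x. g x - f n x) \<in> L2 \<and> lp_norm 2 (\<lambda>x. g x - f n x) \<le> e"
    if e: "\<And>m. m \<ge> M \<Longrightarrow> dist (X m) (X n) \<le> e" "e \<ge> 0" for n M e
  proof -
    have "(\<integral>\<^sup>+x. ennreal ((cmod (g x - f n x))\<^sup>2) \<partial>lborel) = (\<integral>\<^sup>+x. liminf (\<lambda>k. ennreal ((cmod (f (r k) x - f n x))\<^sup>2)) \<partial>lborel)"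
    proof (rule nn_integral_cong_AE)
      show "AE x in lborel. ennreal ((cmod (g x - f n x))\<^sup>2) = liminf (\<lambda>k. ennreal ((cmod (f (r k) x - f n x))\<^sup>2))"
        using lim
      proof eventually_elim
        case (elim x)
        have "(\<lambda>k. ennreal ((cmod (f (r k) x - f n x))\<^sup>2)) \<longlonglongrightarrow> ennreal ((cmod (g x - f n x))\<^sup>2)"
          by (intro tendsto_intros elim tendsto_ennrealI)
        from lim_imp_Liminf[OF _ this] show ?case by simp
      qed
    qed
    also have "\<dots> \<le> liminf (\<lambda>k. \<integral>\<^sup>+x. ennreal ((cmod (f (r k) x - f n x))\<^sup>2) \<partial>lborel)"
      by (rule nn_integral_liminf) measurable
    also have "\<dots> = liminf (\<lambda>k. ennreal ((dist (X (r k)) (X n))\<^sup>2))"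
      by (simp add: L2_nn_integral L2_diff f dXf)
    also have "\<dots> \<le> ennreal (e\<^sup>2)"
    proof (rule Liminf_le)
      show "\<forall>\<^sub>F k in sequentially. ennreal ((dist (X (r k)) (X n))\<^sup>2) \<le> ennreal (e\<^sup>2)"
        using eventually_ge_at_top[of M]
      proof eventually_elim
        case (elim k)
        then have "M \<le> r k" using strict_mono_imp_increasing[OF r, of k] by simp
        then show ?case using e(1) by (intro ennreal_leI power_mono) auto
      qed
    qed simp
    finally have le: "(\<integral>\<^sup>+x. ennreal ((cmod (g x - f n x))\<^sup>2) \<partial>lborel) \<le> ennreal (e\<^sup>2)" .
    then have "(\<lambda>x. g x - f n x) \<in> L2"
      by (intro L2I_nn_integral) (auto intro: order.strict_trans1)
    with le e(2) show ?thesis by (simp add: L2_nn_integral_le)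
  qed
  obtain M0 where "\<And>m n. m \<ge> M0 \<Longrightarrow> n \<ge> M0 \<Longrightarrow> dist (X m) (X n) < 1"
    using metric_CauchyD[OF X zero_less_one] by blast
  then have "(\<lambda>x. g x - f M0 x) \<in> L2" using close[of M0 M0 1] by (simp add: less_imp_le)
  from L2_add[OF this f[of M0]] have gL2: "g \<in> L2" by simp
  have "X \<longlonglongrightarrow> abs_l2 g"
  proof (rule metric_LIMSEQ_I)
    fix e :: real assume e: "e > 0"
    obtain M where M: "\<And>m n. m \<ge> M \<Longrightarrow> n \<ge> M \<Longrightarrow> dist (X m) (X n) < e / 2"
      using metric_CauchyD[OF X half_gt_zero[OF e]] by blast
    show "\<exists>M. \<forall>n\<ge>M. dist (X n) (abs_l2 g) < e"
    proof (intro exI[of _ M] allI impI)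
      fix n assume "n \<ge> M"
      then have "lp_norm 2 (\<lambda>x. g x - f n x) \<le> e / 2" using close[of M n "e / 2"] M e by (simp add: less_imp_le)
      moreover have "dist (X n) (abs_l2 g) = lp_norm 2 (\<lambda>x. g x - f n x)"
        by (simp add: dist_commute[of "X n"]) (simp add: Xf dist_norm abs_l2_diff f gL2 norm_abs_l2 L2_diff)
      ultimately show "dist (X n) (abs_l2 g) < e" using e by simp
    qed
  qed
  then show "convergent X" by (rule convergentI)
qed

lemma abs_l2_tendsto_iff:
  assumes "\<And>n. f n \<in> L2" "g \<in> L2"
  shows "((\<lambda>n. abs_l2 (f n)) \<longlongrightarrow> abs_l2 g) F \<longleftrightarrow> ((\<lambda>n. lp_norm 2 (\<lambda>x. f n x - g x)) \<longlongrightarrow> 0) F"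
  unfolding tendsto_dist_iff[of "\<lambda>n. abs_l2 (f n)"]
  by (simp add: dist_norm abs_l2_diff assms norm_abs_l2 L2_diff)

section \<open>Step functions\<close>

lemma subspace_closure_subspace:
  fixes S :: "'a::real_normed_vector set"
  assumes "subspace S"
  shows "subspace (closure S)"
  unfolding subspace_def
proof (intro conjI ballI allI)
  show "0 \<in> closure S" using assms subspace_0 closure_subset by blast
next
  fix x y assume "x \<in> closure S" "y \<in> closure S"
  then obtain f g where "\<And>n. f n \<in> S" "f \<longlonglongrightarrow> x" "\<And>n. g n \<in> S" "g \<longlonglongrightarrow> y"
    unfolding closure_sequential by blast
  then show "x + y \<in> closure S"
    unfolding closure_sequential using assms by (intro exI[of _ "\<lambda>n. f n + g n"]) (simp add: subspace_add tendsto_add)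
next
  fix c x assume "x \<in> closure S"
  then obtain f where "\<And>n. f n \<in> S" "f \<longlonglongrightarrow> x" unfolding closure_sequential by blast
  then show "c *\<^sub>R x \<in> closure S"
    unfolding closure_sequential using assms
    by (intro exI[of _ "\<lambda>n. c *\<^sub>R f n"]) (simp add: subspace_scale tendsto_scaleR)
qed

text \<open>Half-open intervals form a generating system stable under intersection, so vanishing of
  the integrals extends to all Borel sets. Restriction to \<open>{-real n<..real n}\<close> makes
  the function integrable on the whole line, as the complement step of the induction
  requires.\<close>

lemma AE_zero_if_interval_integrals_zero:
  fixes f :: "real \<Rightarrow> complex"
  assumes int: "\<And>a b. set_integrable lborel {a<..b} f"
    and zero: "\<And>a b. (LINT x:{a<..b}|lborel. f x) = 0"
  shows "AE x in lborel. f x = 0"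
proof -
  have "AE x in lborel. x \<in> {-real n<..real n} \<longrightarrow> f x = 0" for n
  proof -
    define g where "g x = indicator {-real n<..real n} x *\<^sub>R f x" for x
    have g: "integrable lborel g" using int unfolding g_def set_integrable_def .
    have gs: "set_integrable lborel A g" if "A \<in> sets borel" for A
      unfolding set_integrable_def using that g by (intro integrable_mult_indicator) auto
    have tot: "(LINT x|lborel. g x) = 0" using zero[of "-real n" "real n"] by (simp add: g_def set_lebesgue_integral_def)
    have *: "(LINT x:A|lborel. g x) = 0" if A: "A \<in> sets lborel" for A
    proof -
      have st: "Int_stable (range (\<lambda>(a, b). {a<..b::real}))"
        by (auto simp: Int_stable_def)
      have cl: "range (\<lambda>(a, b). {a<..b::real}) \<subseteq> Pow UNIV" by simp
      have A': "A \<in> sigma_sets UNIV (range (\<lambda>(a, b). {a<..b::real}))"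
        using A by (simp add: borel_sigma_sets_Ioc)
      have sb: "sigma_sets UNIV (range (\<lambda>(a, b). {a<..b::real})) = sets borel"
        by (simp add: borel_sigma_sets_Ioc)
      show ?thesis
        using st cl A'
      proof (induction rule: sigma_sets_induct_disjoint)
        case (basic A)
        then obtain a b where "A = {a<..b}" by auto
        then have "(LINT x:A|lborel. g x) = (LINT x:{max a (-real n)<..min b (real n)}|lborel. f x)"
          unfolding set_lebesgue_integral_def g_def
          by (intro Bochner_Integration.integral_cong) (auto split: split_indicator)
        then show ?case using zero by simp
      next
        case empty then show ?case by (simp add: set_lebesgue_integral_def)
      next
        case (compl A)
        then have Ab: "A \<in> sets borel" by (simp add: sb)
        have "(LINT x:A \<union> (UNIV - A)|lborel. g x) = (LINT x:A|lborel. g x) + (LINT x:UNIV - A|lborel. g x)"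
          using Ab by (intro set_integral_Un gs) auto
        moreover have "A \<union> (UNIV - A) = UNIV" by auto
        ultimately show ?case using compl tot by (simp add: set_lebesgue_integral_def)
      next
        case (union A)
        then have Ab: "\<And>i. A i \<in> sets borel" using sb by auto
        have "(LINT x:(\<Union>i. A i)|lborel. g x) = (\<Sum>i. (LINT x:(A i)|lborel. g x))"
          using union Ab by (intro lebesgue_integral_countable_add gs) (auto simp: disjoint_family_on_def)
        then show ?case using union by simp
      qed
    qed
    have "AE x in lborel. g x = 0"
      by (rule sigma_finite_measure.density_zero[OF lborel.sigma_finite_measure_axioms g]) (rule *)
    then show ?thesis
      by eventually_elim (auto simp: g_def indicator_def)
  qed
  then have "AE x in lborel. \<forall>n. x \<in> {-real n<..real n} \<longrightarrow> f x = 0" unfolding AE_all_countable by (rule allI)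
  then show ?thesis
  proof eventually_elim
    case (elim x)
    obtain n :: nat where "\<bar>x\<bar> < n" using reals_Archimedean2 by blast
    then show ?case using elim[rule_format, of n] by (simp add: abs_less_iff)
  qed
qed

text \<open>The inductive form lets identities be proved by adding one interval at a time. Half-open
  intervals are the ones that occur in Levy's inversion formula.\<close>

inductive_set step_functions :: "(real \<Rightarrow> complex) set" where
  zero: "(\<lambda>x. 0) \<in> step_functions"
| step: "f \<in> step_functions \<Longrightarrow> (\<lambda>x. c * indicator {a<..b} x + f x) \<in> step_functions"

lemma L2_indicator: "(\<lambda>x. indicator {a<..b::real} x :: complex) \<in> L2"
proof -
  have "integrable lborel (\<lambda>x. indicator {a<..b} x :: real)"
    by (intro integrable_real_indicator) (simp, cases "a \<le> b", simp_all)
  moreover have "(cmod (indicator {a<..b} x))\<^sup>2 = indicator {a<..b} x" for x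
    by (auto split: split_indicator)
  ultimately show ?thesis by (simp add: L2_def)
qed

lemma integrable_indicator_Ioc: "integrable lborel (\<lambda>x. indicator {a<..b::real} x :: complex)"
proof -
  have "integrable lborel (\<lambda>x. complex_of_real (indicator {a<..b} x))"
    by (intro integrable_of_real integrable_real_indicator) (simp, cases "a \<le> b", simp_all)
  moreover have "complex_of_real (indicator {a<..b} x) = indicator {a<..b} x" for x
    by (auto split: split_indicator)
  ultimately show ?thesis by simp
qed

lemma step_functions_L2: "f \<in> step_functions \<Longrightarrow> f \<in> L2"
  by (induction rule: step_functions.induct) (simp_all add: L2_zero L2_add L2_cmult L2_indicator)

lemma step_functions_integrable: "f \<in> step_functions \<Longrightarrow> integrable lborel f"
  by (induction rule: step_functions.induct) (simp_all add: integrable_indicator_Ioc)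

lemma step_functions_add: "f \<in> step_functions \<Longrightarrow> g \<in> step_functions \<Longrightarrow> (\<lambda>x. f x + g x) \<in> step_functions"
  by (induction rule: step_functions.induct) (auto simp: add.assoc intro: step_functions.intros)

lemma step_functions_cmult: "f \<in> step_functions \<Longrightarrow> (\<lambda>x. d * f x) \<in> step_functions"
proof (induction rule: step_functions.induct)
  case (step f c a b)
  from step_functions.step[OF step.IH, of "d * c" a b] show ?case by (simp add: distrib_left mult.assoc)
qed (auto intro: step_functions.zero)

text \<open>A function orthogonal to the indicator of every interval has vanishing integral over
  every interval, hence is 0 almost everywhere; the criterion for closed subspaces then
  applies.\<close>

lemma step_functions_dense:
  assumes "f \<in> L2"
  obtains s where "\<And>n::nat. s n \<in> step_functions" "(\<lambda>n. abs_l2 (s n)) \<longlonglongrightarrow> abs_l2 f"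
proof -
  let ?S = "abs_l2 ` step_functions"
  have sub: "subspace ?S"
    unfolding subspace_def
  proof (intro conjI ballI allI)
    have "(0::l2) = abs_l2 (\<lambda>x. 0)" by (rule zero_l2.abs_eq) 
    then show "0 \<in> ?S" using step_functions.zero by blast
    show "x + y \<in> ?S" if "x \<in> ?S" "y \<in> ?S" for x y
      using that by (auto simp: abs_l2_add step_functions_L2 intro!: imageI step_functions_add)
    show "c *\<^sub>R x \<in> ?S" if "x \<in> ?S" for x c
      using that by (auto simp: abs_l2_scaleR step_functions_L2 intro!: imageI step_functions_cmult)
  qed
  have "closure ?S = UNIV"
  proof (rule closed_subspace_eq_UNIV)
    show "subspace (closure ?S)" using sub by (rule subspace_closure_subspace)
    fix w assume w: "\<And>u. u \<in> closure ?S \<Longrightarrow> inner w u = 0"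
    define f where "f = rep_l2 w"
    have f: "f \<in> L2" and wf: "w = abs_l2 f" by (simp_all add: f_def)
    have Re0: "Re (L2_inner f s) = 0" if "s \<in> step_functions" for s
    proof -
      have "abs_l2 s \<in> closure ?S" by (rule subsetD[OF closure_subset imageI[OF that]])
      from w[OF this] show ?thesis by (simp add: wf inner_abs_l2 f step_functions_L2[OF that])
    qed
    have ind: "(\<lambda>x. indicator {a<..b} x) \<in> step_functions" for a b :: real
      using step_functions.step[OF step_functions.zero, of 1 a b] by simp
    have zero: "L2_inner f (\<lambda>x. indicator {a<..b} x) = 0" for a b :: real
    proof (rule complex_eqI)
      show "Re (L2_inner f (\<lambda>x. indicator {a<..b} x)) = Re 0" using Re0[OF ind] by simp
      \<comment> \<open>The inner product of \<open>l2\<close> sees real parts only; the factor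
        \<open>\<i>\<close> turns the imaginary part into one.\<close>
      have "Re (L2_inner f (\<lambda>x. \<i> * indicator {a<..b} x)) = 0"
        using Re0[OF step_functions_cmult[OF ind]] .
      then show "Im (L2_inner f (\<lambda>x. indicator {a<..b} x)) = Im 0" by (simp add: L2_inner_cmult_right)
    qed
    have eq: "f x * cnj (indicator {a<..b} x) = indicator {a<..b} x *\<^sub>R f x" for a b x :: real
      by (auto split: split_indicator)
    have "AE x in lborel. f x = 0"
    proof (rule AE_zero_if_interval_integrals_zero)
      show "set_integrable lborel {a<..b} f" for a b
        using L2_integrable_mult_cnj[OF f L2_indicator[of a b]] unfolding eq set_integrable_def .
      show "(LINT x:{a<..b}|lborel. f x) = 0" for a b
        using zero[of a b] unfolding L2_inner_def eq set_lebesgue_integral_def .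
    qed
    then have "w = abs_l2 (\<lambda>x. 0)" using f by (simp add: wf abs_l2_eq_iff L2_zero)
    then show "w = 0" by (simp add: zero_l2.abs_eq)
  qed simp
  then have "abs_l2 f \<in> closure ?S" by simp
  then obtain u where u: "\<And>n. u n \<in> ?S" "u \<longlonglongrightarrow> abs_l2 f" unfolding closure_sequential by blast
  then have "\<forall>n. \<exists>s. s \<in> step_functions \<and> u n = abs_l2 s" by blast
  then obtain s where s: "\<And>n. s n \<in> step_functions" "\<And>n. u n = abs_l2 (s n)" by metis
  have "u = (\<lambda>n. abs_l2 (s n))" using s(2) by (rule ext)
  with u(2) have "(\<lambda>n. abs_l2 (s n)) \<longlonglongrightarrow> abs_l2 f" by simp
  with s(1) show thesis by (rule that)
qed

section \<open>The Fourier transform\<close>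

text \<open>The absolutely convergent integral, defined at every frequency. \<open>fourier\<close>
  is a choice of an \<open>L2\<close> limit and is compared with it almost everywhere, for functions
  that are both integrable and square integrable.\<close>

definition ft :: "(real \<Rightarrow> complex) \<Rightarrow> real \<Rightarrow> complex" where
  "ft f \<xi> = (LINT x|lborel. cis (- (x * \<xi>)) * f x)"

lemma cis_borel_measurable [measurable]: "cis \<in> borel_measurable borel"
  by (intro borel_measurable_continuous_onI continuous_intros)

lemma ft_borel_measurable [measurable]:
  assumes [measurable]: "f \<in> borel_measurable borel"
  shows "ft f \<in> borel_measurable borel"
  unfolding ft_def[abs_def] by measurable

lemma integrable_cis_mult:
  assumes "integrable lborel f" "\<theta> \<in> borel_measurable borel"
  shows "integrable lborel (\<lambda>x. cis (\<theta> x) * f x)"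
proof (rule Bochner_Integration.integrable_bound[OF assms(1)])
  have [measurable]: "f \<in> borel_measurable borel" "\<theta> \<in> borel_measurable borel"
    using borel_measurable_integrable[OF assms(1)] assms(2) by simp_all
  show "(\<lambda>x. cis (\<theta> x) * f x) \<in> borel_measurable lborel" by measurable
qed (simp add: norm_mult)

lemma ft_bound:
  assumes "integrable lborel f"
  shows "cmod (ft f \<xi>) \<le> (LINT x|lborel. cmod (f x))"
proof -
  have "cmod (ft f \<xi>) \<le> (LINT x|lborel. cmod (cis (- (x * \<xi>)) * f x))"
    unfolding ft_def by (rule integral_norm_bound)
  then show ?thesis by (simp add: norm_mult)
qed

lemma ft_add: "integrable lborel f \<Longrightarrow> integrable lborel g \<Longrightarrow> ft (\<lambda>x. f x + g x) \<xi> = ft f \<xi> + ft g \<xi>"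
  unfolding ft_def distrib_left by (intro Bochner_Integration.integral_add integrable_cis_mult) auto

lemma ft_diff: "integrable lborel f \<Longrightarrow> integrable lborel g \<Longrightarrow> ft (\<lambda>x. f x - g x) \<xi> = ft f \<xi> - ft g \<xi>"
  unfolding ft_def right_diff_distrib by (intro Bochner_Integration.integral_diff integrable_cis_mult) auto

lemma ft_cmult: "ft (\<lambda>x. c * f x) \<xi> = c * ft f \<xi>"
  unfolding ft_def by (simp add: mult.left_commute)

lemma ft_zero: "ft (\<lambda>x. 0) \<xi> = 0"
  by (simp add: ft_def)

text \<open>Fubini's theorem. Moving the transform to the other factor is what identifies limits of
  transforms and, combined with Parseval's identity, yields inversion.\<close>

lemma ft_mult:
  assumes f: "integrable lborel f" and g: "integrable lborel g"
  shows "(LINT \<xi>|lborel. ft f \<xi> * g \<xi>) = (LINT x|lborel. f x * ft g x)"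
proof -
  have [measurable]: "f \<in> borel_measurable borel" "g \<in> borel_measurable borel"
    using borel_measurable_integrable[OF f] borel_measurable_integrable[OF g] by simp_all
  have int: "integrable (lborel \<Otimes>\<^sub>M lborel) (\<lambda>(x, \<xi>). cis (- (x * \<xi>)) * f x * g \<xi>)"
  proof (rule lborel_pair.Fubini_integrable)
    show "(\<lambda>(x, \<xi>). cis (- (x * \<xi>)) * f x * g \<xi>) \<in> borel_measurable (lborel \<Otimes>\<^sub>M lborel)" by measurable
    show "integrable lborel (\<lambda>x. LINT y|lborel. norm (case (x, y) of (x, \<xi>) \<Rightarrow> cis (- (x * \<xi>)) * f x * g \<xi>))"
      using f by (simp add: norm_mult)
    show "AE x in lborel. integrable lborel (\<lambda>y. case (x, y) of (x, \<xi>) \<Rightarrow> cis (- (x * \<xi>)) * f x * g \<xi>)"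
    proof (rule AE_I2)
      fix x :: real
      have "integrable lborel (\<lambda>\<xi>. f x * (cis (- (x * \<xi>)) * g \<xi>))"
        by (intro integrable_mult_right integrable_cis_mult g) auto
      then show "integrable lborel (\<lambda>y. case (x, y) of (x, \<xi>) \<Rightarrow> cis (- (x * \<xi>)) * f x * g \<xi>)"
        by (simp add: mult_ac)
    qed
  qed
  have "(LINT \<xi>|lborel. ft f \<xi> * g \<xi>) = (LINT \<xi>|lborel. (LINT x|lborel. cis (- (x * \<xi>)) * f x * g \<xi>))"
    unfolding ft_def by simp
  also have "\<dots> = (LINT x|lborel. (LINT \<xi>|lborel. cis (- (x * \<xi>)) * f x * g \<xi>))"
    using lborel_pair.Fubini_integral[OF int] .
  also have "\<dots> = (LINT x|lborel. f x * ft g x)"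
    unfolding ft_def by (intro Bochner_Integration.integral_cong refl) (simp add: mult_ac flip: integral_mult_right_zero)
  finally show ?thesis .
qed

abbreviation ind :: "real \<Rightarrow> real \<Rightarrow> real \<Rightarrow> complex" where
  "ind a b \<equiv> (\<lambda>x. indicator {a<..b} x)"

lemma ft_ind:
  assumes "a \<le> b" "\<xi> \<noteq> 0"
  shows "ft (ind a b) \<xi> = (cis (- (a * \<xi>)) - cis (- (b * \<xi>))) / (\<i> * \<xi>)"
proof -
  define A where "A = - (\<i> * of_real \<xi>)"
  have A: "A \<noteq> 0" using assms by (simp add: A_def)
  have cA: "cis (- (x * \<xi>)) = exp (x *\<^sub>R A)" for x by (simp add: A_def cis_conv_exp scaleR_conv_of_real algebra_simps)
  have "ft (ind a b) \<xi> = (LINT x|lborel. indicator {a..b} x *\<^sub>R exp (x *\<^sub>R A))"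
    unfolding ft_def cA
  proof (rule integral_cong_AE)
    show "AE x in lborel. exp (x *\<^sub>R A) * indicator {a<..b} x = indicator {a..b} x *\<^sub>R exp (x *\<^sub>R A)"
      using AE_lborel_singleton[of a] by eventually_elim (auto simp: indicator_def)
  qed (auto intro!: borel_measurable_times borel_measurable_scaleR borel_measurable_continuous_onI continuous_intros)
  also have "\<dots> = exp (b *\<^sub>R A) / A - exp (a *\<^sub>R A) / A"
  proof (rule integral_FTC_Icc[OF assms(1)])
    show "((\<lambda>x. exp (x *\<^sub>R A) / A) has_vector_derivative exp (x *\<^sub>R A)) (at x within {a..b})" for x
    proof -
      have "((\<lambda>x. exp (x *\<^sub>R A) / A) has_vector_derivative exp (x *\<^sub>R A) * A / A) (at x within {a..b})"
        by (intro has_vector_derivative_divide exp_scaleR_has_vector_derivative_right)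
      then show ?thesis using A by simp
    qed
  qed (auto intro!: continuous_intros)
  also have "\<dots> = (cis (- (a * \<xi>)) - cis (- (b * \<xi>))) / (\<i> * \<xi>)"
    unfolding cA[symmetric] using assms by (simp add: A_def field_simps)
  finally show ?thesis .
qed

lemma integrable_inverse_1_plus_power2: "integrable lborel (\<lambda>x::real. inverse (1 + x\<^sup>2))"
  using integrable_inverse_1_plus_square by (simp add: set_integrable_def)

lemma ft_ind_L2: "ft (ind a b) \<in> L2"
proof (cases "a \<le> b")
  case ab: True
  \<comment> \<open>The sum of the squares of two bounds: \<open>b - a\<close> for the transform and
    2 for its product with \<open>\<bar>\<xi>\<bar>\<close>. Together they give decay like
    \<open>inverse (1 + \<xi>\<^sup>2)\<close>.\<close>
  define C where "C = (b - a)\<^sup>2 + 4"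
  have le1: "cmod (ft (ind a b) \<xi>) \<le> b - a" for \<xi>
  proof -
    have "cmod (ind a b x) = indicator {a<..b} x" for x by (simp add: indicator_def)
    then have "(LINT x|lborel. cmod (ind a b x)) = measure lborel {a<..b}" by simp
    also have "\<dots> = b - a" using ab by simp
    finally show ?thesis using ft_bound[OF integrable_indicator_Ioc, of a b \<xi>] by (simp only:)
  qed
  have le2: "\<bar>\<xi>\<bar> * cmod (ft (ind a b) \<xi>) \<le> 2" for \<xi>
  proof (cases "\<xi> = 0")
    case False
    have "cmod (cis (- (a * \<xi>)) - cis (- (b * \<xi>))) \<le> 2"
      using norm_triangle_ineq4[of "cis (- (a * \<xi>))" "cis (- (b * \<xi>))"] by simp
    then show ?thesis using False ab by (simp add: ft_ind norm_divide norm_mult)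
  qed simp
  have le: "(cmod (ft (ind a b) \<xi>))\<^sup>2 \<le> C * inverse (1 + \<xi>\<^sup>2)" for \<xi>
  proof -
    have "(cmod (ft (ind a b) \<xi>))\<^sup>2 \<le> (b - a)\<^sup>2" "(\<bar>\<xi>\<bar> * cmod (ft (ind a b) \<xi>))\<^sup>2 \<le> 2\<^sup>2"
      using le1[of \<xi>] le2[of \<xi>] by (intro power_mono; simp)+
    then have "(1 + \<xi>\<^sup>2) * (cmod (ft (ind a b) \<xi>))\<^sup>2 \<le> C" by (simp add: C_def power_mult_distrib algebra_simps)
    moreover have "1 + \<xi>\<^sup>2 > 0" by (simp add: add_pos_nonneg)
    ultimately show ?thesis by (simp add: field_simps)
  qed
  have "integrable lborel (\<lambda>\<xi>. (cmod (ft (ind a b) \<xi>))\<^sup>2)"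
  proof (rule Bochner_Integration.integrable_bound)
    show "integrable lborel (\<lambda>\<xi>. C * inverse (1 + \<xi>\<^sup>2))"
      by (intro integrable_mult_right integrable_inverse_1_plus_power2)
    show "AE \<xi> in lborel. norm ((cmod (ft (ind a b) \<xi>))\<^sup>2) \<le> norm (C * inverse (1 + \<xi>\<^sup>2))"
    proof (rule AE_I2)
      fix \<xi>
      have "norm ((cmod (ft (ind a b) \<xi>))\<^sup>2) \<le> C * inverse (1 + \<xi>\<^sup>2)" using le[of \<xi>] by simp
      also have "\<dots> \<le> norm (C * inverse (1 + \<xi>\<^sup>2))" by simp
      finally show "norm ((cmod (ft (ind a b) \<xi>))\<^sup>2) \<le> norm (C * inverse (1 + \<xi>\<^sup>2))" .
    qed
  qed simp
  then show ?thesis by (simp add: L2_def)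
next
  case False
  then have "ft (ind a b) = (\<lambda>\<xi>. 0)" by (simp add: fun_eq_iff ft_def)
  then show ?thesis by (simp add: L2_zero)
qed

section \<open>Parseval's identity for step functions\<close>

lemma L2_inner_ind: "L2_inner (ind a b) (ind c d) = of_real (measure lborel ({c<..d} \<inter> {a<..b}))"
proof -
  have "indicator {a<..b} x * cnj (indicator {c<..d} x) = of_real (indicator ({c<..d} \<inter> {a<..b}) x)" for x
    by (auto simp: indicator_def)
  then show ?thesis unfolding L2_inner_def by simp
qed

text \<open>Levy's inversion formula, applied to the uniform distribution on an interval, is Parseval's
  identity for two indicator functions.\<close>
lemma parseval_ind:
  assumes "a \<le> b" "c < d"
  shows "L2_inner (ft (ind a b)) (ft (ind c d)) = 2 * pi * L2_inner (ind a b) (ind c d)"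
proof -
  define M where "M = uniform_measure lborel {c<..d}"
  have em: "emeasure lborel {c<..d} = ennreal (d - c)" using assms by simp
  have prob: "prob_space M" unfolding M_def using assms by (intro prob_space_uniform_measure) auto
  interpret M: real_distribution M
    using prob by (simp add: real_distribution_def real_distribution_axioms_def M_def)
  have meas: "measure M A = measure lborel ({c<..d} \<inter> A) / (d - c)" if "A \<in> sets borel" for A
    unfolding M_def using assms that by (subst measure_uniform_measure) auto
  \<comment> \<open>Levy's formula yields the mass of an interval whose end points are not
    atoms.\<close>
  have single: "measure M {x} = 0" for x
  proof -
    have "measure lborel ({c<..d} \<inter> {x}) = 0" by (cases "x \<in> {c<..d}") (simp_all add: measure_def)
    then show ?thesis by (simp add: meas)
  qed
  \<comment> \<open>Characteristic functions carry the opposite sign in the exponent, whence the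
    conjugate; the length normalises the measure.\<close>
  have char: "char M t = cnj (ft (ind c d) t) / (d - c)" for t
  proof -
    have "1 / ennreal (d - c) = ennreal (1 / (d - c))"
      using divide_ennreal[of 1 "d - c"] assms by simp
    then have "M = density lborel (\<lambda>x. ennreal (indicator {c<..d} x / (d - c)))"
      unfolding M_def uniform_measure_def em using assms
      by (intro density_cong) (auto simp: indicator_def)
    then have "char M t = (LINT x|lborel. (indicator {c<..d} x / (d - c)) *\<^sub>R iexp (t * x))"
      unfolding char_def using assms by (simp add: integral_density)
    also have "\<dots> = (LINT x|lborel. cnj (cis (- (x * t)) * indicator {c<..d} x) / (d - c))"
      by (intro Bochner_Integration.integral_cong refl)
        (auto simp: indicator_def cis_conv_exp exp_cnj scaleR_conv_of_real mult.commute)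
    also have "\<dots> = cnj (ft (ind c d) t) / (d - c)"
      unfolding ft_def Bochner_Integration.integral_cnj[symmetric] by simp
    finally show ?thesis .
  qed
  define G where "G t = ft (ind a b) t * cnj (ft (ind c d) t)" for t
  have G: "integrable lborel G"
    unfolding G_def by (intro L2_integrable_mult_cnj ft_ind_L2)
  have Gm [measurable]: "G \<in> borel_measurable borel" using borel_measurable_integrable[OF G] by simp
  have eq: "(CLBINT t=-real T..real T. (iexp (-(t * a)) - iexp (-(t * b))) / (\<i> * t) * char M t)
      = (LINT t|lborel. indicator {-real T..real T} t *\<^sub>R G t) / (d - c)" for T :: nat
  proof -
    have "(CLBINT t=-real T..real T. (iexp (-(t * a)) - iexp (-(t * b))) / (\<i> * t) * char M t)
        = (LINT t|lborel. indicator {-real T..real T} t *\<^sub>R ((iexp (-(t * a)) - iexp (-(t * b))) / (\<i> * t) * char M t))"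
      by (simp add: interval_integral_Icc set_lebesgue_integral_def)
    also have "\<dots> = (LINT t|lborel. (indicator {-real T..real T} t *\<^sub>R G t) / (d - c))"
    proof (rule integral_cong_AE)
      \<comment> \<open>Frequency 0 is left out because the closed form of the transform divides by
        it.\<close>
      show "AE t in lborel. indicator {-real T..real T} t *\<^sub>R ((iexp (-(t * a)) - iexp (-(t * b))) / (\<i> * t) * char M t)
          = (indicator {-real T..real T} t *\<^sub>R G t) / (d - c)"
        using AE_lborel_singleton[of 0]
      proof eventually_elim
        case (elim t)
        have e: "(iexp (-(t * a)) - iexp (-(t * b))) / (\<i> * t) = ft (ind a b) t"
          using elim assms by (simp add: ft_ind cis_conv_exp mult.commute)
        show ?case unfolding e char G_def by (simp add: scaleR_conv_of_real)
      qed
    qed (use M.char_measurable in measurable)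
    finally show ?thesis by simp
  qed
  have "(\<lambda>T. 1 / (2 * pi) * (CLBINT t=-real T..real T. (iexp (-(t * a)) - iexp (-(t * b))) / (\<i> * t) * char M t))
      \<longlonglongrightarrow> of_real (measure M {a<..b})"
    using M.Levy_Inversion[OF assms(1) single single] by simp
  then have L1: "(\<lambda>T. 1 / (2 * pi) * ((LINT t|lborel. indicator {-real T..real T} t *\<^sub>R G t) / (d - c)))
      \<longlonglongrightarrow> of_real (measure M {a<..b})"
    unfolding eq .
  have "(\<lambda>T. LINT t|lborel. indicator {-real T..real T} t *\<^sub>R G t) \<longlonglongrightarrow> (LINT t|lborel. G t)"
  proof (rule integral_dominated_convergence)
    show "integrable lborel (\<lambda>t. cmod (G t))" using G by (rule integrable_norm)
    show "AE t in lborel. (\<lambda>T. indicator {-real T..real T} t *\<^sub>R G t) \<longlonglongrightarrow> G t"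
    proof (rule AE_I2)
      fix t :: real
      obtain n :: nat where n: "\<bar>t\<bar> \<le> n" using real_arch_simple by blast
      have "\<forall>\<^sub>F T in sequentially. indicator {-real T..real T} t *\<^sub>R G t = G t"
        using eventually_ge_at_top[of n] by eventually_elim (use n in \<open>auto simp: indicator_def\<close>)
      then show "(\<lambda>T. indicator {-real T..real T} t *\<^sub>R G t) \<longlonglongrightarrow> G t" by (rule tendsto_eventually)
    qed
  qed (auto simp: indicator_def)
  then have L2: "(\<lambda>T. 1 / (2 * pi) * ((LINT t|lborel. indicator {-real T..real T} t *\<^sub>R G t) / (d - c)))
      \<longlonglongrightarrow> 1 / (2 * pi) * ((LINT t|lborel. G t) / (d - c))"
    by (intro tendsto_mult tendsto_const tendsto_divide) (use assms in auto)
  have arith: "1 / (2 * p) * (I / D) = m / D \<Longrightarrow> D \<noteq> 0 \<Longrightarrow> p \<noteq> 0 \<Longrightarrow> I = 2 * p * m" for p I D m :: complex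
    by (simp add: field_simps)
  from LIMSEQ_unique[OF L2 L1]
  have "1 / (2 * pi) * ((LINT t|lborel. G t) / (d - c)) = of_real (measure lborel ({c<..d} \<inter> {a<..b}) / (d - c))"
    by (simp add: meas)
  then have "(LINT t|lborel. G t) = 2 * pi * of_real (measure lborel ({c<..d} \<inter> {a<..b}))"
    using arith[of "complex_of_real pi" "LINT t|lborel. G t" "complex_of_real (d - c)"] assms by simp
  then show ?thesis unfolding L2_inner_ind by (simp add: L2_inner_def G_def)
qed

lemma parseval_ind': "L2_inner (ft (ind a b)) (ft (ind c d)) = 2 * pi * L2_inner (ind a b) (ind c d)"
proof (cases "a \<le> b \<and> c < d")
  case False
  then have "ind a b = (\<lambda>x. 0) \<or> ind c d = (\<lambda>x. 0)" by (auto simp: fun_eq_iff indicator_def)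
  then show ?thesis by (auto simp: L2_inner_def ft_zero)
qed (use parseval_ind in blast)

lemma ft_step_L2: "f \<in> step_functions \<Longrightarrow> ft f \<in> L2"
proof (induction rule: step_functions.induct)
  case zero
  have "ft (\<lambda>x. 0) = (\<lambda>x. 0)" by (simp add: fun_eq_iff ft_zero)
  then show ?case by (simp add: L2_zero)
next
  case (step f c a b)
  have "ft (\<lambda>x. c * indicator {a<..b} x + f x) = (\<lambda>\<xi>. c * ft (ind a b) \<xi> + ft f \<xi>)"
    using step.hyps by (simp add: fun_eq_iff ft_add ft_cmult step_functions_integrable integrable_indicator_Ioc)
  then show ?case using step.IH by (simp add: L2_add L2_cmult ft_ind_L2)
qed

lemma parseval_step_ind:
  "f \<in> step_functions \<Longrightarrow> L2_inner (ft f) (ft (ind c d)) = 2 * pi * L2_inner f (ind c d)"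
proof (induction rule: step_functions.induct)
  case zero
  then show ?case by (simp add: L2_inner_def ft_zero)
next
  case (step f c' a b)
  have "ft (\<lambda>x. c' * indicator {a<..b} x + f x) = (\<lambda>\<xi>. c' * ft (ind a b) \<xi> + ft f \<xi>)"
    using step.hyps by (simp add: fun_eq_iff ft_add ft_cmult step_functions_integrable integrable_indicator_Ioc)
  then show ?case using step
    by (simp add: L2_inner_add L2_inner_cmult L2_cmult ft_ind_L2 ft_step_L2 L2_indicator step_functions_L2 parseval_ind' distrib_left)
qed

lemma parseval_step:
  "g \<in> step_functions \<Longrightarrow> f \<in> step_functions \<Longrightarrow> L2_inner (ft f) (ft g) = 2 * pi * L2_inner f g"
proof (induction rule: step_functions.induct)
  case zero
  then show ?case by (simp add: L2_inner_def ft_zero)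
next
  case (step g c' a b)
  have "ft (\<lambda>x. c' * indicator {a<..b} x + g x) = (\<lambda>\<xi>. c' * ft (ind a b) \<xi> + ft g \<xi>)"
    using step.hyps by (simp add: fun_eq_iff ft_add ft_cmult step_functions_integrable integrable_indicator_Ioc)
  then show ?case using step
    by (simp add: L2_inner_add_right L2_inner_cmult_right L2_cmult ft_ind_L2 ft_step_L2 L2_indicator step_functions_L2
        parseval_step_ind distrib_left)
qed

section \<open>Extension to functions that are integrable and square integrable\<close>

lemma L2_inner_tendsto:
  assumes "\<And>n. f n \<in> L2" "\<And>n. g n \<in> L2" "f' \<in> L2" "g' \<in> L2"
    and f: "((\<lambda>n. abs_l2 (f n)) \<longlongrightarrow> abs_l2 f') F" and g: "((\<lambda>n. abs_l2 (g n)) \<longlongrightarrow> abs_l2 g') F"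
  shows "((\<lambda>n. L2_inner (f n) (g n)) \<longlongrightarrow> L2_inner f' g') F"
proof -
  have ig: "((\<lambda>n. abs_l2 (\<lambda>x. \<i> * g n x)) \<longlongrightarrow> abs_l2 (\<lambda>x. \<i> * g' x)) F"
  proof -
    have "lp_norm 2 (\<lambda>x. \<i> * g n x - \<i> * g' x) = lp_norm 2 (\<lambda>x. g n x - g' x)" for n
      by (simp add: lp_norm_2 norm_mult flip: right_diff_distrib)
    then show ?thesis using g by (simp add: abs_l2_tendsto_iff assms(1-4) L2_cmult)
  qed
  have Re: "((\<lambda>n. Re (L2_inner (f n) (g n))) \<longlongrightarrow> Re (L2_inner f' g')) F"
    using tendsto_inner[OF f g] by (simp add: inner_abs_l2 assms)
  have Im: "((\<lambda>n. Im (L2_inner (f n) (g n))) \<longlongrightarrow> Im (L2_inner f' g')) F"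
    using tendsto_inner[OF f ig] by (simp add: inner_abs_l2 assms L2_cmult L2_inner_cmult_right)
  show ?thesis using Re Im by (simp add: tendsto_complex_iff)
qed

lemma dist_abs_l2: "f \<in> L2 \<Longrightarrow> g \<in> L2 \<Longrightarrow> dist (abs_l2 f) (abs_l2 g) = lp_norm 2 (\<lambda>x. f x - g x)"
  by (simp add: dist_norm abs_l2_diff norm_abs_l2 L2_diff)

lemma lp_norm_2_eq_if_L2_inner_eq: "L2_inner u u = 2 * pi * L2_inner v v \<Longrightarrow> lp_norm 2 u = sqrt (2 * pi) * lp_norm 2 v"
proof -
  assume "L2_inner u u = 2 * pi * L2_inner v v"
  then have "complex_of_real ((lp_norm 2 u)\<^sup>2) = complex_of_real (2 * pi * (lp_norm 2 v)\<^sup>2)"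
    by (simp add: L2_inner_self)
  then have "(lp_norm 2 u)\<^sup>2 = 2 * pi * (lp_norm 2 v)\<^sup>2" by (simp only: of_real_eq_iff)
  then have "sqrt ((lp_norm 2 u)\<^sup>2) = sqrt (2 * pi * (lp_norm 2 v)\<^sup>2)" by simp
  then show ?thesis by (simp add: real_sqrt_mult)
qed

text \<open>On step functions the transform multiplies distances by \<open>sqrt (2 * pi)\<close>, so
  the transforms converge to some \<open>G\<close>. That \<open>G\<close> is the class of
  \<open>ft f\<close> is read off from integrals over intervals, where \<open>ft_mult\<close> moves
  the transform to the indicator function.\<close>

lemma ft_step_limit:
  assumes f: "f \<in> L2" "integrable lborel f"
    and s: "\<And>n::nat. s n \<in> step_functions" "(\<lambda>n. abs_l2 (s n)) \<longlonglongrightarrow> abs_l2 f"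
  shows "ft f \<in> L2" "(\<lambda>n. abs_l2 (ft (s n))) \<longlonglongrightarrow> abs_l2 (ft f)"
proof -
  have fm [measurable]: "f \<in> borel_measurable borel" using L2_measurable[OF f(1)] by simp
  note sL = step_functions_L2[OF s(1)] and si = step_functions_integrable[OF s(1)] and fsL = ft_step_L2[OF s(1)]
  have iso: "dist (abs_l2 (ft (s n))) (abs_l2 (ft (s m))) = sqrt (2 * pi) * dist (abs_l2 (s n)) (abs_l2 (s m))" for n m
  proof -
    have d: "(\<lambda>x. s n x - s m x) \<in> step_functions"
      using step_functions_add[OF s(1)[of n] step_functions_cmult[OF s(1)[of m], of "-1"]] by simp
    have "(\<lambda>\<xi>. ft (s n) \<xi> - ft (s m) \<xi>) = ft (\<lambda>x. s n x - s m x)"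
      by (simp add: fun_eq_iff ft_diff si)
    then show ?thesis
      using lp_norm_2_eq_if_L2_inner_eq[OF parseval_step[OF d d]]
      by (simp add: dist_abs_l2 sL fsL)
  qed
  have "Cauchy (\<lambda>n. abs_l2 (ft (s n)))"
  proof (rule metric_CauchyI)
    fix e :: real assume e: "e > 0"
    have "e / sqrt (2 * pi) > 0" using e by simp
    then obtain M where M: "\<And>m n. m \<ge> M \<Longrightarrow> n \<ge> M \<Longrightarrow> dist (abs_l2 (s m)) (abs_l2 (s n)) < e / sqrt (2 * pi)"
      using metric_CauchyD[OF LIMSEQ_imp_Cauchy[OF s(2)]] by blast
    show "\<exists>M. \<forall>m\<ge>M. \<forall>n\<ge>M. dist (abs_l2 (ft (s m))) (abs_l2 (ft (s n))) < e"
      unfolding iso using M by (intro exI[of _ M]) (simp add: pos_less_divide_eq mult.commute)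
  qed
  then obtain G where G: "(\<lambda>n. abs_l2 (ft (s n))) \<longlonglongrightarrow> G" using Cauchy_convergent convergent_def by blast
  define g where "g = rep_l2 G"
  have g: "g \<in> L2" "abs_l2 g = G" by (simp_all add: g_def)
  have gm [measurable]: "g \<in> borel_measurable borel" using L2_measurable[OF g(1)] by simp
  have seti: "set_integrable lborel {a<..b} (ft f)" for a b
  proof -
    have "integrable lborel (\<lambda>\<xi>. indicator {a<..b} \<xi> *\<^sub>R ft f \<xi>)"
      by (rule integrableI_bounded_set_indicator[where B = "LINT x|lborel. cmod (f x)"])
        (use ft_bound[OF f(2)] in \<open>auto, (cases "a \<le> b"; simp)?\<close>)
    then show ?thesis by (simp add: set_integrable_def)
  qed
  have setg: "set_integrable lborel {a<..b} g" for a b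
  proof -
    have "integrable lborel (\<lambda>\<xi>. g \<xi> * ind a b \<xi>)" by (intro L2_integrable_mult g L2_indicator)
    moreover have "g \<xi> * ind a b \<xi> = indicator {a<..b} \<xi> *\<^sub>R g \<xi>" for \<xi> by (simp add: indicator_def)
    ultimately show ?thesis by (simp add: set_integrable_def)
  qed
  have "AE \<xi> in lborel. ft f \<xi> - g \<xi> = 0"
  proof (rule AE_zero_if_interval_integrals_zero)
    fix a b :: real
    show "set_integrable lborel {a<..b} (\<lambda>\<xi>. ft f \<xi> - g \<xi>)" by (rule set_integral_diff(1)[OF seti setg])
    have rw: "(LINT \<xi>:{a<..b}|lborel. h \<xi>) = (LINT \<xi>|lborel. h \<xi> * ind a b \<xi>)" for h :: "real \<Rightarrow> complex"
      unfolding set_lebesgue_integral_def by (intro Bochner_Integration.integral_cong) (auto simp: indicator_def)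
    have cnj_ind: "cnj (ind a b x) = ind a b x" for x by (simp add: indicator_def)
    have "(\<lambda>n. L2_inner (s n) (\<lambda>x. cnj (ft (ind a b) x))) \<longlonglongrightarrow> L2_inner f (\<lambda>x. cnj (ft (ind a b) x))"
      by (rule L2_inner_tendsto) (use s f sL L2_cnj[OF ft_ind_L2] in auto)
    moreover have "L2_inner h (\<lambda>x. cnj (ft (ind a b) x)) = (LINT \<xi>|lborel. ft h \<xi> * ind a b \<xi>)" if "integrable lborel h" for h
      using ft_mult[OF that integrable_indicator_Ioc] by (simp add: L2_inner_def)
    ultimately have L1: "(\<lambda>n. LINT \<xi>|lborel. ft (s n) \<xi> * ind a b \<xi>) \<longlonglongrightarrow> (LINT \<xi>|lborel. ft f \<xi> * ind a b \<xi>)"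
      using si f by simp
    have "(\<lambda>n. L2_inner (ft (s n)) (ind a b)) \<longlonglongrightarrow> L2_inner g (ind a b)"
      by (rule L2_inner_tendsto) (use G g fsL L2_indicator in auto)
    then have L2: "(\<lambda>n. LINT \<xi>|lborel. ft (s n) \<xi> * ind a b \<xi>) \<longlonglongrightarrow> (LINT \<xi>|lborel. g \<xi> * ind a b \<xi>)"
      by (simp add: L2_inner_def cnj_ind)
    show "(LINT \<xi>:{a<..b}|lborel. ft f \<xi> - g \<xi>) = 0"
      using LIMSEQ_unique[OF L1 L2] by (simp add: set_integral_diff(2)[OF seti setg] rw)
  qed
  then have AE: "AE \<xi> in lborel. ft f \<xi> = g \<xi>" by eventually_elim simp
  then show fL: "ft f \<in> L2" by (intro L2_cong_AE[OF g(1)]) simp_all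
  have "abs_l2 (ft f) = G" using abs_l2_eq_iff[OF fL g(1)] AE g(2) by simp
  with G show "(\<lambda>n. abs_l2 (ft (s n))) \<longlonglongrightarrow> abs_l2 (ft f)" by simp
qed

lemma
  assumes "f \<in> L2" "integrable lborel f"
  shows ft_L2: "ft f \<in> L2"
    and parseval_ft: "g \<in> L2 \<Longrightarrow> integrable lborel g \<Longrightarrow> L2_inner (ft f) (ft g) = 2 * pi * L2_inner f g"
proof -
  obtain s where s: "\<And>n::nat. s n \<in> step_functions" "(\<lambda>n. abs_l2 (s n)) \<longlonglongrightarrow> abs_l2 f"
    using step_functions_dense[OF assms(1)] by blast
  show fL: "ft f \<in> L2" by (rule ft_step_limit(1)[OF assms s])
  assume g: "g \<in> L2" "integrable lborel g"
  obtain t where t: "\<And>n::nat. t n \<in> step_functions" "(\<lambda>n. abs_l2 (t n)) \<longlonglongrightarrow> abs_l2 g"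
    using step_functions_dense[OF g(1)] by blast
  have A: "(\<lambda>n. L2_inner (ft (s n)) (ft (t n))) \<longlonglongrightarrow> L2_inner (ft f) (ft g)"
    by (rule L2_inner_tendsto[OF ft_step_L2[OF s(1)] ft_step_L2[OF t(1)] ft_step_limit(1)[OF assms s]
        ft_step_limit(1)[OF g t] ft_step_limit(2)[OF assms s] ft_step_limit(2)[OF g t]])
  have B: "(\<lambda>n. 2 * pi * L2_inner (s n) (t n)) \<longlonglongrightarrow> 2 * pi * L2_inner f g"
    by (intro tendsto_mult tendsto_const
        L2_inner_tendsto[OF step_functions_L2[OF s(1)] step_functions_L2[OF t(1)] assms(1) g(1) s(2) t(2)])
  have C: "L2_inner (ft (s n)) (ft (t n)) = 2 * pi * L2_inner (s n) (t n)" for n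
    by (rule parseval_step[OF t(1) s(1)])
  show "L2_inner (ft f) (ft g) = 2 * pi * L2_inner f g"
    by (rule LIMSEQ_unique[OF A[unfolded C] B])
qed

lemma lp_norm_ft: "f \<in> L2 \<Longrightarrow> integrable lborel f \<Longrightarrow> lp_norm 2 (ft f) = sqrt (2 * pi) * lp_norm 2 f"
  by (intro lp_norm_2_eq_if_L2_inner_eq parseval_ft)

section \<open>The transform on all of \<open>L2\<close>, by truncation\<close>

definition trunc :: "real \<Rightarrow> (real \<Rightarrow> complex) \<Rightarrow> real \<Rightarrow> complex" where
  "trunc N f x = indicator {-N..N} x * f x"

lemma L2_indicator_Icc: "(\<lambda>x. indicator {a..b::real} x :: complex) \<in> L2"
proof -
  have "AE x in lborel. indicator {a..b} x = (indicator {a<..b} x :: complex)"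
    using AE_lborel_singleton[of a] by eventually_elim (auto simp: indicator_def)
  then show ?thesis by (intro L2_cong_AE[OF L2_indicator]) auto
qed

lemma trunc_L2: "f \<in> L2 \<Longrightarrow> trunc N f \<in> L2"
  unfolding trunc_def[abs_def] by (rule L2_mult_bounded[of _ _ 1]) (auto simp: indicator_def)

lemma trunc_integrable: "f \<in> L2 \<Longrightarrow> integrable lborel (trunc N f)"
  unfolding trunc_def[abs_def] by (intro L2_integrable_mult L2_indicator_Icc)

lemma trunc_tendsto:
  assumes "f \<in> L2"
  shows "((\<lambda>N. abs_l2 (trunc N f)) \<longlongrightarrow> abs_l2 f) at_top"
proof -
  have [measurable]: "f \<in> borel_measurable borel" using L2_measurable[OF assms] by simp
  have "((\<lambda>N. LINT x|lborel. (cmod (trunc N f x - f x))\<^sup>2) \<longlongrightarrow> (LINT x::real|lborel. 0)) at_top"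
  proof (rule integral_dominated_convergence_at_top)
    show "integrable lborel (\<lambda>x. (cmod (f x))\<^sup>2)" by (rule L2_integrable_power2[OF assms])
    show "\<forall>\<^sub>F N in at_top. AE x in lborel. norm ((cmod (trunc N f x - f x))\<^sup>2) \<le> (cmod (f x))\<^sup>2"
      by (intro always_eventually allI AE_I2) (auto simp: trunc_def indicator_def)
    show "AE x in lborel. ((\<lambda>N. (cmod (trunc N f x - f x))\<^sup>2) \<longlongrightarrow> 0) at_top"
    proof (rule AE_I2)
      fix x
      have "\<forall>\<^sub>F N in at_top. (cmod (trunc N f x - f x))\<^sup>2 = 0"
        using eventually_ge_at_top[of "\<bar>x\<bar>"] by eventually_elim (auto simp: trunc_def indicator_def abs_le_iff)
      then show "((\<lambda>N. (cmod (trunc N f x - f x))\<^sup>2) \<longlongrightarrow> 0) at_top" by (rule tendsto_eventually)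
    qed
    show "(\<lambda>x. (cmod (trunc N f x - f x))\<^sup>2) \<in> borel_measurable lborel" for N
      unfolding trunc_def by measurable
  qed simp
  then have "((\<lambda>N. sqrt (LINT x|lborel. (cmod (trunc N f x - f x))\<^sup>2)) \<longlongrightarrow> sqrt 0) at_top"
    by (intro tendsto_real_sqrt) simp
  then have "((\<lambda>N. lp_norm 2 (\<lambda>x. trunc N f x - f x)) \<longlongrightarrow> 0) at_top" by (simp add: lp_norm_2)
  then show ?thesis using assms by (simp add: abs_l2_tendsto_iff trunc_L2)
qed

lemma L2_limit_iff:
  assumes "\<And>N. F N \<in> L2"
  shows "L2_limit F g \<longleftrightarrow> g \<in> L2 \<and> ((\<lambda>N. abs_l2 (F N)) \<longlongrightarrow> abs_l2 g) at_top"
proof -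
  have "((\<lambda>N. \<integral>\<^sup>+x. ennreal ((cmod (F N x - g x))\<^sup>2) \<partial>lborel) \<longlongrightarrow> 0) at_top \<longleftrightarrow> ((\<lambda>N. abs_l2 (F N)) \<longlongrightarrow> abs_l2 g) at_top"
    if g: "g \<in> L2"
  proof -
    have "((\<lambda>N. \<integral>\<^sup>+x. ennreal ((cmod (F N x - g x))\<^sup>2) \<partial>lborel) \<longlongrightarrow> 0) at_top
        \<longleftrightarrow> ((\<lambda>N. ennreal ((lp_norm 2 (\<lambda>x. F N x - g x))\<^sup>2)) \<longlongrightarrow> ennreal 0) at_top"
      using assms g by (simp add: L2_nn_integral L2_diff)
    also have "\<dots> \<longleftrightarrow> ((\<lambda>N. (lp_norm 2 (\<lambda>x. F N x - g x))\<^sup>2) \<longlongrightarrow> 0) at_top"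
      by (rule tendsto_ennreal_iff) auto
    also have "\<dots> \<longleftrightarrow> ((\<lambda>N. lp_norm 2 (\<lambda>x. F N x - g x)) \<longlongrightarrow> 0) at_top"
      by (rule power_tendsto_0_iff) simp
    also have "\<dots> \<longleftrightarrow> ((\<lambda>N. abs_l2 (F N)) \<longlongrightarrow> abs_l2 g) at_top"
      using assms g by (rule abs_l2_tendsto_iff[symmetric])
    finally show ?thesis .
  qed
  then show ?thesis unfolding L2_limit_def by blast
qed

text \<open>Completeness speaks of sequences, \<open>fourier\<close> of a real parameter. The limit
  \<open>G\<close> is therefore found along the integers; letting one index tend to infinity in the
  isometry gives the exact distance to \<open>G\<close> for every real \<open>N\<close>.\<close>

lemma ft_trunc_converges:
  assumes "f \<in> L2"
  shows "\<exists>g\<in>L2. ((\<lambda>N. abs_l2 (ft (trunc N f))) \<longlongrightarrow> abs_l2 g) at_top"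
proof -
  note t = trunc_L2[OF assms] trunc_integrable[OF assms]
  note ftL = ft_L2[OF t]
  have iso: "dist (abs_l2 (ft (trunc N f))) (abs_l2 (ft (trunc M f))) = sqrt (2 * pi) * dist (abs_l2 (trunc N f)) (abs_l2 (trunc M f))" for N M
  proof -
    have "(\<lambda>\<xi>. ft (trunc N f) \<xi> - ft (trunc M f) \<xi>) = ft (\<lambda>x. trunc N f x - trunc M f x)"
      by (simp add: fun_eq_iff ft_diff t)
    then show ?thesis
      using lp_norm_ft[of "\<lambda>x. trunc N f x - trunc M f x"]
      by (simp add: dist_abs_l2 L2_diff t ftL)
  qed
  have nat: "(\<lambda>n. abs_l2 (trunc (real n) f)) \<longlonglongrightarrow> abs_l2 f"
    by (rule filterlim_compose[OF trunc_tendsto[OF assms] filterlim_real_sequentially])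
  have "Cauchy (\<lambda>n. abs_l2 (ft (trunc (real n) f)))"
  proof (rule metric_CauchyI)
    fix e :: real assume e: "e > 0"
    have "e / sqrt (2 * pi) > 0" using e by simp
    then obtain M where M: "\<And>m n. m \<ge> M \<Longrightarrow> n \<ge> M \<Longrightarrow> dist (abs_l2 (trunc (real m) f)) (abs_l2 (trunc (real n) f)) < e / sqrt (2 * pi)"
      using metric_CauchyD[OF LIMSEQ_imp_Cauchy[OF nat]] by blast
    show "\<exists>M. \<forall>m\<ge>M. \<forall>n\<ge>M. dist (abs_l2 (ft (trunc (real m) f))) (abs_l2 (ft (trunc (real n) f))) < e"
      unfolding iso using M by (intro exI[of _ M]) (simp add: pos_less_divide_eq mult.commute)
  qed
  then obtain G where G: "(\<lambda>n. abs_l2 (ft (trunc (real n) f))) \<longlonglongrightarrow> G" using Cauchy_convergent convergent_def by blast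
  have dG: "dist (abs_l2 (ft (trunc N f))) G = sqrt (2 * pi) * dist (abs_l2 (trunc N f)) (abs_l2 f)" for N
  proof (rule LIMSEQ_unique)
    show "(\<lambda>n. dist (abs_l2 (ft (trunc N f))) (abs_l2 (ft (trunc (real n) f)))) \<longlonglongrightarrow> dist (abs_l2 (ft (trunc N f))) G"
      by (intro tendsto_dist tendsto_const G)
    show "(\<lambda>n. dist (abs_l2 (ft (trunc N f))) (abs_l2 (ft (trunc (real n) f)))) \<longlonglongrightarrow> sqrt (2 * pi) * dist (abs_l2 (trunc N f)) (abs_l2 f)"
      unfolding iso by (intro tendsto_dist tendsto_mult tendsto_const nat)
  qed
  have "((\<lambda>N. sqrt (2 * pi) * dist (abs_l2 (trunc N f)) (abs_l2 f)) \<longlongrightarrow> sqrt (2 * pi) * 0) at_top"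
    by (intro tendsto_mult tendsto_const trunc_tendsto[OF assms, unfolded tendsto_dist_iff[of _ "abs_l2 f"]])
  then have "((\<lambda>N. abs_l2 (ft (trunc N f))) \<longlongrightarrow> G) at_top"
    unfolding tendsto_dist_iff[of _ G] dG by simp
  then have "((\<lambda>N. abs_l2 (ft (trunc N f))) \<longlongrightarrow> abs_l2 (rep_l2 G)) at_top" by simp
  then show ?thesis using rep_l2_L2 by blast
qed

lemma fourier_trunc_eq: "(LINT x:{-N..N}|lborel. cis (- (x * \<xi>)) * f x) = ft (trunc N f) \<xi>"
  unfolding ft_def set_lebesgue_integral_def trunc_def
  by (intro Bochner_Integration.integral_cong) (auto simp: indicator_def)

lemma
  assumes "f \<in> L2"
  shows fourier_L2: "fourier f \<in> L2"
    and fourier_tendsto: "((\<lambda>N. abs_l2 (ft (trunc N f))) \<longlongrightarrow> abs_l2 (fourier f)) at_top"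
proof -
  note ftL = ft_L2[OF trunc_L2[OF assms] trunc_integrable[OF assms]]
  have ex: "\<exists>g. L2_limit (\<lambda>N \<xi>. LINT x:{-N..N}|lborel. cis (- (x * \<xi>)) * f x) g"
    unfolding fourier_trunc_eq L2_limit_iff[OF ftL] using ft_trunc_converges[OF assms] by blast
  have "L2_limit (\<lambda>N \<xi>. LINT x:{-N..N}|lborel. cis (- (x * \<xi>)) * f x) (fourier f)"
    unfolding fourier_def by (rule someI_ex[OF ex])
  then show "fourier f \<in> L2" "((\<lambda>N. abs_l2 (ft (trunc N f))) \<longlongrightarrow> abs_l2 (fourier f)) at_top"
    unfolding fourier_trunc_eq L2_limit_iff[OF ftL] by blast+
qed

theorem parseval:
  assumes "f \<in> L2" "g \<in> L2"
  shows "L2_inner (fourier f) (fourier g) = 2 * pi * L2_inner f g"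
proof -
  note t = trunc_L2 trunc_integrable ft_L2[OF trunc_L2 trunc_integrable]
  have A: "((\<lambda>N. L2_inner (ft (trunc N f)) (ft (trunc N g))) \<longlongrightarrow> L2_inner (fourier f) (fourier g)) at_top"
    by (intro L2_inner_tendsto fourier_tendsto fourier_L2 t assms)
  have B: "((\<lambda>N. 2 * pi * L2_inner (trunc N f) (trunc N g)) \<longlongrightarrow> 2 * pi * L2_inner f g) at_top"
    by (intro tendsto_mult tendsto_const L2_inner_tendsto trunc_tendsto t assms)
  have C: "L2_inner (ft (trunc N f)) (ft (trunc N g)) = 2 * pi * L2_inner (trunc N f) (trunc N g)" for N
    by (intro parseval_ft t assms)
  show ?thesis by (rule tendsto_unique[OF trivial_limit_at_top_linorder A[unfolded C] B])
qed

lemma lp_norm_fourier: "f \<in> L2 \<Longrightarrow> lp_norm 2 (fourier f) = sqrt (2 * pi) * lp_norm 2 f"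
  by (intro lp_norm_2_eq_if_L2_inner_eq parseval)

lemma fourier_add:
  assumes "f \<in> L2" "g \<in> L2"
  shows "AE \<xi> in lborel. fourier (\<lambda>x. f x + g x) \<xi> = fourier f \<xi> + fourier g \<xi>"
proof -
  have "((\<lambda>N. abs_l2 (ft (trunc N f)) + abs_l2 (ft (trunc N g))) \<longlongrightarrow> abs_l2 (fourier f) + abs_l2 (fourier g)) at_top"
    by (intro tendsto_add fourier_tendsto assms)
  moreover have "abs_l2 (ft (trunc N f)) + abs_l2 (ft (trunc N g)) = abs_l2 (ft (trunc N (\<lambda>x. f x + g x)))" for N
  proof -
    have "ft (trunc N (\<lambda>x. f x + g x)) = (\<lambda>\<xi>. ft (trunc N f) \<xi> + ft (trunc N g) \<xi>)"
      unfolding fun_eq_iff using ft_add[OF trunc_integrable[OF assms(1), of N] trunc_integrable[OF assms(2), of N]]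
      by (simp add: trunc_def[abs_def] distrib_left)
    then show ?thesis by (simp add: abs_l2_add ft_L2 trunc_L2 trunc_integrable assms)
  qed
  ultimately have "((\<lambda>N. abs_l2 (ft (trunc N (\<lambda>x. f x + g x)))) \<longlongrightarrow> abs_l2 (fourier f) + abs_l2 (fourier g)) at_top"
    by simp
  from tendsto_unique[OF trivial_limit_at_top_linorder fourier_tendsto[OF L2_add[OF assms]] this]
  show ?thesis using assms by (simp add: abs_l2_add fourier_L2 abs_l2_eq_iff L2_add)
qed

lemma abs_l2_cmult_tendsto:
  assumes "\<And>n. f n \<in> L2" "g \<in> L2" "((\<lambda>n. abs_l2 (f n)) \<longlongrightarrow> abs_l2 g) F"
    and b: "b \<in> borel_measurable borel" "\<And>x. cmod (b x) \<le> C"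
  shows "((\<lambda>n. abs_l2 (\<lambda>x. b x * f n x)) \<longlongrightarrow> abs_l2 (\<lambda>x. b x * g x)) F"
proof -
  have bL: "h \<in> L2 \<Longrightarrow> (\<lambda>x. b x * h x) \<in> L2" for h by (rule L2_mult_bounded[OF _ _ b(2)]) (use b(1) in simp_all)
  have C0: "C \<ge> 0" using b(2)[of 0] norm_ge_zero order_trans by blast
  have le: "lp_norm 2 (\<lambda>x. b x * f n x - b x * g x) \<le> C * lp_norm 2 (\<lambda>x. f n x - g x)" for n
  proof -
    have "(LINT x|lborel. (cmod (b x * f n x - b x * g x))\<^sup>2) \<le> (LINT x|lborel. C\<^sup>2 * (cmod (f n x - g x))\<^sup>2)"
    proof (rule integral_mono)
      show "integrable lborel (\<lambda>x. (cmod (b x * f n x - b x * g x))\<^sup>2)"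
        by (intro L2_integrable_power2 L2_diff bL assms)
      show "integrable lborel (\<lambda>x. C\<^sup>2 * (cmod (f n x - g x))\<^sup>2)"
        by (intro integrable_mult_right L2_integrable_power2 L2_diff assms)
      show "(cmod (b x * f n x - b x * g x))\<^sup>2 \<le> C\<^sup>2 * (cmod (f n x - g x))\<^sup>2" for x
        using power_mono[OF b(2)[of x], of 2]
        by (simp add: norm_mult power_mult_distrib mult_right_mono flip: right_diff_distrib)
    qed
    then have "sqrt (LINT x|lborel. (cmod (b x * f n x - b x * g x))\<^sup>2) \<le> sqrt (C\<^sup>2 * (LINT x|lborel. (cmod (f n x - g x))\<^sup>2))"
      by simp
    then show ?thesis using C0 by (simp add: lp_norm_2 real_sqrt_mult)
  qed
  have lim: "((\<lambda>n. C * lp_norm 2 (\<lambda>x. f n x - g x)) \<longlongrightarrow> 0) F"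
    using tendsto_mult[OF tendsto_const assms(3)[unfolded abs_l2_tendsto_iff[OF assms(1,2)]], of C] by simp
  have "\<forall>\<^sub>F n in F. norm (lp_norm 2 (\<lambda>x. b x * f n x - b x * g x)) \<le> C * lp_norm 2 (\<lambda>x. f n x - g x)"
    by (rule always_eventually) (simp add: le)
  from Lim_null_comparison[OF this lim] have "((\<lambda>n. lp_norm 2 (\<lambda>x. b x * f n x - b x * g x)) \<longlongrightarrow> 0) F" .
  then show ?thesis by (simp add: abs_l2_tendsto_iff bL assms(1,2))
qed

lemma fourier_cmult:
  assumes "f \<in> L2"
  shows "AE \<xi> in lborel. fourier (\<lambda>x. c * f x) \<xi> = c * fourier f \<xi>"
proof -
  have "((\<lambda>N. abs_l2 (\<lambda>\<xi>. c * ft (trunc N f) \<xi>)) \<longlongrightarrow> abs_l2 (\<lambda>\<xi>. c * fourier f \<xi>)) at_top"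
    by (rule abs_l2_cmult_tendsto[where C = "cmod c"])
      (simp_all add: ft_L2 trunc_L2 trunc_integrable fourier_L2 fourier_tendsto assms)
  moreover have "(\<lambda>\<xi>. c * ft (trunc N f) \<xi>) = ft (trunc N (\<lambda>x. c * f x))" for N
    by (simp add: fun_eq_iff trunc_def[abs_def] mult.left_commute[of _ c] ft_cmult)
  ultimately have "((\<lambda>N. abs_l2 (ft (trunc N (\<lambda>x. c * f x)))) \<longlongrightarrow> abs_l2 (\<lambda>\<xi>. c * fourier f \<xi>)) at_top" by simp
  from tendsto_unique[OF trivial_limit_at_top_linorder fourier_tendsto[OF L2_cmult[OF assms]] this]
  show ?thesis using assms by (simp add: fourier_L2 abs_l2_eq_iff L2_cmult)
qed

lemma fourier_diff:
  assumes "f \<in> L2" "g \<in> L2"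
  shows "AE \<xi> in lborel. fourier (\<lambda>x. f x - g x) \<xi> = fourier f \<xi> - fourier g \<xi>"
  using fourier_add[OF assms(1) L2_cmult[OF assms(2), of "-1"]] fourier_cmult[OF assms(2), of "-1"]
  by eventually_elim simp

lemma fourier_cong_AE:
  assumes "f \<in> L2" "g \<in> L2" "AE x in lborel. f x = g x"
  shows "fourier f = fourier g"
proof -
  have "ft (trunc N f) = ft (trunc N g)" for N
  proof
    fix \<xi>
    have [measurable]: "f \<in> borel_measurable borel" "g \<in> borel_measurable borel"
      using assms(1,2)[THEN L2_measurable] by simp_all
    show "ft (trunc N f) \<xi> = ft (trunc N g) \<xi>"
      unfolding ft_def trunc_def by (rule integral_cong_AE) (use assms(3) in auto)
  qed
  then show ?thesis unfolding fourier_def fourier_trunc_eq by simp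
qed

lemma fourier_continuous:
  assumes "\<And>n. f n \<in> L2" "g \<in> L2" "((\<lambda>n. abs_l2 (f n)) \<longlongrightarrow> abs_l2 g) F"
  shows "((\<lambda>n. abs_l2 (fourier (f n))) \<longlongrightarrow> abs_l2 (fourier g)) F"
proof -
  have "lp_norm 2 (\<lambda>x. fourier (f n) x - fourier g x) = sqrt (2 * pi) * lp_norm 2 (\<lambda>x. f n x - g x)" for n
  proof -
    have "abs_l2 (\<lambda>\<xi>. fourier (f n) \<xi> - fourier g \<xi>) = abs_l2 (fourier (\<lambda>x. f n x - g x))"
      using fourier_diff[OF assms(1)[of n] assms(2)]
      by (subst abs_l2_eq_iff) (auto simp: L2_diff fourier_L2 assms(1,2))
    then have "lp_norm 2 (\<lambda>\<xi>. fourier (f n) \<xi> - fourier g \<xi>) = lp_norm 2 (fourier (\<lambda>x. f n x - g x))"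
      by (metis norm_abs_l2 L2_diff fourier_L2 assms(1,2))
    then show ?thesis by (simp add: lp_norm_fourier L2_diff assms(1,2))
  qed
  moreover have "((\<lambda>n. sqrt (2 * pi) * lp_norm 2 (\<lambda>x. f n x - g x)) \<longlongrightarrow> sqrt (2 * pi) * 0) F"
    by (intro tendsto_mult tendsto_const assms(3)[unfolded abs_l2_tendsto_iff[OF assms(1,2)]])
  ultimately show ?thesis by (simp add: abs_l2_tendsto_iff fourier_L2 assms(1,2))
qed

lemma fourier_eq_ft:
  assumes "f \<in> L2" "integrable lborel f"
  shows "AE \<xi> in lborel. fourier f \<xi> = ft f \<xi>"
proof -
  have "lp_norm 2 (\<lambda>\<xi>. ft (trunc N f) \<xi> - ft f \<xi>) = sqrt (2 * pi) * lp_norm 2 (\<lambda>x. trunc N f x - f x)" for N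
  proof -
    have "(\<lambda>\<xi>. ft (trunc N f) \<xi> - ft f \<xi>) = ft (\<lambda>x. trunc N f x - f x)"
      by (simp add: fun_eq_iff ft_diff trunc_integrable assms)
    then show ?thesis by (simp add: lp_norm_ft L2_diff trunc_L2 trunc_integrable assms)
  qed
  moreover have "((\<lambda>N. sqrt (2 * pi) * lp_norm 2 (\<lambda>x. trunc N f x - f x)) \<longlongrightarrow> sqrt (2 * pi) * 0) at_top"
    by (intro tendsto_mult tendsto_const trunc_tendsto[OF assms(1), unfolded abs_l2_tendsto_iff[OF trunc_L2[OF assms(1)] assms(1)]])
  ultimately have "((\<lambda>N. abs_l2 (ft (trunc N f))) \<longlongrightarrow> abs_l2 (ft f)) at_top"
    by (simp add: abs_l2_tendsto_iff ft_L2 trunc_L2 trunc_integrable assms)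
  from tendsto_unique[OF trivial_limit_at_top_linorder fourier_tendsto[OF assms(1)] this]
  show ?thesis by (simp add: abs_l2_eq_iff fourier_L2 ft_L2 assms)
qed

section \<open>Conjugation and inversion\<close>

lemma lp_norm_2_cnj: "lp_norm 2 (\<lambda>x. cnj (f x)) = lp_norm 2 f"
  by (simp add: lp_norm_2)

lemma abs_l2_cnj_tendsto:
  assumes "\<And>n. f n \<in> L2" "g \<in> L2" "((\<lambda>n. abs_l2 (f n)) \<longlongrightarrow> abs_l2 g) F"
  shows "((\<lambda>n. abs_l2 (\<lambda>x. cnj (f n x))) \<longlongrightarrow> abs_l2 (\<lambda>x. cnj (g x))) F"
proof -
  have "lp_norm 2 (\<lambda>x. cnj (f n x) - cnj (g x)) = lp_norm 2 (\<lambda>x. f n x - g x)" for n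
    using lp_norm_2_cnj[of "\<lambda>x. f n x - g x"] by simp
  then show ?thesis using assms(3) by (simp add: abs_l2_tendsto_iff assms(1,2) L2_cnj)
qed

lemma fourier_mult:
  assumes "f \<in> L2" "g \<in> L2"
  shows "(LINT \<xi>|lborel. fourier f \<xi> * g \<xi>) = (LINT x|lborel. f x * fourier g x)"
proof -
  note t = trunc_L2 trunc_integrable ft_L2[OF trunc_L2 trunc_integrable] L2_cnj fourier_L2
  have A: "((\<lambda>N. L2_inner (ft (trunc N f)) (\<lambda>x. cnj (trunc N g x))) \<longlongrightarrow> L2_inner (fourier f) (\<lambda>x. cnj (g x))) at_top"
    by (intro L2_inner_tendsto abs_l2_cnj_tendsto fourier_tendsto trunc_tendsto t assms)
  have B: "((\<lambda>N. L2_inner (trunc N f) (\<lambda>x. cnj (ft (trunc N g) x))) \<longlongrightarrow> L2_inner f (\<lambda>x. cnj (fourier g x))) at_top"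
    by (intro L2_inner_tendsto abs_l2_cnj_tendsto fourier_tendsto trunc_tendsto t assms)
  have C: "L2_inner (ft (trunc N f)) (\<lambda>x. cnj (trunc N g x)) = L2_inner (trunc N f) (\<lambda>x. cnj (ft (trunc N g) x))" for N
    using ft_mult[OF trunc_integrable[OF assms(1)] trunc_integrable[OF assms(2)]] by (simp add: L2_inner_def)
  have "L2_inner (fourier f) (\<lambda>x. cnj (g x)) = L2_inner f (\<lambda>x. cnj (fourier g x))"
    by (rule tendsto_unique[OF trivial_limit_at_top_linorder A[unfolded C] B])
  then show ?thesis by (simp add: L2_inner_def)
qed

text \<open>Conjugation before and after reverses the sign in the exponent, so the inverse inherits
  its properties from \<open>fourier\<close>.\<close>

definition inv_fourier :: "(real \<Rightarrow> complex) \<Rightarrow> real \<Rightarrow> complex" where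
  "inv_fourier g x = cnj (fourier (\<lambda>\<xi>. cnj (g \<xi>)) x) / (2 * pi)"

lemma inv_fourier_L2: "g \<in> L2 \<Longrightarrow> inv_fourier g \<in> L2"
proof -
  assume "g \<in> L2"
  then have "(\<lambda>x. 1 / (2 * pi) * cnj (fourier (\<lambda>\<xi>. cnj (g \<xi>)) x)) \<in> L2" by (intro L2_cmult L2_cnj fourier_L2)
  then show ?thesis by (simp add: inv_fourier_def[abs_def])
qed

lemma L2_eq_if_inner_zero: "f \<in> L2 \<Longrightarrow> g \<in> L2 \<Longrightarrow> L2_inner (\<lambda>x. f x - g x) (\<lambda>x. f x - g x) = 0 \<Longrightarrow> AE x in lborel. f x = g x"
  using lp_norm_2_zero_iff[OF L2_diff, of f g] by (simp add: L2_inner_self)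

text \<open>The squared norm of the difference is expanded. Parseval's identity for the square terms
  and the multiplication formula for the mixed ones make all four terms equal to
  \<open>L2_inner g g\<close>, up to sign.\<close>

lemma fourier_inv_fourier:
  assumes g: "g \<in> L2"
  shows "AE \<xi> in lborel. fourier (inv_fourier g) \<xi> = g \<xi>"
proof -
  define k where "k = inv_fourier g"
  have k: "k \<in> L2" unfolding k_def by (rule inv_fourier_L2[OF g])
  have Fc: "fourier (\<lambda>\<xi>. cnj (g \<xi>)) = (\<lambda>x. (2 * pi) * cnj (k x))"
    by (simp add: fun_eq_iff k_def inv_fourier_def)
  have cc: "L2_inner (\<lambda>x. cnj (h x)) (\<lambda>x. cnj (h x)) = L2_inner h h" for h
    by (simp add: L2_inner_self lp_norm_2_cnj)
  have "L2_inner (fourier (\<lambda>\<xi>. cnj (g \<xi>))) (fourier (\<lambda>\<xi>. cnj (g \<xi>))) = 2 * pi * L2_inner g g"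
    using parseval[OF L2_cnj[OF g] L2_cnj[OF g]] by (simp add: cc)
  then have kk: "2 * pi * L2_inner k k = L2_inner g g"
    unfolding Fc by (simp add: L2_inner_cmult L2_inner_cmult_right cc mult.assoc)
  have FF: "L2_inner (fourier k) (fourier k) = L2_inner g g"
    using parseval[OF k k] kk by simp
  have "(LINT \<xi>|lborel. fourier k \<xi> * cnj (g \<xi>)) = (LINT x|lborel. k x * fourier (\<lambda>\<xi>. cnj (g \<xi>)) x)"
    by (rule fourier_mult[OF k L2_cnj[OF g]])
  also have "\<dots> = (LINT x|lborel. (2 * pi) * (k x * cnj (k x)))" unfolding Fc by (simp add: mult_ac)
  also have "\<dots> = 2 * pi * L2_inner k k" unfolding L2_inner_def by (rule integral_mult_right_zero)
  finally have Fg: "L2_inner (fourier k) g = L2_inner g g" using kk by (simp add: L2_inner_def)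
  have gF: "L2_inner g (fourier k) = L2_inner g g"
    using L2_inner_commute[of g "fourier k"] L2_inner_commute[of g g] Fg by simp
  have "L2_inner (\<lambda>x. fourier k x - g x) (\<lambda>x. fourier k x - g x) = 0"
    by (simp add: L2_inner_diff L2_inner_diff_right L2_diff fourier_L2 k g FF Fg gF)
  from L2_eq_if_inner_zero[OF fourier_L2[OF k] g this] show ?thesis by (simp add: k_def)
qed

lemma fourier_inj:
  assumes "f \<in> L2" "g \<in> L2" "AE \<xi> in lborel. fourier f \<xi> = fourier g \<xi>"
  shows "AE x in lborel. f x = g x"
proof -
  have "AE \<xi> in lborel. fourier (\<lambda>x. f x - g x) \<xi> = 0"
    using fourier_diff[OF assms(1,2)] assms(3) by eventually_elim simp
  then have "lp_norm 2 (fourier (\<lambda>x. f x - g x)) = 0"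
    by (subst lp_norm_2_zero_iff) (simp_all add: fourier_L2 L2_diff assms)
  then have "lp_norm 2 (\<lambda>x. f x - g x) = 0" by (simp add: lp_norm_fourier L2_diff assms)
  then show ?thesis using lp_norm_2_zero_iff[OF L2_diff[OF assms(1,2)]] by simp
qed

text \<open>The pointwise counterpart of \<open>inv_fourier\<close>. Elements of the Hardy space
  have integrable transforms, so this integral supplies a representative for which pointwise bounds
  and evaluation at a point make sense.\<close>

definition inv_ft :: "(real \<Rightarrow> complex) \<Rightarrow> real \<Rightarrow> complex" where
  "inv_ft g x = (LINT \<xi>|lborel. cis (x * \<xi>) * g \<xi>) / (2 * pi)"

lemma inv_ft_eq_ft: "inv_ft g x = cnj (ft (\<lambda>\<xi>. cnj (g \<xi>)) x) / (2 * pi)"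
  unfolding inv_ft_def ft_def Bochner_Integration.integral_cnj[symmetric]
  by (simp add: cis_cnj mult.commute)

lemma inv_fourier_eq_inv_ft:
  assumes "g \<in> L2" "integrable lborel g"
  shows "AE x in lborel. inv_fourier g x = inv_ft g x"
  using fourier_eq_ft[OF L2_cnj[OF assms(1)]] assms(2)
  unfolding inv_fourier_def inv_ft_eq_ft by auto

lemma inv_ft_borel_measurable [measurable]:
  assumes [measurable]: "g \<in> borel_measurable borel"
  shows "inv_ft g \<in> borel_measurable borel"
  unfolding inv_ft_def[abs_def] by measurable

lemma
  assumes "g \<in> L2" "integrable lborel g"
  shows inv_ft_L2: "inv_ft g \<in> L2"
    and fourier_inv_ft: "AE \<xi> in lborel. fourier (inv_ft g) \<xi> = g \<xi>"
proof -
  have [measurable]: "g \<in> borel_measurable borel" using L2_measurable[OF assms(1)] by simp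
  have AE: "AE x in lborel. inv_ft g x = inv_fourier g x"
    using inv_fourier_eq_inv_ft[OF assms] by eventually_elim simp
  show L: "inv_ft g \<in> L2" by (rule L2_cong_AE[OF inv_fourier_L2[OF assms(1)] _ AE]) simp
  show "AE \<xi> in lborel. fourier (inv_ft g) \<xi> = g \<xi>"
    using fourier_inv_fourier[OF assms(1)] fourier_cong_AE[OF L inv_fourier_L2[OF assms(1)] AE] by simp
qed

section \<open>The projector to nonnegative frequencies, and translations\<close>

definition nonneg_part :: "(real \<Rightarrow> complex) \<Rightarrow> real \<Rightarrow> complex" where
  "nonneg_part g \<xi> = indicator {0..} \<xi> * g \<xi>"

lemma nonneg_part_L2: "g \<in> L2 \<Longrightarrow> nonneg_part g \<in> L2"
  unfolding nonneg_part_def[abs_def] by (rule L2_mult_bounded[of _ _ 1]) (auto simp: indicator_def)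

text \<open>The integrals over \<open>{0..N}\<close> in \<open>szego\<close> are, up to conjugation
  and a factor, transforms of truncations of the conjugated nonnegative part of
  \<open>fourier f\<close>. Their convergence is thus an instance of that of \<open>fourier\<close>,
  and the projector becomes multiplication by an indicator function.\<close>

lemma
  assumes "f \<in> L2"
  shows szego_L2: "szego f \<in> L2"
    and fourier_szego: "AE \<xi> in lborel. fourier (szego f) \<xi> = nonneg_part (fourier f) \<xi>"
proof -
  define g where "g = nonneg_part (fourier f)"
  have g: "g \<in> L2" unfolding g_def by (intro nonneg_part_L2 fourier_L2 assms)
  define F where "F N x = 1 / (2 * of_real pi) * (LINT \<xi>:{0..N}|lborel. cis (x * \<xi>) * fourier f \<xi>)" for N x
  have F: "F N = (\<lambda>x. 1 / (2 * pi) * cnj (ft (trunc N (\<lambda>\<xi>. cnj (g \<xi>))) x))" for N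
  proof
    fix x
    have "cnj (ft (trunc N (\<lambda>\<xi>. cnj (g \<xi>))) x) = (LINT \<xi>|lborel. cnj (cis (- (\<xi> * x)) * trunc N (\<lambda>\<xi>. cnj (g \<xi>)) \<xi>))"
      unfolding ft_def by (simp only: Bochner_Integration.integral_cnj)
    also have "\<dots> = (LINT \<xi>:{0..N}|lborel. cis (x * \<xi>) * fourier f \<xi>)"
      unfolding set_lebesgue_integral_def
      by (intro Bochner_Integration.integral_cong)
        (auto simp: trunc_def g_def nonneg_part_def indicator_def cis_cnj mult.commute)
    finally show "F N x = 1 / (2 * pi) * cnj (ft (trunc N (\<lambda>\<xi>. cnj (g \<xi>))) x)" by (simp add: F_def)
  qed
  have FL: "F N \<in> L2" for N
    unfolding F by (intro L2_cmult L2_cnj ft_L2 trunc_L2 trunc_integrable g)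
  have inv: "inv_fourier g = (\<lambda>x. 1 / (2 * pi) * cnj (fourier (\<lambda>\<xi>. cnj (g \<xi>)) x))"
    by (simp add: fun_eq_iff inv_fourier_def)
  have lim: "((\<lambda>N. abs_l2 (F N)) \<longlongrightarrow> abs_l2 (inv_fourier g)) at_top"
    unfolding F inv
    by (rule abs_l2_cmult_tendsto[where C = "cmod (1 / (2 * pi))"])
      (auto intro!: L2_cnj ft_L2 trunc_L2 trunc_integrable g fourier_L2 abs_l2_cnj_tendsto fourier_tendsto)
  have ex: "\<exists>h. L2_limit F h" unfolding L2_limit_iff[OF FL] using lim inv_fourier_L2[OF g] by blast
  have "L2_limit F (szego f)" unfolding szego_def F_def[symmetric, abs_def] by (rule someI_ex[OF ex])
  then have sz: "szego f \<in> L2" "((\<lambda>N. abs_l2 (F N)) \<longlongrightarrow> abs_l2 (szego f)) at_top"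
    unfolding L2_limit_iff[OF FL] by blast+
  show "szego f \<in> L2" by (rule sz)
  have "AE x in lborel. szego f x = inv_fourier g x"
    using tendsto_unique[OF trivial_limit_at_top_linorder sz(2) lim] abs_l2_eq_iff[OF sz(1) inv_fourier_L2[OF g]] by simp
  then have "fourier (szego f) = fourier (inv_fourier g)" by (intro fourier_cong_AE sz inv_fourier_L2 g)
  then show "AE \<xi> in lborel. fourier (szego f) \<xi> = nonneg_part (fourier f) \<xi>"
    using fourier_inv_fourier[OF g] by (simp add: g_def)
qed

lemma L2_plus_iff: "f \<in> L2_plus \<longleftrightarrow> f \<in> L2 \<and> (AE \<xi> in lborel. \<xi> < 0 \<longrightarrow> fourier f \<xi> = 0)"
proof (intro iffI conjI)
  assume "f \<in> L2_plus"
  then obtain h where f: "f \<in> L2" and h: "h \<in> L2" "AE x in lborel. f x = szego h x" by (auto simp: L2_plus_def)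
  show "f \<in> L2" by (rule f)
  show "AE \<xi> in lborel. \<xi> < 0 \<longrightarrow> fourier f \<xi> = 0"
    using fourier_szego[OF h(1)] unfolding fourier_cong_AE[OF f szego_L2[OF h(1)] h(2)]
    by eventually_elim (auto simp: nonneg_part_def)
next
  assume f: "f \<in> L2 \<and> (AE \<xi> in lborel. \<xi> < 0 \<longrightarrow> fourier f \<xi> = 0)"
  then have fL: "f \<in> L2" and AE: "AE \<xi> in lborel. \<xi> < 0 \<longrightarrow> fourier f \<xi> = 0" by auto
  have "AE \<xi> in lborel. fourier f \<xi> = fourier (szego f) \<xi>"
    using fourier_szego[OF fL] AE by eventually_elim (auto simp: nonneg_part_def indicator_def)
  from fourier_inj[OF fL szego_L2[OF fL] this] fL show "f \<in> L2_plus" by (auto simp: L2_plus_def)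
qed

lemma L2_translate:
  assumes "f \<in> L2"
  shows "(\<lambda>x. f (x - a)) \<in> L2" "lp_norm 2 (\<lambda>x. f (x - a)) = lp_norm 2 f"
proof -
  have [measurable]: "f \<in> borel_measurable borel" using L2_measurable[OF assms] by simp
  have "integrable lborel (\<lambda>x. (cmod (f (- a + 1 * x)))\<^sup>2)"
    by (rule lborel_integrable_real_affine[OF L2_integrable_power2[OF assms]]) simp
  then show "(\<lambda>x. f (x - a)) \<in> L2" by (simp add: L2_def)
  show "lp_norm 2 (\<lambda>x. f (x - a)) = lp_norm 2 f"
    using lborel_integral_real_affine[of 1 "\<lambda>x. (cmod (f x))\<^sup>2" "- a"] by (simp add: lp_norm_2)
qed

lemma ft_translate: "ft (\<lambda>x. f (x - a)) \<xi> = cis (- (a * \<xi>)) * ft f \<xi>"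
proof -
  have "ft f \<xi> = (LINT x|lborel. cis (- ((x - a) * \<xi>)) * f (x - a))"
    unfolding ft_def using lborel_integral_real_affine[of 1 "\<lambda>x. cis (- (x * \<xi>)) * f x" "- a"] by simp
  also have "\<dots> = (LINT x|lborel. cis (a * \<xi>) * (cis (- (x * \<xi>)) * f (x - a)))"
    by (intro Bochner_Integration.integral_cong refl) (simp add: cis_mult mult.assoc[symmetric] algebra_simps)
  also have "\<dots> = cis (a * \<xi>) * ft (\<lambda>x. f (x - a)) \<xi>" unfolding ft_def by simp
  finally show ?thesis by (simp add: mult.assoc[symmetric] cis_mult)
qed

lemma fourier_translate:
  assumes "f \<in> L2"
  shows "AE \<xi> in lborel. fourier (\<lambda>x. f (x - a)) \<xi> = cis (- (a * \<xi>)) * fourier f \<xi>"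
proof -
  define s where "s N x = trunc N f (x - a)" for N x
  have s: "s N \<in> L2" "integrable lborel (s N)" for N
  proof -
    show "s N \<in> L2" unfolding s_def[abs_def] by (rule L2_translate[OF trunc_L2[OF assms]])
    have "integrable lborel (\<lambda>x. trunc N f (- a + 1 * x))"
      by (rule lborel_integrable_real_affine[OF trunc_integrable[OF assms]]) simp
    then show "integrable lborel (s N)" by (simp add: s_def[abs_def])
  qed
  have "lp_norm 2 (\<lambda>x. s N x - f (x - a)) = lp_norm 2 (\<lambda>x. trunc N f x - f x)" for N
    unfolding s_def using L2_translate(2)[OF L2_diff[OF trunc_L2[OF assms] assms]] by simp
  then have "((\<lambda>N. abs_l2 (s N)) \<longlongrightarrow> abs_l2 (\<lambda>x. f (x - a))) at_top"
    using trunc_tendsto[OF assms] by (simp add: abs_l2_tendsto_iff s L2_translate trunc_L2 assms)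
  then have L1: "((\<lambda>N. abs_l2 (fourier (s N))) \<longlongrightarrow> abs_l2 (fourier (\<lambda>x. f (x - a)))) at_top"
    by (intro fourier_continuous s L2_translate assms)
  have "((\<lambda>N. abs_l2 (\<lambda>\<xi>. cis (- (a * \<xi>)) * ft (trunc N f) \<xi>)) \<longlongrightarrow> abs_l2 (\<lambda>\<xi>. cis (- (a * \<xi>)) * fourier f \<xi>)) at_top"
    by (rule abs_l2_cmult_tendsto[where C = 1])
      (simp_all add: ft_L2 trunc_L2 trunc_integrable fourier_L2 fourier_tendsto assms)
  moreover have "abs_l2 (\<lambda>\<xi>. cis (- (a * \<xi>)) * ft (trunc N f) \<xi>) = abs_l2 (fourier (s N))" for N
  proof -
    have "(\<lambda>\<xi>. cis (- (a * \<xi>)) * ft (trunc N f) \<xi>) = ft (s N)"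
      unfolding s_def[abs_def] by (simp add: fun_eq_iff ft_translate)
    moreover have "abs_l2 (ft (s N)) = abs_l2 (fourier (s N))"
      using fourier_eq_ft[OF s, of N] by (subst abs_l2_eq_iff) (auto simp: ft_L2 s fourier_L2 eq_commute)
    ultimately show ?thesis by simp
  qed
  ultimately have L2: "((\<lambda>N. abs_l2 (fourier (s N))) \<longlongrightarrow> abs_l2 (\<lambda>\<xi>. cis (- (a * \<xi>)) * fourier f \<xi>)) at_top"
    by simp
  have "(\<lambda>\<xi>. cis (- (a * \<xi>)) * fourier f \<xi>) \<in> L2"
    by (rule L2_mult_bounded[of _ _ 1]) (auto intro: fourier_L2 assms)
  with tendsto_unique[OF trivial_limit_at_top_linorder L1 L2] show ?thesis
    by (simp add: abs_l2_eq_iff fourier_L2 L2_translate assms)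
qed

section \<open>Test functions and weak derivatives\<close>

text \<open>\<open>test_function\<close> asks for every iterated \<open>deriv\<close>. Working
  inside a family closed under differentiation reduces this to computing a single derivative
  there.\<close>

lemma smooth_if_closed_under_deriv:
  fixes S :: "(real \<Rightarrow> real) set"
  assumes S: "\<And>f. f \<in> S \<Longrightarrow> \<exists>g\<in>S. \<forall>x. (f has_field_derivative g x) (at x)" and "f \<in> S"
  shows "(deriv ^^ n) f \<in> S \<and> (\<forall>x. (deriv ^^ n) f field_differentiable (at x))"
proof -
  have "(deriv ^^ n) f \<in> S"
  proof (induction n)
    case (Suc n)
    obtain g where g: "g \<in> S" "\<And>x. ((deriv ^^ n) f has_field_derivative g x) (at x)" using S[OF Suc] by blast
    have "deriv ((deriv ^^ n) f) = g" using DERIV_imp_deriv[OF g(2)] by (simp add: fun_eq_iff)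
    with g(1) show ?case by simp
  qed (use assms(2) in simp)
  then show ?thesis using S field_differentiable_def by blast
qed

text \<open>The standard flat function is the case \<open>k = 0\<close>. The powers of
  \<open>inverse s\<close> are what differentiation brings in, so the derivative of a member is a
  linear combination of members.\<close>

definition flat :: "nat \<Rightarrow> real \<Rightarrow> real" where
  "flat k s = (if s > 0 then exp (- inverse s) * inverse s ^ k else 0)"

lemma flat_has_derivative: "(flat k has_field_derivative (flat (k + 2) s - real k * flat (k + 1) s)) (at s)"
proof -
  consider "s > 0" | "s < 0" | "s = 0" by linarith
  then show ?thesis
  proof cases
    case 1
    have "((\<lambda>s. exp (- inverse s) * inverse s ^ k) has_field_derivative (flat (k + 2) s - real k * flat (k + 1) s)) (at s)"
      using 1 by (auto intro!: derivative_eq_intros simp: flat_def)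
        (cases k; simp add: power2_eq_square algebra_simps)
    then show ?thesis
      by (rule DERIV_cong_ev[OF refl _ refl, THEN iffD1, rotated])
        (use eventually_nhds_in_open[of "{0<..}" s] 1 in \<open>auto elim!: eventually_mono simp: flat_def\<close>)
  next
    case 2
    have "((\<lambda>s. 0) has_field_derivative (flat (k + 2) s - real k * flat (k + 1) s)) (at s)"
      using 2 by (simp add: flat_def)
    then show ?thesis
      by (rule DERIV_cong_ev[OF refl _ refl, THEN iffD1, rotated])
        (use eventually_nhds_in_open[of "{..<0}" s] 2 in \<open>auto elim!: eventually_mono simp: flat_def\<close>)
  next
    case 3
    have l: "((\<lambda>h. (flat k (0 + h) - flat k 0) / h) \<longlongrightarrow> 0) (at_left 0)"
      by (rule tendsto_eventually) (auto simp: flat_def eventually_at_left[of "-1" 0] intro!: exI[of _ "-1"])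
    \<comment> \<open>The difference quotient from the right, where the exponential beats any power
      of \<open>inverse h\<close>. From the left the quotient is identically 0.\<close>
    have "((\<lambda>h::real. inverse h ^ (k + 1) / exp (inverse h)) \<longlongrightarrow> 0) (at_right 0)"
      by (rule filterlim_compose[OF tendsto_power_div_exp_0 filterlim_inverse_at_top_right])
    then have r: "((\<lambda>h. (flat k (0 + h) - flat k 0) / h) \<longlongrightarrow> 0) (at_right 0)"
    proof (rule Lim_transform_eventually)
      show "\<forall>\<^sub>F h::real in at_right 0. inverse h ^ (k + 1) / exp (inverse h) = (flat k (0 + h) - flat k 0) / h"
        using eventually_at_right_less[of "0::real"]
        by eventually_elim (simp add: flat_def exp_minus field_simps)
    qed
    show ?thesis unfolding 3 DERIV_def using l r by (simp add: flat_def filterlim_split_at)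
  qed
qed

text \<open>Polynomial coefficients absorb the factor that the chain rule produces for the argument
  \<open>1 - (x / N)\<^sup>2\<close>.\<close>

definition trig :: "real \<Rightarrow> real poly \<Rightarrow> real poly \<Rightarrow> real \<Rightarrow> real" where
  "trig \<xi> A B x = poly A x * cos (\<xi> * x) + poly B x * sin (\<xi> * x)"

lemma trig_has_derivative:
  "(trig \<xi> A B has_field_derivative trig \<xi> (pderiv A + smult \<xi> B) (pderiv B - smult \<xi> A) x) (at x)"
  unfolding trig_def[abs_def]
  by (auto intro!: derivative_eq_intros simp: algebra_simps)

lemma trig_mult_poly: "trig \<xi> A B x * poly C x = trig \<xi> (A * C) (B * C) x"
  by (simp add: trig_def algebra_simps)

lemma one_minus_power2_has_derivative:
  "((\<lambda>x::real. 1 - (x / N)\<^sup>2) has_field_derivative - 2 * x / N\<^sup>2) (at x)"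
proof -
  have "((\<lambda>x::real. x\<^sup>2) has_field_derivative 2 * x) (at x)" by (auto intro!: derivative_eq_intros)
  from DERIV_diff[OF DERIV_const DERIV_cdivide[OF this, of "N\<^sup>2"]] show ?thesis
    by (simp add: power_divide)
qed

text \<open>Sums are built into the family because the derivative of one product is a sum of three:
  one from the trigonometric factor and two from \<open>flat\<close>.\<close>

inductive_set cutoffs :: "real \<Rightarrow> real \<Rightarrow> (real \<Rightarrow> real) set" for N \<xi> where
  zero: "(\<lambda>x. 0) \<in> cutoffs N \<xi>"
| add: "f \<in> cutoffs N \<xi> \<Longrightarrow> (\<lambda>x. trig \<xi> A B x * flat k (1 - (x / N)\<^sup>2) + f x) \<in> cutoffs N \<xi>"

lemma cutoffs_closed_under_deriv:
  "f \<in> cutoffs N \<xi> \<Longrightarrow> \<exists>g\<in>cutoffs N \<xi>. \<forall>x. (f has_field_derivative g x) (at x)"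
proof (induction rule: cutoffs.induct)
  case zero
  show ?case using cutoffs.zero by (intro bexI[of _ "\<lambda>x. 0"]) auto
next
  case (add f A B k)
  then obtain g where g: "g \<in> cutoffs N \<xi>" "\<And>x. (f has_field_derivative g x) (at x)" by blast
  define C where "C = [:0, - 2 / N\<^sup>2:]"
  let ?q = "\<lambda>x. 1 - (x / N)\<^sup>2"
  define h where "h x = trig \<xi> (pderiv A + smult \<xi> B) (pderiv B - smult \<xi> A) x * flat k (?q x)
    + (trig \<xi> (A * C) (B * C) x * flat (k + 2) (?q x)
    + (trig \<xi> (A * (smult (- real k) C)) (B * (smult (- real k) C)) x * flat (k + 1) (?q x) + g x))" for x
  have "h \<in> cutoffs N \<xi>" unfolding h_def[abs_def] by (intro cutoffs.add g)
  moreover have "((\<lambda>x. trig \<xi> A B x * flat k (?q x) + f x) has_field_derivative h x) (at x)" for x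
  proof -
    have q: "(?q has_field_derivative poly C x) (at x)"
      using one_minus_power2_has_derivative by (simp add: C_def mult.commute)
    have "((\<lambda>x. flat k (?q x)) has_field_derivative (flat (k + 2) (?q x) - real k * flat (k + 1) (?q x)) * poly C x) (at x)"
      by (rule DERIV_chain2[OF flat_has_derivative q])
    from DERIV_add[OF DERIV_mult[OF trig_has_derivative this] g(2)] show ?thesis
      by (rule DERIV_cong) (simp only: h_def trig_mult_poly[symmetric] poly_smult, simp add: algebra_simps)
  qed
  ultimately show ?case by blast
qed

lemma cutoffs_support:
  assumes "N > 0"
  shows "f \<in> cutoffs N \<xi> \<Longrightarrow> \<bar>x\<bar> \<ge> N \<Longrightarrow> f x = 0"
proof (induction rule: cutoffs.induct)
  case (add f A B k)
  have "N\<^sup>2 \<le> x\<^sup>2" using add.prems assms by (metis abs_le_square_iff abs_of_pos)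
  then have "1 - (x / N)\<^sup>2 \<le> 0" using assms by (simp add: power_divide)
  then show ?case using add by (simp add: flat_def)
qed simp

lemma test_function_cutoffs:
  assumes "f \<in> cutoffs N \<xi>" "N > 0"
  shows "test_function f"
  unfolding test_function_def
proof (intro conjI)
  show "\<forall>n x. (deriv ^^ n) f field_differentiable (at x)"
    using smooth_if_closed_under_deriv[OF cutoffs_closed_under_deriv assms(1)] by blast
  have "{x. f x \<noteq> 0} \<subseteq> {-N..N}"
    using cutoffs_support[OF assms(2,1)] by (force simp: abs_le_iff)
  then have "bounded {x. f x \<noteq> 0}" using bounded_closed_interval bounded_subset by blast
  then show "compact (closure {x. f x \<noteq> 0})" by (rule compact_closure[THEN iffD2])
qed

text \<open>The factor \<open>exp 1\<close> makes the value at 0, and the limit for growing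
  \<open>N\<close>, equal to 1.\<close>

definition cutoff :: "real \<Rightarrow> real \<Rightarrow> real" where
  "cutoff N x = exp 1 * flat 0 (1 - (x / N)\<^sup>2)"

definition cutoff' :: "real \<Rightarrow> real \<Rightarrow> real" where
  "cutoff' N x = exp 1 * (- 2 * x / N\<^sup>2) * flat 2 (1 - (x / N)\<^sup>2)"

lemma cutoff_has_derivative: "(cutoff N has_field_derivative cutoff' N x) (at x)"
proof -
  have "((\<lambda>x. exp 1 * flat 0 (1 - (x / N)\<^sup>2)) has_field_derivative
      exp 1 * ((flat (0 + 2) (1 - (x / N)\<^sup>2) - real 0 * flat (0 + 1) (1 - (x / N)\<^sup>2)) * (- 2 * x / N\<^sup>2))) (at x)"
    by (rule DERIV_cmult[OF DERIV_chain2[OF flat_has_derivative one_minus_power2_has_derivative]])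
  then show ?thesis unfolding cutoff_def[abs_def]
    by (rule DERIV_cong) (simp add: cutoff'_def numeral_2_eq_2)
qed

lemma flat_borel_measurable [measurable]: "flat k \<in> borel_measurable borel"
  unfolding flat_def[abs_def] by measurable

lemma cutoff_borel_measurable [measurable]: "cutoff N \<in> borel_measurable borel"
  unfolding cutoff_def[abs_def] by measurable

lemma cutoff'_borel_measurable [measurable]: "cutoff' N \<in> borel_measurable borel"
  unfolding cutoff'_def[abs_def] by measurable

lemma cutoff_bounds: "0 \<le> cutoff N x" "cutoff N x \<le> 1"
proof -
  show "0 \<le> cutoff N x" by (simp add: cutoff_def flat_def)
  define s where "s = 1 - (x / N)\<^sup>2"
  have "exp 1 * flat 0 s \<le> 1"
  proof (cases "s > 0")
    case True
    then have "1 \<le> inverse s" by (simp add: s_def one_le_inverse)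
    then have "exp (1 - inverse s) \<le> 1" by simp
    then show ?thesis using True by (simp add: flat_def flip: exp_add)
  qed (simp add: flat_def)
  then show "cutoff N x \<le> 1" by (simp add: cutoff_def s_def)
qed

lemma flat_2_bound: "flat 2 s \<le> 2" "0 \<le> flat 2 s"
proof -
  show "flat 2 s \<le> 2"
  proof (cases "s > 0")
    case True
    define t where "t = inverse s"
    have t0: "0 \<le> t" using True by (simp add: t_def)
    have "1 + t + t\<^sup>2 / 2 \<le> exp t" by (rule exp_lower_Taylor_quadratic[OF t0])
    with t0 have "t\<^sup>2 \<le> 2 * exp t" by linarith
    then have "exp (- t) * t\<^sup>2 \<le> exp (- t) * (2 * exp t)" by (intro mult_left_mono) auto
    also have "\<dots> = 2" by (simp flip: exp_add)
    finally show ?thesis using True by (simp add: flat_def t_def)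
  qed (simp add: flat_def)
qed (simp add: flat_def)

lemma cutoff'_bound:
  assumes "N > 0"
  shows "\<bar>cutoff' N x\<bar> \<le> 4 * exp 1 / N"
proof (cases "\<bar>x\<bar> < N")
  case True
  have "\<bar>cutoff' N x\<bar> = exp 1 * (2 * \<bar>x\<bar> / N\<^sup>2) * flat 2 (1 - (x / N)\<^sup>2)"
    using flat_2_bound(2) by (simp add: cutoff'_def abs_mult)
  also have "\<dots> \<le> exp 1 * (2 * N / N\<^sup>2) * 2"
    using True flat_2_bound assms by (intro mult_mono divide_right_mono mult_nonneg_nonneg) auto
  also have "\<dots> = 4 * exp 1 / N" using assms by (simp add: power2_eq_square)
  finally show ?thesis .
next
  case False
  have "N\<^sup>2 \<le> x\<^sup>2" using False assms by (metis abs_le_square_iff abs_of_pos not_less)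
  then have "1 - (x / N)\<^sup>2 \<le> 0" using assms by (simp add: power_divide)
  then have "cutoff' N x = 0" by (simp add: cutoff'_def flat_def)
  then show ?thesis using assms by simp
qed

lemma cutoff_support:
  assumes "N > 0" "\<bar>x\<bar> \<ge> N"
  shows "cutoff N x = 0" "cutoff' N x = 0"
proof -
  have "N\<^sup>2 \<le> x\<^sup>2" using assms by (metis abs_le_square_iff abs_of_pos)
  then have "1 - (x / N)\<^sup>2 \<le> 0" using assms by (simp add: power_divide)
  then show "cutoff N x = 0" "cutoff' N x = 0" by (simp_all add: cutoff_def cutoff'_def flat_def)
qed

lemma cutoff_tendsto: "(\<lambda>n. cutoff (real (Suc n)) x) \<longlonglongrightarrow> 1"
proof -
  have "(\<lambda>n. x / real (Suc n)) \<longlonglongrightarrow> 0"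
    using tendsto_mult[OF tendsto_const[of x] LIMSEQ_inverse_real_of_nat] by (simp add: divide_inverse)
  then have "(\<lambda>n. 1 - (x / real (Suc n))\<^sup>2) \<longlonglongrightarrow> 1 - 0\<^sup>2" by (intro tendsto_intros)
  then have lim: "(\<lambda>n. 1 - (x / real (Suc n))\<^sup>2) \<longlonglongrightarrow> 1" by simp
  have "isCont (flat 0) 1" by (rule DERIV_isCont[OF flat_has_derivative])
  from isCont_tendsto_compose[OF this lim]
  have "(\<lambda>n. flat 0 (1 - (x / real (Suc n))\<^sup>2)) \<longlonglongrightarrow> flat 0 1" .
  then have "(\<lambda>n. exp 1 * flat 0 (1 - (x / real (Suc n))\<^sup>2)) \<longlonglongrightarrow> exp 1 * flat 0 1" by (intro tendsto_intros)
  moreover have "exp 1 * flat 0 1 = 1" by (simp add: flat_def flip: exp_add)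
  ultimately show ?thesis by (simp add: cutoff_def)
qed

lemma test_function_cutoff_trig:
  assumes "N > 0"
  shows "test_function (\<lambda>x. cutoff N x * cos (\<xi> * x))" "test_function (\<lambda>x. cutoff N x * sin (\<xi> * x))"
proof -
  have "(\<lambda>x. trig \<xi> [:exp 1:] 0 x * flat 0 (1 - (x / N)\<^sup>2) + 0) \<in> cutoffs N \<xi>"
    by (intro cutoffs.intros)
  moreover have "(\<lambda>x. trig \<xi> [:exp 1:] 0 x * flat 0 (1 - (x / N)\<^sup>2) + 0) = (\<lambda>x. cutoff N x * cos (\<xi> * x))"
    by (simp add: fun_eq_iff trig_def cutoff_def)
  ultimately show "test_function (\<lambda>x. cutoff N x * cos (\<xi> * x))" using test_function_cutoffs[OF _ assms] by metis
  have "(\<lambda>x. trig \<xi> 0 [:exp 1:] x * flat 0 (1 - (x / N)\<^sup>2) + 0) \<in> cutoffs N \<xi>"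
    by (intro cutoffs.intros)
  moreover have "(\<lambda>x. trig \<xi> 0 [:exp 1:] x * flat 0 (1 - (x / N)\<^sup>2) + 0) = (\<lambda>x. cutoff N x * sin (\<xi> * x))"
    by (simp add: fun_eq_iff trig_def cutoff_def)
  ultimately show "test_function (\<lambda>x. cutoff N x * sin (\<xi> * x))" using test_function_cutoffs[OF _ assms] by metis
qed

section \<open>Weak derivatives as Fourier multipliers\<close>

lemma L2_mult_compact_integrable:
  assumes "f \<in> L2" "b \<in> borel_measurable borel" "\<And>x. cmod (b x) \<le> C" "\<And>x. \<bar>x\<bar> \<ge> N \<Longrightarrow> b x = 0"
  shows "integrable lborel (\<lambda>x. b x * f x)"
proof -
  have [measurable]: "f \<in> borel_measurable borel" "b \<in> borel_measurable borel"
    using assms(2) L2_measurable[OF assms(1)] by simp_all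
  have C0: "C \<ge> 0" using assms(3)[of 0] norm_ge_zero order_trans by blast
  show ?thesis
  proof (rule Bochner_Integration.integrable_bound)
    show "integrable lborel (\<lambda>x. C * cmod (trunc N f x))"
      by (intro integrable_mult_right integrable_norm trunc_integrable assms)
    show "AE x in lborel. norm (b x * f x) \<le> norm (C * cmod (trunc N f x))"
    proof (rule AE_I2)
      fix x
      show "norm (b x * f x) \<le> norm (C * cmod (trunc N f x))"
      proof (cases "\<bar>x\<bar> \<ge> N")
        case False
        then have "trunc N f x = f x" by (auto simp: trunc_def indicator_def)
        then show ?thesis using assms(3)[of x] C0 by (simp add: norm_mult abs_mult mult_right_mono)
      qed (simp add: assms(4))
    qed
  qed measurable
qed

lemma ft_cos_sin:
  assumes "integrable lborel h"
  shows "ft h \<xi> = (LINT x|lborel. h x * of_real (cos (\<xi> * x))) - \<i> * (LINT x|lborel. h x * of_real (sin (\<xi> * x)))"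
proof -
  have i: "integrable lborel (\<lambda>x. h x * of_real (cos (\<xi> * x)))" "integrable lborel (\<lambda>x. h x * of_real (sin (\<xi> * x)))"
  proof -
    have [measurable]: "h \<in> borel_measurable borel" using borel_measurable_integrable[OF assms] by simp
    show "integrable lborel (\<lambda>x. h x * of_real (cos (\<xi> * x)))" "integrable lborel (\<lambda>x. h x * of_real (sin (\<xi> * x)))"
      by (rule Bochner_Integration.integrable_bound[OF assms]; simp add: norm_mult mult_left_le)+
  qed
  have "ft h \<xi> = (LINT x|lborel. h x * of_real (cos (\<xi> * x)) - \<i> * (h x * of_real (sin (\<xi> * x))))"
    unfolding ft_def
    by (intro Bochner_Integration.integral_cong refl) (simp add: complex_eq_iff mult.commute algebra_simps)
  also have "\<dots> = (LINT x|lborel. h x * of_real (cos (\<xi> * x))) - \<i> * (LINT x|lborel. h x * of_real (sin (\<xi> * x)))"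
    using i by simp
  finally show ?thesis .
qed

text \<open>Test functions being real, the weak derivative is tested separately against the cut-off
  times \<open>cos (\<xi> * x)\<close> and times \<open>sin (\<xi> * x)\<close>; cosine minus
  \<open>\<i>\<close> times sine restores the exponential. The last term is the derivative falling
  on the cut-off, where \<open>cutoff'\<close> is of order 1 / N.\<close>

lemma ft_weak_deriv_cutoff:
  assumes "f \<in> L2" "g \<in> L2" "has_weak_deriv f g" "N > 0"
  shows "ft (\<lambda>x. of_real (cutoff N x) * g x) \<xi> = \<i> * \<xi> * ft (\<lambda>x. of_real (cutoff N x) * f x) \<xi> - ft (\<lambda>x. of_real (cutoff' N x) * f x) \<xi>"
proof -
  have c1: "cmod (of_real (cutoff N x)) \<le> 1" for x using cutoff_bounds[of N x] by simp
  have c2: "cmod (of_real (cutoff' N x)) \<le> 4 * exp 1 / N" for x using cutoff'_bound[OF assms(4)] by simp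
  have i: "integrable lborel (\<lambda>x. of_real (cutoff N x) * h x)" "integrable lborel (\<lambda>x. of_real (cutoff' N x) * h x)"
    if "h \<in> L2" for h
    using L2_mult_compact_integrable[OF that _ c1, where N = N] L2_mult_compact_integrable[OF that _ c2, where N = N]
      cutoff_support[OF assms(4)] by simp_all
  have it: "integrable lborel (\<lambda>x. h x * of_real (cos (\<xi> * x)))" "integrable lborel (\<lambda>x. h x * of_real (sin (\<xi> * x)))"
    if h: "integrable lborel h" for h :: "real \<Rightarrow> complex"
  proof -
    have [measurable]: "h \<in> borel_measurable borel" using borel_measurable_integrable[OF h] by simp
    show "integrable lborel (\<lambda>x. h x * of_real (cos (\<xi> * x)))" "integrable lborel (\<lambda>x. h x * of_real (sin (\<xi> * x)))"
      by (rule Bochner_Integration.integrable_bound[OF h]; simp add: norm_mult mult_left_le)+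
  qed
  define u where "u = (\<lambda>x. of_real (cutoff N x) * f x)"
  define u' where "u' = (\<lambda>x. of_real (cutoff' N x) * f x)"
  define v where "v = (\<lambda>x. of_real (cutoff N x) * g x)"
  have iu: "integrable lborel u" "integrable lborel u'" "integrable lborel v"
    unfolding u_def u'_def v_def by (intro i assms)+
  have dc: "deriv (\<lambda>x. cutoff N x * cos (\<xi> * x)) x = cutoff' N x * cos (\<xi> * x) - \<xi> * (cutoff N x * sin (\<xi> * x))" for x
    by (rule DERIV_imp_deriv) (auto intro!: derivative_eq_intros cutoff_has_derivative simp: algebra_simps)
  have ds: "deriv (\<lambda>x. cutoff N x * sin (\<xi> * x)) x = cutoff' N x * sin (\<xi> * x) + \<xi> * (cutoff N x * cos (\<xi> * x))" for x
    by (rule DERIV_imp_deriv) (auto intro!: derivative_eq_intros cutoff_has_derivative simp: algebra_simps)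
  have "(LINT x|lborel. f x * of_real (deriv (\<lambda>x. cutoff N x * cos (\<xi> * x)) x)) = - (LINT x|lborel. g x * of_real (cutoff N x * cos (\<xi> * x)))"
    using assms(3) test_function_cutoff_trig(1)[OF assms(4)] by (simp add: has_weak_deriv_def)
  moreover have "(LINT x|lborel. f x * of_real (deriv (\<lambda>x. cutoff N x * cos (\<xi> * x)) x))
      = (LINT x|lborel. u' x * of_real (cos (\<xi> * x)) - of_real \<xi> * (u x * of_real (sin (\<xi> * x))))"
    unfolding dc u_def u'_def by (intro Bochner_Integration.integral_cong refl) (simp add: algebra_simps)
  moreover have "\<dots> = (LINT x|lborel. u' x * of_real (cos (\<xi> * x))) - of_real \<xi> * (LINT x|lborel. u x * of_real (sin (\<xi> * x)))"
    using it[OF iu(1)] it[OF iu(2)] by simp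
  moreover have "(LINT x|lborel. g x * of_real (cutoff N x * cos (\<xi> * x))) = (LINT x|lborel. v x * of_real (cos (\<xi> * x)))"
    unfolding v_def by (intro Bochner_Integration.integral_cong refl) (simp add: algebra_simps)
  ultimately have 1: "(LINT x|lborel. u' x * of_real (cos (\<xi> * x))) - of_real \<xi> * (LINT x|lborel. u x * of_real (sin (\<xi> * x)))
      = - (LINT x|lborel. v x * of_real (cos (\<xi> * x)))" by simp
  have "(LINT x|lborel. f x * of_real (deriv (\<lambda>x. cutoff N x * sin (\<xi> * x)) x)) = - (LINT x|lborel. g x * of_real (cutoff N x * sin (\<xi> * x)))"
    using assms(3) test_function_cutoff_trig(2)[OF assms(4)] by (simp add: has_weak_deriv_def)
  moreover have "(LINT x|lborel. f x * of_real (deriv (\<lambda>x. cutoff N x * sin (\<xi> * x)) x))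
      = (LINT x|lborel. u' x * of_real (sin (\<xi> * x)) + of_real \<xi> * (u x * of_real (cos (\<xi> * x))))"
    unfolding ds u_def u'_def by (intro Bochner_Integration.integral_cong refl) (simp add: algebra_simps)
  moreover have "\<dots> = (LINT x|lborel. u' x * of_real (sin (\<xi> * x))) + of_real \<xi> * (LINT x|lborel. u x * of_real (cos (\<xi> * x)))"
    using it[OF iu(1)] it[OF iu(2)] by simp
  moreover have "(LINT x|lborel. g x * of_real (cutoff N x * sin (\<xi> * x))) = (LINT x|lborel. v x * of_real (sin (\<xi> * x)))"
    unfolding v_def by (intro Bochner_Integration.integral_cong refl) (simp add: algebra_simps)
  ultimately have 2: "(LINT x|lborel. u' x * of_real (sin (\<xi> * x))) + of_real \<xi> * (LINT x|lborel. u x * of_real (cos (\<xi> * x)))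
      = - (LINT x|lborel. v x * of_real (sin (\<xi> * x)))" by simp
  have arith: "a - z * d = - e \<Longrightarrow> b + z * c = - h \<Longrightarrow> e - \<i> * h = \<i> * z * (c - \<i> * d) - (a - \<i> * b)"
    for a b c d e h z :: complex
  proof -
    assume A: "a - z * d = - e" and B: "b + z * c = - h"
    have e: "e = z * d - a" using A by (simp add: algebra_simps)
    have "h = - (b + z * c)" unfolding B by simp
    then have h: "h = - b - z * c" by simp
    show ?thesis unfolding e h by (simp add: algebra_simps)
  qed
  have "ft v \<xi> = \<i> * \<xi> * ft u \<xi> - ft u' \<xi>"
    unfolding ft_cos_sin[OF iu(1)] ft_cos_sin[OF iu(2)] ft_cos_sin[OF iu(3)] by (rule arith[OF 1 2])
  then show ?thesis by (simp add: u_def u'_def v_def)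
qed

lemma lp_norm_2_mono:
  assumes "g \<in> L2" "f \<in> borel_measurable borel" "\<And>x. cmod (f x) \<le> C * cmod (g x)" "C \<ge> 0"
  shows "lp_norm 2 f \<le> C * lp_norm 2 g"
proof -
  have f: "f \<in> L2" by (rule L2_dominated[OF assms(1)]) (use assms in auto)
  have "(LINT x|lborel. (cmod (f x))\<^sup>2) \<le> (LINT x|lborel. C\<^sup>2 * (cmod (g x))\<^sup>2)"
  proof (rule integral_mono)
    show "(cmod (f x))\<^sup>2 \<le> C\<^sup>2 * (cmod (g x))\<^sup>2" for x
      using power_mono[OF assms(3)[of x], of 2] by (simp add: power_mult_distrib)
  qed (intro integrable_mult_right L2_integrable_power2 f assms)+
  then have "sqrt (LINT x|lborel. (cmod (f x))\<^sup>2) \<le> sqrt (C\<^sup>2 * (LINT x|lborel. (cmod (g x))\<^sup>2))" by simp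
  then show ?thesis using assms(4) by (simp add: lp_norm_2 real_sqrt_mult)
qed

lemma L2_tendsto_dominated:
  assumes "f \<in> L2" "\<And>n::nat. s n \<in> borel_measurable borel" "\<And>n x. cmod (s n x - f x) \<le> cmod (f x)"
    and "\<And>x. (\<lambda>n. s n x) \<longlonglongrightarrow> f x"
  shows "(\<lambda>n. lp_norm 2 (\<lambda>x. s n x - f x)) \<longlonglongrightarrow> 0"
proof -
  have [measurable]: "f \<in> borel_measurable borel" "\<And>n. s n \<in> borel_measurable borel"
    using L2_measurable[OF assms(1)] assms(2) by simp_all
  have "(\<lambda>n. LINT x|lborel. (cmod (s n x - f x))\<^sup>2) \<longlonglongrightarrow> (LINT x::real|lborel. 0)"
  proof (rule integral_dominated_convergence)
    show "integrable lborel (\<lambda>x. (cmod (f x))\<^sup>2)" by (rule L2_integrable_power2[OF assms(1)])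
    show "AE x in lborel. (\<lambda>n. (cmod (s n x - f x))\<^sup>2) \<longlonglongrightarrow> 0"
    proof (rule AE_I2)
      fix x
      have "(\<lambda>n. (cmod (s n x - f x))\<^sup>2) \<longlonglongrightarrow> (cmod (f x - f x))\<^sup>2" by (intro tendsto_intros assms(4))
      then show "(\<lambda>n. (cmod (s n x - f x))\<^sup>2) \<longlonglongrightarrow> 0" by simp
    qed
    show "AE x in lborel. norm ((cmod (s n x - f x))\<^sup>2) \<le> (cmod (f x))\<^sup>2" for n
      using assms(3)[of n] by (intro AE_I2) (simp add: power_mono)
  qed simp_all
  then have "(\<lambda>n. sqrt (LINT x|lborel. (cmod (s n x - f x))\<^sup>2)) \<longlonglongrightarrow> sqrt 0" by (intro tendsto_real_sqrt) simp
  then show ?thesis by (simp add: lp_norm_2)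
qed

text \<open>Testing against cut-off exponentials gives the formula pointwise for the cut-off functions. The
  cut-off is removed in \<open>L\<^sup>2\<close>, after multiplication by \<open>1 / (1 + \<xi>\<^sup>2)\<close> to keep all multipliers bounded.\<close>
lemma fourier_weak_deriv:
  assumes f: "f \<in> L2" and g: "g \<in> L2" and w: "has_weak_deriv f g"
  shows "AE \<xi> in lborel. fourier g \<xi> = \<i> * \<xi> * fourier f \<xi>"
proof -
  have [measurable]: "f \<in> borel_measurable borel" "g \<in> borel_measurable borel" using f g L2_measurable by simp_all
  define eta where "eta n = cutoff (real (Suc n))" for n
  define eta' where "eta' n = cutoff' (real (Suc n))" for n
  have [measurable]: "eta n \<in> borel_measurable borel" "eta' n \<in> borel_measurable borel" for n
    by (simp_all add: eta_def eta'_def)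
  have c1: "cmod (of_real (eta n x)) \<le> 1" for n x using cutoff_bounds[of "real (Suc n)" x] by (simp add: eta_def)
  have c2: "cmod (of_real (eta' n x)) \<le> 4 * exp 1 / real (Suc n)" for n x
    using cutoff'_bound[of "real (Suc n)" x] by (simp add: eta'_def)
  have L: "(\<lambda>x. of_real (eta n x) * h x) \<in> L2" "(\<lambda>x. of_real (eta' n x) * h x) \<in> L2" if "h \<in> L2" for h n
    by (rule L2_mult_bounded[OF that _ c1], simp, rule L2_mult_bounded[OF that _ c2], simp)
  have z: "of_real (eta n x) = (0::complex)" "of_real (eta' n x) = (0::complex)" if "\<bar>x\<bar> \<ge> real (Suc n)" for n x
    using cutoff_support[OF _ that] by (simp_all add: eta_def eta'_def)
  have I: "integrable lborel (\<lambda>x. of_real (eta n x) * h x)" "integrable lborel (\<lambda>x. of_real (eta' n x) * h x)" if "h \<in> L2" for h n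
  proof -
    have "(\<lambda>x. complex_of_real (eta n x)) \<in> borel_measurable borel" "(\<lambda>x. complex_of_real (eta' n x)) \<in> borel_measurable borel"
      by measurable
    note m = this
    show "integrable lborel (\<lambda>x. of_real (eta n x) * h x)"
      by (rule L2_mult_compact_integrable[where b = "\<lambda>x. of_real (eta n x)" and C = 1 and N = "real (Suc n)"])
        (use that m c1 z in auto)
    show "integrable lborel (\<lambda>x. of_real (eta' n x) * h x)"
      by (rule L2_mult_compact_integrable[where b = "\<lambda>x. of_real (eta' n x)" and C = "4 * exp 1 / real (Suc n)" and N = "real (Suc n)"])
        (use that m c2 z in \<open>auto simp del: of_nat_Suc\<close>)
  qed
  have lim: "(\<lambda>n. abs_l2 (\<lambda>x. of_real (eta n x) * h x)) \<longlonglongrightarrow> abs_l2 h" if h: "h \<in> L2" for h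
  proof -
    have [measurable]: "h \<in> borel_measurable borel" using L2_measurable[OF h] by simp
    have "(\<lambda>n. lp_norm 2 (\<lambda>x. of_real (eta n x) * h x - h x)) \<longlonglongrightarrow> 0"
    proof (rule L2_tendsto_dominated[OF h])
      fix n x
      have "of_real (eta n x) * h x - h x = of_real (eta n x - 1) * h x" by (simp add: algebra_simps)
      then have "cmod (of_real (eta n x) * h x - h x) = \<bar>eta n x - 1\<bar> * cmod (h x)" by (simp only: norm_mult norm_of_real)
      also have "\<dots> \<le> 1 * cmod (h x)"
        using cutoff_bounds[of "real (Suc n)" x] by (intro mult_right_mono) (auto simp: eta_def)
      finally show "cmod (of_real (eta n x) * h x - h x) \<le> cmod (h x)" by simp
    next
      fix x
      have "(\<lambda>n. of_real (eta n x) * h x) \<longlonglongrightarrow> of_real 1 * h x"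
        unfolding eta_def by (intro tendsto_mult tendsto_of_real tendsto_const cutoff_tendsto)
      then show "(\<lambda>n. of_real (eta n x) * h x) \<longlonglongrightarrow> h x" by simp
    qed simp
    then show ?thesis by (simp add: abs_l2_tendsto_iff L h)
  qed
  have lim0: "(\<lambda>n. abs_l2 (\<lambda>x. of_real (eta' n x) * f x)) \<longlonglongrightarrow> abs_l2 (\<lambda>x. 0)"
  proof -
    have le: "lp_norm 2 (\<lambda>x. of_real (eta' n x) * f x) \<le> 4 * exp 1 / real (Suc n) * lp_norm 2 f" for n
    proof (rule lp_norm_2_mono[OF f])
      show "cmod (of_real (eta' n x) * f x) \<le> 4 * exp 1 / real (Suc n) * cmod (f x)" for x
        unfolding norm_mult by (rule mult_right_mono[OF c2 norm_ge_zero])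
    qed simp_all
    have lim: "(\<lambda>n. 4 * exp 1 / real (Suc n) * lp_norm 2 f) \<longlonglongrightarrow> 0"
      using tendsto_mult[OF tendsto_const[of "4 * exp 1 * lp_norm 2 f"] LIMSEQ_inverse_real_of_nat]
      by (simp add: divide_inverse mult_ac)
    have "\<forall>\<^sub>F n in sequentially. norm (lp_norm 2 (\<lambda>x. of_real (eta' n x) * f x)) \<le> 4 * exp 1 / real (Suc n) * lp_norm 2 f"
      by (rule always_eventually) (use le in simp)
    from Lim_null_comparison[OF this lim] show ?thesis by (simp add: abs_l2_tendsto_iff L f L2_zero)
  qed
  define b where "b \<xi> = \<i> * of_real (\<xi> / (1 + \<xi>\<^sup>2))" for \<xi> :: real
  define c where "c \<xi> = complex_of_real (1 / (1 + \<xi>\<^sup>2))" for \<xi> :: real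
  have pos: "1 + \<xi>\<^sup>2 > 0" for \<xi> :: real by (simp add: add_pos_nonneg)
  have b1: "cmod (b \<xi>) \<le> 1" for \<xi>
  proof -
    have "0 \<le> (1 - \<bar>\<xi>\<bar>)\<^sup>2" by simp
    then have "\<bar>\<xi>\<bar> \<le> 1 + \<xi>\<^sup>2" using abs_ge_zero[of \<xi>] unfolding power2_diff power2_abs by simp
    then show ?thesis using pos[of \<xi>] by (simp add: b_def norm_mult norm_divide del: of_real_divide)
  qed
  have c1': "cmod (c \<xi>) \<le> 1" for \<xi> using pos[of \<xi>] by (simp add: c_def norm_divide del: of_real_divide)
  have bm [measurable]: "b \<in> borel_measurable borel" "c \<in> borel_measurable borel"
    unfolding b_def[abs_def] c_def[abs_def] by measurable
  have bL: "(\<lambda>\<xi>. b \<xi> * h \<xi>) \<in> L2" "(\<lambda>\<xi>. c \<xi> * h \<xi>) \<in> L2" if "h \<in> L2" for h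
    by (rule L2_mult_bounded[OF that _ b1], simp, rule L2_mult_bounded[OF that _ c1'], simp)
  have A: "(\<lambda>n. abs_l2 (\<lambda>\<xi>. c \<xi> * fourier (\<lambda>x. of_real (eta n x) * g x) \<xi>)) \<longlonglongrightarrow> abs_l2 (\<lambda>\<xi>. c \<xi> * fourier g \<xi>)"
    by (rule abs_l2_cmult_tendsto[OF _ _ fourier_continuous[OF L(1)[OF g] g lim[OF g]] bm(2) c1']) (intro fourier_L2 L g)+
  have B: "(\<lambda>n. abs_l2 (\<lambda>\<xi>. b \<xi> * fourier (\<lambda>x. of_real (eta n x) * f x) \<xi>)) \<longlonglongrightarrow> abs_l2 (\<lambda>\<xi>. b \<xi> * fourier f \<xi>)"
    by (rule abs_l2_cmult_tendsto[OF _ _ fourier_continuous[OF L(1)[OF f] f lim[OF f]] bm(1) b1]) (intro fourier_L2 L f)+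
  have C: "(\<lambda>n. abs_l2 (\<lambda>\<xi>. c \<xi> * fourier (\<lambda>x. of_real (eta' n x) * f x) \<xi>)) \<longlonglongrightarrow> abs_l2 (\<lambda>\<xi>. c \<xi> * fourier (\<lambda>x. 0) \<xi>)"
    by (rule abs_l2_cmult_tendsto[OF _ _ fourier_continuous[OF L(2)[OF f] L2_zero lim0] bm(2) c1']) (intro fourier_L2 L f L2_zero)+
  have eq: "abs_l2 (\<lambda>\<xi>. b \<xi> * fourier (\<lambda>x. of_real (eta n x) * f x) \<xi>) - abs_l2 (\<lambda>\<xi>. c \<xi> * fourier (\<lambda>x. of_real (eta' n x) * f x) \<xi>)
      = abs_l2 (\<lambda>\<xi>. c \<xi> * fourier (\<lambda>x. of_real (eta n x) * g x) \<xi>)" for n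
  proof -
    have "AE \<xi> in lborel. b \<xi> * fourier (\<lambda>x. of_real (eta n x) * f x) \<xi> - c \<xi> * fourier (\<lambda>x. of_real (eta' n x) * f x) \<xi>
        = c \<xi> * fourier (\<lambda>x. of_real (eta n x) * g x) \<xi>"
      using fourier_eq_ft[OF L(1)[OF f] I(1)[OF f], of n] fourier_eq_ft[OF L(2)[OF f] I(2)[OF f], of n]
        fourier_eq_ft[OF L(1)[OF g] I(1)[OF g], of n]
    proof eventually_elim
      case (elim \<xi>)
      have bc: "b \<xi> = c \<xi> * (\<i> * \<xi>)" by (simp add: b_def c_def)
      show ?case
        unfolding elim bc using ft_weak_deriv_cutoff[OF f g w, of "real (Suc n)" \<xi>]
        by (simp add: eta_def eta'_def right_diff_distrib mult.assoc)
    qed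
    then show ?thesis by (simp add: abs_l2_diff abs_l2_eq_iff bL fourier_L2 L f g L2_diff)
  qed
  have "abs_l2 (\<lambda>\<xi>. b \<xi> * fourier f \<xi>) - abs_l2 (\<lambda>\<xi>. c \<xi> * fourier (\<lambda>x. 0) \<xi>) = abs_l2 (\<lambda>\<xi>. c \<xi> * fourier g \<xi>)"
    by (rule LIMSEQ_unique[OF tendsto_diff[OF B C, unfolded eq] A])
  then have "AE \<xi> in lborel. b \<xi> * fourier f \<xi> - c \<xi> * fourier (\<lambda>x. 0) \<xi> = c \<xi> * fourier g \<xi>"
    by (simp add: abs_l2_diff abs_l2_eq_iff bL fourier_L2 f g L2_diff L2_zero)
  moreover have "AE \<xi> in lborel. fourier (\<lambda>x. 0) \<xi> = 0"
    using fourier_cmult[OF L2_zero, of 0] by simp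
  ultimately show ?thesis
  proof eventually_elim
    case (elim \<xi>)
    have bc: "b \<xi> = c \<xi> * (\<i> * \<xi>)" by (simp add: b_def c_def)
    have "c \<xi> \<noteq> 0" using pos[of \<xi>] unfolding c_def of_real_eq_0_iff by simp
    then show ?case using elim by (simp add: bc mult.assoc)
  qed
qed

section \<open>Test functions in \<open>L2\<close> and the Fourier characterisation of
  \<open>H1\<close>\<close>

lemma test_function_has_derivative:
  assumes "test_function \<phi>"
  shows "(\<phi> has_field_derivative deriv \<phi> x) (at x)"
proof -
  have "(deriv ^^ 0) \<phi> field_differentiable (at x)" using assms unfolding test_function_def by blast
  then show ?thesis by (simp add: DERIV_deriv_iff_field_differentiable)
qed

lemma test_function_support:
  assumes "test_function \<phi>"
  shows "\<exists>R>0. \<forall>x. \<bar>x\<bar> \<ge> R \<longrightarrow> \<phi> x = 0 \<and> deriv \<phi> x = 0"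
proof -
  let ?K = "closure {x. \<phi> x \<noteq> 0}"
  have "bounded ?K" using assms compact_imp_bounded by (auto simp: test_function_def)
  then obtain R where R: "R > 0" "\<And>x. x \<in> ?K \<Longrightarrow> \<bar>x\<bar> \<le> R" unfolding bounded_pos by auto
  have out: "x \<notin> ?K" if "\<bar>x\<bar> \<ge> R + 1" for x using R(2)[of x] that by force
  have z: "\<phi> x = 0" if "x \<notin> ?K" for x
    using that subsetD[OF closure_subset, of x "{x. \<phi> x \<noteq> 0}"] by auto
  have "deriv \<phi> x = 0" if "x \<notin> ?K" for x
  proof (rule DERIV_imp_deriv)
    have "((\<lambda>x. 0) has_field_derivative 0) (at x)" by simp
    then show "(\<phi> has_field_derivative 0) (at x)"
    proof (rule has_field_derivative_transform_within_open)
      show "open (- ?K)" by (rule open_Compl[OF closed_closure])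
      show "x \<in> - ?K" using that by simp
      show "0 = \<phi> y" if "y \<in> - ?K" for y by (rule z[OF ComplD[OF that], symmetric])
    qed
  qed
  then have "\<phi> x = 0 \<and> deriv \<phi> x = 0" if "\<bar>x\<bar> \<ge> R + 1" for x using z[OF out[OF that]] out[OF that] by blast
  then show ?thesis using R(1) by (intro exI[of _ "R + 1"]) simp
qed

lemma test_function_deriv:
  assumes "test_function \<phi>"
  shows "test_function (deriv \<phi>)"
proof -
  obtain R where "R > 0 \<and> (\<forall>x. \<bar>x\<bar> \<ge> R \<longrightarrow> \<phi> x = 0 \<and> deriv \<phi> x = 0)"
    using test_function_support[OF assms] by (rule exE)
  then have R0: "R > 0" "\<And>x. \<bar>x\<bar> \<ge> R \<Longrightarrow> \<phi> x = 0" "\<And>x. \<bar>x\<bar> \<ge> R \<Longrightarrow> deriv \<phi> x = 0"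
    by blast+
  note R = R0(1,3)
  have "(deriv ^^ n) (deriv \<phi>) field_differentiable (at x)" for n x
  proof -
    have "(deriv ^^ Suc n) \<phi> field_differentiable (at x)" using assms unfolding test_function_def by blast
    then show ?thesis by (simp only: funpow_Suc_right o_apply)
  qed
  moreover have "{x. deriv \<phi> x \<noteq> 0} \<subseteq> {-R..R}" using R(2) by (force simp: abs_le_iff)
  then have "bounded {x. deriv \<phi> x \<noteq> 0}" using bounded_closed_interval bounded_subset by blast
  then have "compact (closure {x. deriv \<phi> x \<noteq> 0})" by (rule compact_closure[THEN iffD2])
  ultimately show ?thesis by (simp add: test_function_def)
qed

lemma test_function_continuous: "test_function \<phi> \<Longrightarrow> continuous_on A \<phi>"
  by (meson DERIV_isCont continuous_at_imp_continuous_on test_function_has_derivative)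

lemma test_function_L2:
  assumes "test_function \<phi>"
  shows "(\<lambda>x. complex_of_real (\<phi> x)) \<in> L2"
proof -
  obtain R where "R > 0 \<and> (\<forall>x. \<bar>x\<bar> \<ge> R \<longrightarrow> \<phi> x = 0 \<and> deriv \<phi> x = 0)"
    using test_function_support[OF assms] by (rule exE)
  then have R: "R > 0" "\<And>x. \<bar>x\<bar> \<ge> R \<Longrightarrow> \<phi> x = 0" "\<And>x. \<bar>x\<bar> \<ge> R \<Longrightarrow> deriv \<phi> x = 0"
    by blast+
  have "bounded (\<phi> ` {-R..R})"
    by (intro compact_imp_bounded compact_continuous_image test_function_continuous[OF assms]) simp
  then obtain C where "\<forall>y\<in>\<phi> ` {-R..R}. norm y \<le> C" unfolding bounded_iff by (rule exE)
  then have C: "\<And>x. x \<in> {-R..R} \<Longrightarrow> \<bar>\<phi> x\<bar> \<le> C" by simp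
  have [measurable]: "\<phi> \<in> borel_measurable borel"
    by (rule borel_measurable_continuous_onI[OF test_function_continuous[OF assms]])
  show ?thesis
  proof (rule L2_dominated[OF L2_indicator_Icc[of "-R" R], of _ C])
    show "AE x in lborel. cmod (complex_of_real (\<phi> x)) \<le> C * cmod (indicator {-R..R} x)"
    proof (rule AE_I2)
      fix x
      show "cmod (complex_of_real (\<phi> x)) \<le> C * cmod (indicator {-R..R} x)"
        using C[of x] R(2)[of x] by (cases "x \<in> {-R..R}") (auto simp: abs_le_iff)
    qed
  qed simp
qed

lemma has_weak_deriv_test_function:
  assumes \<phi>: "test_function \<phi>"
  shows "has_weak_deriv (\<lambda>x. complex_of_real (\<phi> x)) (\<lambda>x. complex_of_real (deriv \<phi> x))"
  unfolding has_weak_deriv_def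
proof (intro allI impI)
  fix \<psi> assume \<psi>: "test_function \<psi>"
  obtain R where "R > 0 \<and> (\<forall>x. \<bar>x\<bar> \<ge> R \<longrightarrow> \<phi> x = 0 \<and> deriv \<phi> x = 0)"
    using test_function_support[OF \<phi>] by (rule exE)
  then have R: "R > 0" "\<And>x. \<bar>x\<bar> \<ge> R \<Longrightarrow> \<phi> x = 0" "\<And>x. \<bar>x\<bar> \<ge> R \<Longrightarrow> deriv \<phi> x = 0"
    by blast+
  note L = test_function_L2[OF \<phi>] test_function_L2[OF \<psi>] test_function_L2[OF test_function_deriv[OF \<phi>]]
    test_function_L2[OF test_function_deriv[OF \<psi>]]
  have c: "continuous_on A \<phi>" "continuous_on A \<psi>" "continuous_on A (deriv \<phi>)" "continuous_on A (deriv \<psi>)" for A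
    using test_function_continuous[OF \<phi>] test_function_continuous[OF \<psi>]
      test_function_continuous[OF test_function_deriv[OF \<phi>]] test_function_continuous[OF test_function_deriv[OF \<psi>]] by simp_all
  define F where "F x = complex_of_real (deriv \<phi> x * \<psi> x + \<phi> x * deriv \<psi> x)" for x
  have "(LINT x|lborel. indicator {-R..R} x *\<^sub>R F x) = complex_of_real (\<phi> R * \<psi> R) - complex_of_real (\<phi> (-R) * \<psi> (-R))"
  proof (rule integral_FTC_Icc)
    show "((\<lambda>x. complex_of_real (\<phi> x * \<psi> x)) has_vector_derivative F x) (at x within {-R..R})" for x
    proof -
      have "((\<lambda>x. \<phi> x * \<psi> x) has_field_derivative (deriv \<phi> x * \<psi> x + \<phi> x * deriv \<psi> x)) (at x within {-R..R})"
      proof (rule has_field_derivative_at_within)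
        show "((\<lambda>x. \<phi> x * \<psi> x) has_field_derivative (deriv \<phi> x * \<psi> x + \<phi> x * deriv \<psi> x)) (at x)"
          by (rule DERIV_cong[OF DERIV_mult[OF test_function_has_derivative[OF \<phi>] test_function_has_derivative[OF \<psi>]]]) simp
      qed
      then have "((\<lambda>x. \<phi> x * \<psi> x) has_vector_derivative (deriv \<phi> x * \<psi> x + \<phi> x * deriv \<psi> x)) (at x within {-R..R})"
        by (rule has_real_derivative_iff_has_vector_derivative[THEN iffD1])
      then show ?thesis unfolding F_def by (rule bounded_linear.has_vector_derivative[OF bounded_linear_of_real])
    qed
    show "continuous_on {-R..R} F"
      unfolding F_def by (intro continuous_on_of_real continuous_on_add continuous_on_mult c)
  qed (use R(1) in simp)
  then have "(LINT x|lborel. indicator {-R..R} x *\<^sub>R F x) = 0" using R by simp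
  moreover have "indicator {-R..R} x *\<^sub>R F x = F x" for x
    using R(2,3)[of x] by (cases "x \<in> {-R..R}") (auto simp: F_def abs_le_iff)
  ultimately have "(LINT x|lborel. F x) = 0" by simp
  moreover have "(LINT x|lborel. F x) = (LINT x|lborel. of_real (deriv \<phi> x) * of_real (\<psi> x)) + (LINT x|lborel. of_real (\<phi> x) * of_real (deriv \<psi> x))"
    unfolding F_def of_real_add of_real_mult by (intro Bochner_Integration.integral_add L2_integrable_mult L)
  ultimately show "(LINT x|lborel. complex_of_real (\<phi> x) * of_real (deriv \<psi> x)) = - (LINT x|lborel. complex_of_real (deriv \<phi> x) * of_real (\<psi> x))"
    by (simp add: eq_neg_iff_add_eq_0 add.commute)
qed

lemma fourier_deriv_test_function:
  "test_function \<phi> \<Longrightarrow> AE \<xi> in lborel. fourier (\<lambda>x. of_real (deriv \<phi> x)) \<xi> = \<i> * \<xi> * fourier (\<lambda>x. of_real (\<phi> x)) \<xi>"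
  by (intro fourier_weak_deriv test_function_L2 test_function_deriv has_weak_deriv_test_function)

lemma integral_mult_test_function:
  assumes "f \<in> L2" "test_function \<phi>"
  shows "(LINT x|lborel. f x * of_real (\<phi> x)) = L2_inner (fourier f) (fourier (\<lambda>x. of_real (\<phi> x))) / (2 * pi)"
  using parseval[OF assms(1) test_function_L2[OF assms(2)]] by (simp add: L2_inner_def)

text \<open>For the direction not yet known both integrals are written by Parseval's identity. The
  factor \<open>\<i> * \<xi>\<close> in the transform of \<open>deriv \<phi>\<close> changes sign
  under conjugation, which is the minus sign of integration by parts.\<close>

lemma has_weak_deriv_iff:
  assumes "f \<in> L2" "g \<in> L2"
  shows "has_weak_deriv f g \<longleftrightarrow> (AE \<xi> in lborel. fourier g \<xi> = \<i> * \<xi> * fourier f \<xi>)"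
proof
  assume AE: "AE \<xi> in lborel. fourier g \<xi> = \<i> * \<xi> * fourier f \<xi>"
  show "has_weak_deriv f g"
    unfolding has_weak_deriv_def
  proof (intro allI impI)
    fix \<phi> assume \<phi>: "test_function \<phi>"
    define p where "p = fourier (\<lambda>x. complex_of_real (\<phi> x))"
    define p' where "p' = fourier (\<lambda>x. complex_of_real (deriv \<phi> x))"
    have pL: "p \<in> L2" "p' \<in> L2" unfolding p_def p'_def by (intro fourier_L2 test_function_L2 test_function_deriv \<phi>)+
    have [measurable]: "p \<in> borel_measurable borel" "p' \<in> borel_measurable borel"
      "fourier f \<in> borel_measurable borel" "fourier g \<in> borel_measurable borel"
      using pL[THEN L2_measurable] fourier_L2[OF assms(1), THEN L2_measurable] fourier_L2[OF assms(2), THEN L2_measurable] by simp_all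
    have "L2_inner (fourier f) p' = (LINT \<xi>|lborel. - (fourier g \<xi> * cnj (p \<xi>)))"
      unfolding L2_inner_def
    proof (rule integral_cong_AE)
      show "AE \<xi> in lborel. fourier f \<xi> * cnj (p' \<xi>) = - (fourier g \<xi> * cnj (p \<xi>))"
        using AE fourier_deriv_test_function[OF \<phi>] unfolding p'_def[symmetric] p_def[symmetric]
        by eventually_elim simp
    qed simp_all
    also have "\<dots> = - L2_inner (fourier g) p" unfolding L2_inner_def by simp
    finally have "L2_inner (fourier f) p' = - L2_inner (fourier g) p" .
    then show "(LINT x|lborel. f x * of_real (deriv \<phi> x)) = - (LINT x|lborel. g x * of_real (\<phi> x))"
      using integral_mult_test_function[OF assms(1) test_function_deriv[OF \<phi>]] integral_mult_test_function[OF assms(2) \<phi>]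
      by (simp add: p_def p'_def)
  qed
qed (rule fourier_weak_deriv[OF assms])

lemma H1_iff: "f \<in> H1 \<longleftrightarrow> f \<in> L2 \<and> (\<lambda>\<xi>. of_real \<xi> * fourier f \<xi>) \<in> L2"
proof
  assume "f \<in> H1"
  then obtain g where f: "f \<in> L2" and g: "g \<in> L2" "has_weak_deriv f g" by (auto simp: H1_def)
  have [measurable]: "fourier f \<in> borel_measurable borel" using L2_measurable[OF fourier_L2[OF f]] by simp
  have "AE \<xi> in lborel. of_real \<xi> * fourier f \<xi> = - \<i> * fourier g \<xi>"
    using fourier_weak_deriv[OF f g] by eventually_elim (simp add: mult.assoc[symmetric])
  then have "(\<lambda>\<xi>. of_real \<xi> * fourier f \<xi>) \<in> L2"
    by (intro L2_cong_AE[OF L2_cmult[OF fourier_L2[OF g(1)], of "- \<i>"]]) simp_all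
  with f show "f \<in> L2 \<and> (\<lambda>\<xi>. of_real \<xi> * fourier f \<xi>) \<in> L2" by simp
next
  assume a: "f \<in> L2 \<and> (\<lambda>\<xi>. of_real \<xi> * fourier f \<xi>) \<in> L2"
  then have gL: "(\<lambda>\<xi>. \<i> * (of_real \<xi> * fourier f \<xi>)) \<in> L2" by (intro L2_cmult) simp
  have "AE \<xi> in lborel. fourier (inv_fourier (\<lambda>\<xi>. \<i> * (of_real \<xi> * fourier f \<xi>))) \<xi> = \<i> * \<xi> * fourier f \<xi>"
    using fourier_inv_fourier[OF gL] by (simp add: mult.assoc)
  then show "f \<in> H1"
    using has_weak_deriv_iff[OF _ inv_fourier_L2[OF gL]] a inv_fourier_L2[OF gL] by (auto simp: H1_def)
qed

text \<open>\<open>weak_deriv\<close> is chosen by \<open>SOME\<close>; up to null sets its Fourier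
  transform is the same for every choice.\<close>

lemma
  assumes "f \<in> H1"
  shows weak_deriv_L2: "weak_deriv f \<in> L2"
    and fourier_of_weak_deriv: "AE \<xi> in lborel. fourier (weak_deriv f) \<xi> = \<i> * \<xi> * fourier f \<xi>"
proof -
  have ex: "\<exists>g. g \<in> L2 \<and> has_weak_deriv f g" using assms by (auto simp: H1_def)
  have w: "weak_deriv f \<in> L2 \<and> has_weak_deriv f (weak_deriv f)" unfolding weak_deriv_def by (rule someI_ex[OF ex])
  then show "weak_deriv f \<in> L2" by simp
  show "AE \<xi> in lborel. fourier (weak_deriv f) \<xi> = \<i> * \<xi> * fourier f \<xi>"
    using w assms by (intro fourier_weak_deriv) (auto simp: H1_def)
qed

section \<open>The Hardy space on the Fourier side\<close>

text \<open>If \<open>g\<close> is the Fourier transform of \<open>f\<close>, this is the pairing of \<open>b(-i\<partial>\<^sub>x) f\<close> with \<open>f\<close>.\<close>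
definition quad :: "(real \<Rightarrow> real) \<Rightarrow> (real \<Rightarrow> complex) \<Rightarrow> real" where
  "quad b g = (LINT \<xi>|lborel. b \<xi> * (cmod (g \<xi>))\<^sup>2) / (2 * pi)"

lemma lp_norm_2_fourier: "f \<in> L2 \<Longrightarrow> (lp_norm 2 f)\<^sup>2 = quad (\<lambda>\<xi>. 1) (fourier f)"
  using lp_norm_fourier[of f] by (simp add: quad_def lp_norm_2_power2[symmetric] power_mult_distrib)

lemma quad_cong_AE:
  assumes "AE \<xi> in lborel. g \<xi> = g' \<xi>" "g \<in> borel_measurable borel" "g' \<in> borel_measurable borel" "b \<in> borel_measurable borel"
  shows "quad b g = quad b g'"
proof -
  have "(LINT \<xi>|lborel. b \<xi> * (cmod (g \<xi>))\<^sup>2) = (LINT \<xi>|lborel. b \<xi> * (cmod (g' \<xi>))\<^sup>2)"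
    by (rule integral_cong_AE) (use assms in auto)
  then show ?thesis by (simp add: quad_def)
qed

lemma lp_norm_2_weak_deriv:
  assumes "f \<in> H1"
  shows "(lp_norm 2 (weak_deriv f))\<^sup>2 = quad (\<lambda>\<xi>. \<xi>\<^sup>2) (fourier f)"
proof -
  have f: "f \<in> L2" using assms by (simp add: H1_iff)
  have [measurable]: "fourier f \<in> borel_measurable borel" "fourier (weak_deriv f) \<in> borel_measurable borel"
    using fourier_L2[OF f] fourier_L2[OF weak_deriv_L2[OF assms]] L2_measurable by simp_all
  have "(lp_norm 2 (weak_deriv f))\<^sup>2 = quad (\<lambda>\<xi>. 1) (\<lambda>\<xi>. \<i> * \<xi> * fourier f \<xi>)"
    unfolding lp_norm_2_fourier[OF weak_deriv_L2[OF assms]]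
    by (rule quad_cong_AE[OF fourier_of_weak_deriv[OF assms]]) simp_all
  then show ?thesis by (simp add: quad_def norm_mult power_mult_distrib)
qed

text \<open>Fourier transforms of elements of \<open>H1_plus\<close> in a normal form: they vanish
  at every negative frequency instead of almost every one, which permits pointwise case distinctions
  on the sign.\<close>

definition hardy :: "(real \<Rightarrow> complex) set" where
  "hardy = {g \<in> L2. (\<lambda>\<xi>. of_real \<xi> * g \<xi>) \<in> L2 \<and> (\<forall>\<xi><0. g \<xi> = 0)}"

lemma hardy_L2: "g \<in> hardy \<Longrightarrow> g \<in> L2" "g \<in> hardy \<Longrightarrow> (\<lambda>\<xi>. of_real \<xi> * g \<xi>) \<in> L2"
  by (simp_all add: hardy_def)

lemma hardy_borel_measurable [measurable_dest]: "g \<in> hardy \<Longrightarrow> g \<in> borel_measurable borel"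
  using L2_measurable[OF hardy_L2(1)] by simp

text \<open>The weight is a polynomial whose modulus is \<open>sqrt (1 + \<xi>\<^sup>2)\<close>; it
  turns the norm of \<open>H1\<close> into one of \<open>L2\<close>.\<close>

lemma hardy_weighted_L2: "g \<in> hardy \<Longrightarrow> (\<lambda>\<xi>. (1 + \<i> * of_real \<xi>) * g \<xi>) \<in> L2"
  using L2_add[OF hardy_L2(1) L2_cmult[OF hardy_L2(2), of g \<i>], of g] by (simp add: algebra_simps)

lemma norm_1_plus_i: "(cmod (1 + \<i> * of_real \<xi>))\<^sup>2 = 1 + \<xi>\<^sup>2"
  by (simp add: cmod_power2)

lemma one_plus_i_nonzero: "1 + \<i> * complex_of_real \<xi> \<noteq> 0"
  by (simp add: complex_eq_iff)

lemma L2_inverse_1_plus_i: "(\<lambda>\<xi>. inverse (1 + \<i> * complex_of_real \<xi>)) \<in> L2"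
proof -
  have "(cmod (inverse (1 + \<i> * complex_of_real \<xi>)))\<^sup>2 = inverse (1 + \<xi>\<^sup>2)" for \<xi>
    unfolding norm_inverse power_inverse norm_1_plus_i ..
  then show ?thesis using integrable_inverse_1_plus_power2 by (simp add: L2_def)
qed

text \<open>Dividing and multiplying by the weight writes \<open>g\<close> as a product of two
  square integrable functions. Hence \<open>inv_ft g\<close> is an absolutely convergent
  integral.\<close>

lemma hardy_integrable:
  assumes "g \<in> hardy"
  shows "integrable lborel g"
proof -
  have "integrable lborel (\<lambda>\<xi>. inverse (1 + \<i> * of_real \<xi>) * ((1 + \<i> * of_real \<xi>) * g \<xi>))"
    by (intro L2_integrable_mult L2_inverse_1_plus_i hardy_weighted_L2 assms)
  then show ?thesis by (simp add: one_plus_i_nonzero mult.assoc[symmetric])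
qed

lemma hardy_cmult: "g \<in> hardy \<Longrightarrow> (\<lambda>\<xi>. c * g \<xi>) \<in> hardy"
  using L2_cmult[of "\<lambda>\<xi>. of_real \<xi> * g \<xi>" c] by (simp add: hardy_def L2_cmult mult.left_commute)

lemma hardy_add: "g \<in> hardy \<Longrightarrow> h \<in> hardy \<Longrightarrow> (\<lambda>\<xi>. g \<xi> + h \<xi>) \<in> hardy"
  by (simp add: hardy_def L2_add distrib_left)

lemma hardy_diff: "g \<in> hardy \<Longrightarrow> h \<in> hardy \<Longrightarrow> (\<lambda>\<xi>. g \<xi> - h \<xi>) \<in> hardy"
  using hardy_add[OF _ hardy_cmult, of g h "-1"] by simp

lemma hardy_mult_bounded:
  assumes "g \<in> hardy" "b \<in> borel_measurable borel" "\<And>\<xi>. cmod (b \<xi>) \<le> C"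
  shows "(\<lambda>\<xi>. b \<xi> * g \<xi>) \<in> hardy"
  using L2_mult_bounded[OF hardy_L2(1)[OF assms(1)] _ assms(3)] L2_mult_bounded[OF hardy_L2(2)[OF assms(1)] _ assms(3)] assms(1,2)
  by (simp add: hardy_def mult.left_commute)

lemma
  assumes "g \<in> hardy"
  shows inv_ft_hardy_L2: "inv_ft g \<in> L2"
    and fourier_inv_ft_hardy: "AE \<xi> in lborel. fourier (inv_ft g) \<xi> = g \<xi>"
    and inv_ft_H1_plus: "inv_ft g \<in> H1_plus"
proof -
  show L: "inv_ft g \<in> L2" and F: "AE \<xi> in lborel. fourier (inv_ft g) \<xi> = g \<xi>"
    using inv_ft_L2 fourier_inv_ft hardy_L2(1)[OF assms] hardy_integrable[OF assms] by blast+
  have [measurable]: "fourier (inv_ft g) \<in> borel_measurable borel" using L2_measurable[OF fourier_L2[OF L]] by simp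
  have "(\<lambda>\<xi>. of_real \<xi> * fourier (inv_ft g) \<xi>) \<in> L2"
    by (rule L2_cong_AE[OF hardy_L2(2)[OF assms]]) (use F in auto)
  moreover have "AE \<xi> in lborel. \<xi> < 0 \<longrightarrow> fourier (inv_ft g) \<xi> = 0"
    using F by eventually_elim (use assms in \<open>auto simp: hardy_def\<close>)
  ultimately show "inv_ft g \<in> H1_plus" using L by (simp add: H1_plus_def H1_iff L2_plus_iff)
qed

text \<open>Passing to the nonnegative part corrects the transform on the null set of negative
  frequencies where it may differ from 0.\<close>

lemma H1_plus_representation:
  assumes "f \<in> H1_plus"
  obtains g where "g \<in> hardy" "AE \<xi> in lborel. fourier f \<xi> = g \<xi>" "AE x in lborel. f x = inv_ft g x"
proof -
  have f: "f \<in> L2" "(\<lambda>\<xi>. of_real \<xi> * fourier f \<xi>) \<in> L2" "AE \<xi> in lborel. \<xi> < 0 \<longrightarrow> fourier f \<xi> = 0"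
    using assms by (simp_all add: H1_plus_def H1_iff L2_plus_iff)
  define g where "g = nonneg_part (fourier f)"
  have "(\<lambda>\<xi>. of_real \<xi> * g \<xi>) = nonneg_part (\<lambda>\<xi>. of_real \<xi> * fourier f \<xi>)"
    by (simp add: fun_eq_iff g_def nonneg_part_def)
  then have g: "g \<in> hardy"
    using nonneg_part_L2[OF f(2)] nonneg_part_L2[OF fourier_L2[OF f(1)]] by (simp add: hardy_def g_def nonneg_part_def)
  have AE: "AE \<xi> in lborel. fourier f \<xi> = g \<xi>"
    using f(3) by eventually_elim (auto simp: g_def nonneg_part_def indicator_def)
  have "AE \<xi> in lborel. fourier f \<xi> = fourier (inv_ft g) \<xi>"
    using AE fourier_inv_ft_hardy[OF g] by eventually_elim simp
  from fourier_inj[OF f(1) inv_ft_hardy_L2[OF g] this] g AE show thesis by (intro that)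
qed

lemma integrable_quad:
  assumes "g \<in> hardy" "b \<in> borel_measurable borel" "\<And>\<xi>. \<bar>b \<xi>\<bar> \<le> C * (1 + \<xi>\<^sup>2)"
  shows "integrable lborel (\<lambda>\<xi>. b \<xi> * (cmod (g \<xi>))\<^sup>2)"
proof (rule Bochner_Integration.integrable_bound)
  have [measurable]: "g \<in> borel_measurable borel" "b \<in> borel_measurable borel" using assms hardy_borel_measurable by simp_all
  show "integrable lborel (\<lambda>\<xi>. C * (cmod ((1 + \<i> * of_real \<xi>) * g \<xi>))\<^sup>2)"
    by (intro integrable_mult_right L2_integrable_power2 hardy_weighted_L2 assms)
  show "(\<lambda>\<xi>. b \<xi> * (cmod (g \<xi>))\<^sup>2) \<in> borel_measurable lborel" by measurable
  show "AE \<xi> in lborel. norm (b \<xi> * (cmod (g \<xi>))\<^sup>2) \<le> norm (C * (cmod ((1 + \<i> * of_real \<xi>) * g \<xi>))\<^sup>2)"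
  proof (rule AE_I2)
    fix \<xi>
    have "norm (b \<xi> * (cmod (g \<xi>))\<^sup>2) \<le> C * (1 + \<xi>\<^sup>2) * (cmod (g \<xi>))\<^sup>2"
      using assms(3)[of \<xi>] by (simp add: abs_mult mult_right_mono)
    also have "\<dots> = C * (cmod ((1 + \<i> * of_real \<xi>) * g \<xi>))\<^sup>2"
      by (simp only: norm_mult power_mult_distrib norm_1_plus_i mult.assoc)
    also have "\<dots> \<le> norm (C * (cmod ((1 + \<i> * of_real \<xi>) * g \<xi>))\<^sup>2)" by simp
    finally show "norm (b \<xi> * (cmod (g \<xi>))\<^sup>2) \<le> norm (C * (cmod ((1 + \<i> * of_real \<xi>) * g \<xi>))\<^sup>2)" .
  qed
qed

lemma quad_mono:
  assumes "g \<in> hardy" "a \<in> borel_measurable borel" "b \<in> borel_measurable borel"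
    "\<And>\<xi>. \<bar>a \<xi>\<bar> \<le> C * (1 + \<xi>\<^sup>2)" "\<And>\<xi>. \<bar>b \<xi>\<bar> \<le> C' * (1 + \<xi>\<^sup>2)" "\<And>\<xi>. 0 \<le> \<xi> \<Longrightarrow> a \<xi> \<le> b \<xi>"
  shows "quad a g \<le> quad b g"
proof -
  have "(LINT \<xi>|lborel. a \<xi> * (cmod (g \<xi>))\<^sup>2) \<le> (LINT \<xi>|lborel. b \<xi> * (cmod (g \<xi>))\<^sup>2)"
  proof (rule integral_mono)
    show "a \<xi> * (cmod (g \<xi>))\<^sup>2 \<le> b \<xi> * (cmod (g \<xi>))\<^sup>2" for \<xi>
      using assms(1,6) by (cases "\<xi> < 0") (auto simp: hardy_def intro: mult_right_mono)
  qed (rule integrable_quad[OF assms(1,2,4)], rule integrable_quad[OF assms(1,3,5)])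
  then show ?thesis by (simp add: quad_def divide_right_mono)
qed

lemma quad_linear:
  assumes "g \<in> hardy" "a \<in> borel_measurable borel" "b \<in> borel_measurable borel"
    "\<And>\<xi>. \<bar>a \<xi>\<bar> \<le> C * (1 + \<xi>\<^sup>2)" "\<And>\<xi>. \<bar>b \<xi>\<bar> \<le> C' * (1 + \<xi>\<^sup>2)"
  shows "quad (\<lambda>\<xi>. s * a \<xi> + t * b \<xi>) g = s * quad a g + t * quad b g"
proof -
  have "(LINT \<xi>|lborel. (s * a \<xi> + t * b \<xi>) * (cmod (g \<xi>))\<^sup>2) = (LINT \<xi>|lborel. s * (a \<xi> * (cmod (g \<xi>))\<^sup>2) + t * (b \<xi> * (cmod (g \<xi>))\<^sup>2))"
    by (intro Bochner_Integration.integral_cong refl) (simp add: algebra_simps)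
  also have "\<dots> = s * (LINT \<xi>|lborel. a \<xi> * (cmod (g \<xi>))\<^sup>2) + t * (LINT \<xi>|lborel. b \<xi> * (cmod (g \<xi>))\<^sup>2)"
    using integrable_quad[OF assms(1,2,4)] integrable_quad[OF assms(1,3,5)] by simp
  finally show ?thesis by (simp add: quad_def add_divide_distrib)
qed

lemma quad_nonneg: "(\<And>\<xi>. 0 \<le> b \<xi>) \<Longrightarrow> 0 \<le> quad b g"
  unfolding quad_def by (intro divide_nonneg_pos Bochner_Integration.integral_nonneg) auto

lemma quad_cmult: "quad b (\<lambda>\<xi>. c * g \<xi>) = (cmod c)\<^sup>2 * quad b g"
proof -
  have "b \<xi> * (cmod (c * g \<xi>))\<^sup>2 = (cmod c)\<^sup>2 * (b \<xi> * (cmod (g \<xi>))\<^sup>2)" for \<xi>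
    by (simp add: norm_mult power_mult_distrib)
  then show ?thesis unfolding quad_def by (simp only: integral_mult_right_zero times_divide_eq_right)
qed

text \<open>The polarisation of \<open>quad\<close>, regarded as a real quadratic form.\<close>

definition quad_inner :: "(real \<Rightarrow> real) \<Rightarrow> (real \<Rightarrow> complex) \<Rightarrow> (real \<Rightarrow> complex) \<Rightarrow> real" where
  "quad_inner b g h = Re (LINT \<xi>|lborel. of_real (b \<xi>) * g \<xi> * cnj (h \<xi>)) / (2 * pi)"

lemma integrable_quad_inner:
  assumes "g \<in> hardy" "h \<in> hardy" "b \<in> borel_measurable borel" "\<And>\<xi>. \<bar>b \<xi>\<bar> \<le> C * (1 + \<xi>\<^sup>2)"
  shows "integrable lborel (\<lambda>\<xi>. of_real (b \<xi>) * g \<xi> * cnj (h \<xi>))"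
proof (rule Bochner_Integration.integrable_bound)
  have [measurable]: "g \<in> borel_measurable borel" "h \<in> borel_measurable borel" "b \<in> borel_measurable borel"
    using assms hardy_borel_measurable by simp_all
  show "integrable lborel (\<lambda>\<xi>. C * cmod (((1 + \<i> * of_real \<xi>) * g \<xi>) * ((1 + \<i> * of_real \<xi>) * h \<xi>)))"
    by (intro integrable_mult_right integrable_norm L2_integrable_mult hardy_weighted_L2 assms)
  show "(\<lambda>\<xi>. of_real (b \<xi>) * g \<xi> * cnj (h \<xi>)) \<in> borel_measurable lborel" by measurable
  show "AE \<xi> in lborel. norm (of_real (b \<xi>) * g \<xi> * cnj (h \<xi>)) \<le> norm (C * cmod (((1 + \<i> * of_real \<xi>) * g \<xi>) * ((1 + \<i> * of_real \<xi>) * h \<xi>)))"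
  proof (rule AE_I2)
    fix \<xi>
    have "norm (of_real (b \<xi>) * g \<xi> * cnj (h \<xi>)) = \<bar>b \<xi>\<bar> * (cmod (g \<xi>) * cmod (h \<xi>))" by (simp add: norm_mult)
    also have "\<dots> \<le> C * (1 + \<xi>\<^sup>2) * (cmod (g \<xi>) * cmod (h \<xi>))" using assms(4)[of \<xi>] by (rule mult_right_mono) simp
    also have "\<dots> = C * cmod (((1 + \<i> * of_real \<xi>) * g \<xi>) * ((1 + \<i> * of_real \<xi>) * h \<xi>))"
    proof -
      have "cmod (1 + \<i> * of_real \<xi>) * cmod (1 + \<i> * of_real \<xi>) = 1 + \<xi>\<^sup>2"
        unfolding norm_1_plus_i[symmetric] by (rule power2_eq_square[symmetric])
      then have "C * (1 + \<xi>\<^sup>2) * (cmod (g \<xi>) * cmod (h \<xi>))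
          = C * (cmod (1 + \<i> * of_real \<xi>) * cmod (1 + \<i> * of_real \<xi>)) * (cmod (g \<xi>) * cmod (h \<xi>))" by simp
      then show ?thesis by (simp only: norm_mult mult_ac)
    qed
    also have "\<dots> \<le> norm (C * cmod (((1 + \<i> * of_real \<xi>) * g \<xi>) * ((1 + \<i> * of_real \<xi>) * h \<xi>)))" by simp
    finally show "norm (of_real (b \<xi>) * g \<xi> * cnj (h \<xi>)) \<le> norm (C * cmod (((1 + \<i> * of_real \<xi>) * g \<xi>) * ((1 + \<i> * of_real \<xi>) * h \<xi>)))" .
  qed
qed

lemma quad_add:
  assumes "g \<in> hardy" "h \<in> hardy" "b \<in> borel_measurable borel" "\<And>\<xi>. \<bar>b \<xi>\<bar> \<le> C * (1 + \<xi>\<^sup>2)"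
  shows "quad b (\<lambda>\<xi>. g \<xi> + of_real t * h \<xi>) = quad b g + 2 * t * quad_inner b g h + t\<^sup>2 * quad b h"
proof -
  have pt: "b \<xi> * (cmod (g \<xi> + of_real t * h \<xi>))\<^sup>2
      = b \<xi> * (cmod (g \<xi>))\<^sup>2 + 2 * t * Re (of_real (b \<xi>) * g \<xi> * cnj (h \<xi>)) + t\<^sup>2 * (b \<xi> * (cmod (h \<xi>))\<^sup>2)" for \<xi>
    unfolding cmod_power2 by (simp add: power2_eq_square algebra_simps)
  have i: "integrable lborel (\<lambda>\<xi>. Re (of_real (b \<xi>) * g \<xi> * cnj (h \<xi>)))"
    by (rule integrable_Re[OF integrable_quad_inner[OF assms]])
  have "(LINT \<xi>|lborel. b \<xi> * (cmod (g \<xi> + of_real t * h \<xi>))\<^sup>2)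
      = (LINT \<xi>|lborel. b \<xi> * (cmod (g \<xi>))\<^sup>2) + 2 * t * (LINT \<xi>|lborel. Re (of_real (b \<xi>) * g \<xi> * cnj (h \<xi>))) + t\<^sup>2 * (LINT \<xi>|lborel. b \<xi> * (cmod (h \<xi>))\<^sup>2)"
    unfolding pt using integrable_quad[OF assms(1,3,4)] integrable_quad[OF assms(2,3,4)] i by simp
  moreover have "(LINT \<xi>|lborel. Re (of_real (b \<xi>) * g \<xi> * cnj (h \<xi>))) = Re (LINT \<xi>|lborel. of_real (b \<xi>) * g \<xi> * cnj (h \<xi>))"
    by (rule integral_Re[OF integrable_quad_inner[OF assms]])
  ultimately show ?thesis by (simp add: quad_def quad_inner_def field_simps)
qed

text \<open>The constant \<open>c\<close>, of modulus at most 1, rotates the pairing onto the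
  nonnegative reals, where the real Cauchy-Schwarz inequality of \<open>l2\<close> applies.\<close>

lemma L2_Cauchy_Schwarz:
  assumes "f \<in> L2" "g \<in> L2"
  shows "cmod (L2_inner f g) \<le> lp_norm 2 f * lp_norm 2 g"
proof -
  define z where "z = L2_inner f g"
  define c where "c = cnj (sgn z)"
  have "z * cnj z = of_real (cmod z) * of_real (cmod z)"
    using complex_norm_square[of z] by (simp add: power2_eq_square)
  then have "c * z = of_real (cmod z)"
    by (cases "z = 0") (simp_all add: c_def sgn_eq field_simps)
  then have "cmod z = Re (L2_inner (\<lambda>x. c * f x) g)" by (simp add: L2_inner_cmult z_def)
  also have "\<dots> = inner (abs_l2 (\<lambda>x. c * f x)) (abs_l2 g)" by (simp add: inner_abs_l2 L2_cmult assms)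
  also have "\<dots> \<le> norm (abs_l2 (\<lambda>x. c * f x)) * norm (abs_l2 g)" by (rule norm_cauchy_schwarz)
  also have "\<dots> = lp_norm 2 (\<lambda>x. c * f x) * lp_norm 2 g" by (simp add: norm_abs_l2 L2_cmult assms)
  also have "\<dots> \<le> 1 * lp_norm 2 f * lp_norm 2 g"
  proof (rule mult_right_mono)
    have "cmod c \<le> 1" by (simp add: c_def norm_sgn)
    then have "cmod (c * f x) \<le> 1 * cmod (f x)" for x by (simp add: norm_mult mult_left_le_one_le)
    then show "lp_norm 2 (\<lambda>x. c * f x) \<le> 1 * lp_norm 2 f"
      using L2_measurable[OF assms(1)] by (intro lp_norm_2_mono[OF assms(1)]) simp_all
  qed simp
  finally show ?thesis by (simp add: z_def)
qed

section \<open>Quadratic energies, the sixth power and the Sobolev embedding\<close>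

abbreviation mass :: "(real \<Rightarrow> complex) \<Rightarrow> real" where "mass \<equiv> quad (\<lambda>\<xi>. 1)"
abbreviation kin :: "(real \<Rightarrow> complex) \<Rightarrow> real" where "kin \<equiv> quad (\<lambda>\<xi>. \<xi>\<^sup>2)"
abbreviation mom :: "(real \<Rightarrow> complex) \<Rightarrow> real" where "mom \<equiv> quad (\<lambda>\<xi>. \<xi>)"
abbreviation ener :: "(real \<Rightarrow> complex) \<Rightarrow> real" where "ener \<equiv> quad (\<lambda>\<xi>. 1 + \<xi>\<^sup>2)"
abbreviation qsym :: "real \<Rightarrow> real" where "qsym \<equiv> (\<lambda>\<xi>. \<xi>\<^sup>2 - \<xi> + 1 / 2)"

definition six :: "(real \<Rightarrow> complex) \<Rightarrow> real" where
  "six g = (LINT x|lborel. cmod (inv_ft g x) ^ 6)"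

text \<open>The constant in the embedding of \<open>H1\<close> into bounded functions, as it arises
  from Cauchy-Schwarz with the weight \<open>1 + \<i> * \<xi>\<close> and its inverse.\<close>

definition Sob :: real where
  "Sob = (lp_norm 2 (\<lambda>\<xi>. inverse (1 + \<i> * complex_of_real \<xi>)))\<^sup>2 / (2 * pi)"

lemma abs_le_1_plus_power2: "\<bar>x::real\<bar> \<le> 1 + x\<^sup>2"
proof -
  have "0 \<le> (1 - \<bar>x\<bar>)\<^sup>2" by simp
  then show ?thesis using abs_ge_zero[of x] unfolding power2_diff power2_abs by simp
qed

lemma symbol_bounds:
  "\<bar>1::real\<bar> \<le> 1 * (1 + \<xi>\<^sup>2)" "\<bar>\<xi>\<^sup>2\<bar> \<le> 1 * (1 + \<xi>\<^sup>2)" "\<bar>\<xi>\<bar> \<le> 1 * (1 + \<xi>\<^sup>2)" "\<bar>1 + \<xi>\<^sup>2\<bar> \<le> 1 * (1 + \<xi>\<^sup>2)"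
  "\<bar>qsym \<xi>\<bar> \<le> 2 * (1 + \<xi>\<^sup>2)" for \<xi> :: real
proof -
  note a = abs_le_1_plus_power2[of \<xi>] zero_le_power2[of \<xi>]
  show "\<bar>1::real\<bar> \<le> 1 * (1 + \<xi>\<^sup>2)" "\<bar>\<xi>\<^sup>2\<bar> \<le> 1 * (1 + \<xi>\<^sup>2)" "\<bar>\<xi>\<bar> \<le> 1 * (1 + \<xi>\<^sup>2)" "\<bar>1 + \<xi>\<^sup>2\<bar> \<le> 1 * (1 + \<xi>\<^sup>2)"
    using a by simp_all
  have "2 * (1 + \<xi>\<^sup>2) - qsym \<xi> = (\<xi> + 1 / 2)\<^sup>2 + 5 / 4" "2 * (1 + \<xi>\<^sup>2) - (- qsym \<xi>) = 3 * (\<xi> - 1 / 6)\<^sup>2 + 29 / 12"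
    by (simp_all add: power2_eq_square field_simps)
  then have "0 \<le> 2 * (1 + \<xi>\<^sup>2) - qsym \<xi>" "0 \<le> 2 * (1 + \<xi>\<^sup>2) - (- qsym \<xi>)" by (simp_all only:) simp_all
  then show "\<bar>qsym \<xi>\<bar> \<le> 2 * (1 + \<xi>\<^sup>2)" unfolding diff_ge_0_iff_ge by (rule abs_leI)
qed

text \<open>Completing the square leaves 7/8 times a square plus 5/56. This is coercivity:
  \<open>quad qsym\<close> controls the norm of \<open>H1\<close> in spite of the negative
  term.\<close>

lemma qsym_lower: "1 / 8 * (1 + \<xi>\<^sup>2) \<le> qsym \<xi>"
proof -
  have "qsym \<xi> - 1 / 8 * (1 + \<xi>\<^sup>2) = 7 / 8 * (\<xi> - 4 / 7)\<^sup>2 + 5 / 56" by (simp add: power2_eq_square field_simps)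
  then have "0 \<le> qsym \<xi> - 1 / 8 * (1 + \<xi>\<^sup>2)" by (simp only:) simp
  then show ?thesis unfolding diff_ge_0_iff_ge .
qed

lemma quad_const_mult: "quad (\<lambda>\<xi>. c * b \<xi>) g = c * quad b g"
  by (simp add: quad_def mult.assoc)

lemma ener_le_qsym: "g \<in> hardy \<Longrightarrow> ener g \<le> 8 * quad qsym g"
proof -
  assume g: "g \<in> hardy"
  have "quad (\<lambda>\<xi>. 1 / 8 * (1 + \<xi>\<^sup>2)) g \<le> quad qsym g"
  proof (rule quad_mono[OF g _ _ _ symbol_bounds(5) qsym_lower])
    show "\<bar>1 / 8 * (1 + \<xi>\<^sup>2)\<bar> \<le> 1 / 8 * (1 + \<xi>\<^sup>2)" for \<xi> :: real by simp
  qed simp_all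
  then show ?thesis unfolding quad_const_mult by simp
qed

lemma mass_le_ener: "g \<in> hardy \<Longrightarrow> mass g \<le> ener g"
  by (rule quad_mono[OF _ _ _ symbol_bounds(1) symbol_bounds(4)]) simp_all

lemma mass_nonneg: "0 \<le> mass g" and ener_nonneg: "0 \<le> ener g" and kin_nonneg: "0 \<le> kin g"
  by (rule quad_nonneg; simp)+

lemma qsym_nonneg: "g \<in> hardy \<Longrightarrow> 0 \<le> quad qsym g"
  using ener_le_qsym[of g] ener_nonneg[of g] by linarith

lemma ener_eq_norm: "g \<in> hardy \<Longrightarrow> (lp_norm 2 (\<lambda>\<xi>. (1 + \<i> * of_real \<xi>) * g \<xi>))\<^sup>2 = 2 * pi * ener g"
  by (simp add: lp_norm_2_power2 quad_def norm_mult power_mult_distrib norm_1_plus_i)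

lemma inv_ft_bound:
  assumes "g \<in> hardy"
  shows "(cmod (inv_ft g x))\<^sup>2 \<le> Sob * ener g"
proof -
  define a where "a = (\<lambda>\<xi>. cnj (cis (x * \<xi>) * inverse (1 + \<i> * complex_of_real \<xi>)))"
  have a: "a \<in> L2" unfolding a_def
    by (intro L2_cnj L2_mult_bounded[OF L2_inverse_1_plus_i, of _ 1]) simp_all
  have "inv_ft g x = L2_inner (\<lambda>\<xi>. (1 + \<i> * of_real \<xi>) * g \<xi>) a / (2 * pi)"
    unfolding inv_ft_def L2_inner_def a_def
    by (intro arg_cong2[where f = "(/)"] Bochner_Integration.integral_cong refl) (simp add: one_plus_i_nonzero field_simps)
  then have "cmod (inv_ft g x) = cmod (L2_inner (\<lambda>\<xi>. (1 + \<i> * of_real \<xi>) * g \<xi>) a) / (2 * pi)"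
    by (simp add: norm_divide norm_mult)
  also have "\<dots> \<le> lp_norm 2 (\<lambda>\<xi>. (1 + \<i> * of_real \<xi>) * g \<xi>) * lp_norm 2 a / (2 * pi)"
    by (intro divide_right_mono L2_Cauchy_Schwarz hardy_weighted_L2 assms a) simp
  also have "lp_norm 2 a = lp_norm 2 (\<lambda>\<xi>. inverse (1 + \<i> * complex_of_real \<xi>))"
    unfolding a_def lp_norm_2_cnj by (simp add: lp_norm_2 norm_mult)
  finally have "(cmod (inv_ft g x))\<^sup>2 \<le> (lp_norm 2 (\<lambda>\<xi>. (1 + \<i> * of_real \<xi>) * g \<xi>) * lp_norm 2 (\<lambda>\<xi>. inverse (1 + \<i> * complex_of_real \<xi>)) / (2 * pi))\<^sup>2"
    by (intro power_mono norm_ge_zero)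
  also have "\<dots> = (2 * pi * ener g) * (lp_norm 2 (\<lambda>\<xi>. inverse (1 + \<i> * complex_of_real \<xi>)))\<^sup>2 / (2 * pi)\<^sup>2"
    by (simp only: power_divide power_mult_distrib ener_eq_norm[OF assms])
  also have "\<dots> = Sob * ener g" by (simp add: Sob_def power2_eq_square)
  finally show ?thesis .
qed

lemma Sob_nonneg: "0 \<le> Sob"
  by (simp add: Sob_def)

lemma lp_norm_2_inv_ft:
  assumes "g \<in> hardy"
  shows "(lp_norm 2 (inv_ft g))\<^sup>2 = mass g"
proof -
  have [measurable]: "g \<in> borel_measurable borel" "fourier (inv_ft g) \<in> borel_measurable borel"
    using assms hardy_borel_measurable L2_measurable[OF fourier_L2[OF inv_ft_hardy_L2[OF assms]]] by simp_all
  show ?thesis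
    unfolding lp_norm_2_fourier[OF inv_ft_hardy_L2[OF assms]]
    by (rule quad_cong_AE[OF fourier_inv_ft_hardy[OF assms]]) simp_all
qed

lemma inv_ft_measurable_hardy: "g \<in> hardy \<Longrightarrow> inv_ft g \<in> borel_measurable borel"
  by (rule inv_ft_borel_measurable[OF hardy_borel_measurable])

lemma integrable_power_L2:
  assumes "f \<in> L2" "\<And>x. cmod (f x) \<le> C"
  shows "integrable lborel (\<lambda>x. cmod (f x) ^ (n + 2))"
proof (rule Bochner_Integration.integrable_bound)
  have [measurable]: "f \<in> borel_measurable borel" using L2_measurable[OF assms(1)] by simp
  show "integrable lborel (\<lambda>x. C ^ n * (cmod (f x))\<^sup>2)" by (intro integrable_mult_right L2_integrable_power2 assms)
  show "(\<lambda>x. cmod (f x) ^ (n + 2)) \<in> borel_measurable lborel" by measurable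
  show "AE x in lborel. norm (cmod (f x) ^ (n + 2)) \<le> norm (C ^ n * (cmod (f x))\<^sup>2)"
  proof (rule AE_I2)
    fix x
    have C: "0 \<le> C" using assms(2)[of x] norm_ge_zero order_trans by blast
    have "norm (cmod (f x) ^ (n + 2)) = cmod (f x) ^ n * (cmod (f x))\<^sup>2" by (simp add: power_add power2_eq_square)
    also have "\<dots> \<le> C ^ n * (cmod (f x))\<^sup>2" by (intro mult_right_mono power_mono assms) auto
    finally show "norm (cmod (f x) ^ (n + 2)) \<le> norm (C ^ n * (cmod (f x))\<^sup>2)" using C by simp
  qed
qed

lemma inv_ft_bound':
  assumes "g \<in> hardy"
  shows "cmod (inv_ft g x) \<le> sqrt (Sob * ener g)"
  using inv_ft_bound[OF assms] by (rule real_le_rsqrt)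

lemma integrable_six: "g \<in> hardy \<Longrightarrow> integrable lborel (\<lambda>x. cmod (inv_ft g x) ^ 6)"
  using integrable_power_L2[OF inv_ft_hardy_L2 inv_ft_bound', where n = 4] by simp

lemma six_nonneg: "0 \<le> six g"
  unfolding six_def by (intro Bochner_Integration.integral_nonneg) simp

text \<open>Interpolation between the supremum and the mass. It rules out that the profiles of a
  minimising sequence become uniformly small, and shows that a remainder of vanishing mass
  contributes nothing to \<open>six\<close>.\<close>

lemma six_le:
  assumes "g \<in> hardy" "\<And>x. cmod (inv_ft g x) ^ 4 \<le> c"
  shows "six g \<le> c * mass g"
proof -
  have "six g \<le> (LINT x|lborel. c * (cmod (inv_ft g x))\<^sup>2)"
    unfolding six_def
  proof (rule integral_mono[OF integrable_six[OF assms(1)]])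
    show "integrable lborel (\<lambda>x. c * (cmod (inv_ft g x))\<^sup>2)"
      by (intro integrable_mult_right L2_integrable_power2 inv_ft_hardy_L2 assms)
    show "cmod (inv_ft g x) ^ 6 \<le> c * (cmod (inv_ft g x))\<^sup>2" for x
      using mult_right_mono[OF assms(2)[of x], of "(cmod (inv_ft g x))\<^sup>2"] by (simp flip: power_add)
  qed
  then show ?thesis using lp_norm_2_inv_ft[OF assms(1)] by (simp add: lp_norm_2_power2)
qed

lemma inv_ft_cmult: "inv_ft (\<lambda>\<xi>. c * g \<xi>) x = c * inv_ft g x"
  unfolding inv_ft_def by (simp add: mult.left_commute)

lemma inv_ft_add: "g \<in> hardy \<Longrightarrow> h \<in> hardy \<Longrightarrow> inv_ft (\<lambda>\<xi>. g \<xi> + h \<xi>) x = inv_ft g x + inv_ft h x"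
  unfolding inv_ft_def distrib_left using integrable_cis_mult[OF hardy_integrable, of _ "\<lambda>\<xi>. x * \<xi>"]
  by (simp add: add_divide_distrib)

lemma inv_ft_translate: "inv_ft (\<lambda>\<xi>. cis (a * \<xi>) * g \<xi>) x = inv_ft g (x + a)"
  unfolding inv_ft_def by (simp add: mult.assoc[symmetric] cis_mult distrib_right)

lemma six_cmult: "six (\<lambda>\<xi>. c * g \<xi>) = cmod c ^ 6 * six g"
  by (simp add: six_def inv_ft_cmult norm_mult power_mult_distrib)

lemma six_translate: "six (\<lambda>\<xi>. cis (a * \<xi>) * g \<xi>) = six g"
  unfolding six_def inv_ft_translate
  using lborel_integral_real_affine[of 1 "\<lambda>x. cmod (inv_ft g x) ^ 6" a] by (simp add: add.commute)

lemma quad_translate: "quad b (\<lambda>\<xi>. cis (a * \<xi>) * g \<xi>) = quad b g"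
  by (simp add: quad_def norm_mult)

lemma hardy_translate: "g \<in> hardy \<Longrightarrow> (\<lambda>\<xi>. cis (a * \<xi>) * g \<xi>) \<in> hardy"
  by (rule hardy_mult_bounded[of _ _ 1]) simp_all

section \<open>Weak compactness and asymptotic splitting of the sixth power\<close>

text \<open>The pairing with weight \<open>1 + i\<xi>\<close> is the one of \<open>H\<^sup>1\<close>.\<close>
lemma hardy_weakly_compact:
  assumes g: "\<And>n::nat. g n \<in> hardy" and bound: "\<And>n. ener (g n) \<le> E"
  obtains k h where "strict_mono (k :: nat \<Rightarrow> nat)" "h \<in> hardy"
    "\<And>a. a \<in> L2 \<Longrightarrow> (\<lambda>n. LINT \<xi>|lborel. (1 + \<i> * of_real \<xi>) * (g (k n) \<xi> - h \<xi>) * a \<xi>) \<longlonglongrightarrow> 0"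
proof -
  define u where "u n \<xi> = (1 + \<i> * of_real \<xi>) * g n \<xi>" for n \<xi>
  have u: "u n \<in> L2" for n unfolding u_def[abs_def] by (rule hardy_weighted_L2[OF g])
  have "norm (abs_l2 (u n)) \<le> sqrt (2 * pi * E)" for n
  proof -
    have "(norm (abs_l2 (u n)))\<^sup>2 = 2 * pi * ener (g n)"
      using ener_eq_norm[OF g[of n]] by (simp add: norm_abs_l2 u) (simp add: u_def[abs_def])
    also have "\<dots> \<le> 2 * pi * E" using bound[of n] by (intro mult_left_mono) auto
    finally show ?thesis by (rule real_le_rsqrt)
  qed
  then have "bounded (range (\<lambda>n. abs_l2 (u n)))" unfolding bounded_iff by blast
  then have "\<exists>k v. strict_mono (k :: nat \<Rightarrow> nat) \<and> (\<forall>w. (\<lambda>m. inner w (abs_l2 (u (k m)))) \<longlonglongrightarrow> inner w v)"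
    by (rule bounded_weakly_convergent_subsequence) blast
  then obtain k v where k: "strict_mono (k :: nat \<Rightarrow> nat)" and v: "\<And>w. (\<lambda>m. inner w (abs_l2 (u (k m)))) \<longlonglongrightarrow> inner w v"
    by blast
  define w where "w = rep_l2 v"
  have w: "w \<in> L2" and vw: "v = abs_l2 w" by (simp_all add: w_def)
  have lim: "(\<lambda>m. L2_inner (u (k m)) c) \<longlonglongrightarrow> L2_inner w c" if c: "c \<in> L2" for c
  proof -
    have Re: "(\<lambda>m. Re (L2_inner (u (k m)) d)) \<longlonglongrightarrow> Re (L2_inner w d)" if d: "d \<in> L2" for d
      using v[of "abs_l2 d"] unfolding vw inner_commute[of "abs_l2 d"] by (simp add: inner_abs_l2 d u w)
    have "(\<lambda>m. Im (L2_inner (u (k m)) c)) \<longlonglongrightarrow> Im (L2_inner w c)"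
      using Re[OF L2_cmult[OF c, of \<i>]] by (simp add: L2_inner_cmult_right)
    with Re[OF c] show ?thesis by (simp add: tendsto_complex_iff)
  qed
  \<comment> \<open>The weak limit is divided by the weight. Its nonnegative part is taken so that
    \<open>h\<close> vanishes at every negative frequency; the sequence does so too, so test
    functions may be cut to nonnegative frequencies as well.\<close>
  define h where "h \<xi> = inverse (1 + \<i> * of_real \<xi>) * nonneg_part w \<xi>" for \<xi>
  have h1: "(1 + \<i> * of_real \<xi>) * h \<xi> = nonneg_part w \<xi>" for \<xi>
    by (simp add: h_def mult.assoc[symmetric] one_plus_i_nonzero)
  have c1: "1 \<le> cmod (1 + \<i> * complex_of_real \<xi>)" for \<xi>
    by (rule power2_le_imp_le) (simp_all add: norm_1_plus_i)
  have c2: "\<bar>\<xi>\<bar> \<le> cmod (1 + \<i> * complex_of_real \<xi>)" for \<xi>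
    by (rule power2_le_imp_le) (simp_all add: norm_1_plus_i)
  have nw: "nonneg_part w \<in> L2" by (rule nonneg_part_L2[OF w])
  have "h \<in> L2"
    unfolding h_def[abs_def]
    by (rule L2_mult_bounded[OF nw, of _ 1]) (use c1 in \<open>auto simp: norm_inverse intro!: inverse_le_1_iff[THEN iffD2]\<close>)
  moreover have "(\<lambda>\<xi>. (of_real \<xi> * inverse (1 + \<i> * of_real \<xi>)) * nonneg_part w \<xi>) \<in> L2"
  proof (rule L2_mult_bounded[OF nw])
    fix \<xi> :: real
    have "\<bar>\<xi>\<bar> / cmod (1 + \<i> * complex_of_real \<xi>) \<le> 1"
      using c1[of \<xi>] c2[of \<xi>] by (simp add: divide_le_eq_1)
    then show "cmod (of_real \<xi> * inverse (1 + \<i> * of_real \<xi>)) \<le> 1"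
      by (simp add: norm_mult norm_inverse divide_inverse)
  qed simp
  ultimately have h: "h \<in> hardy"
    by (simp add: hardy_def h_def mult.assoc) (simp add: nonneg_part_def)
  have "(\<lambda>n. LINT \<xi>|lborel. (1 + \<i> * of_real \<xi>) * (g (k n) \<xi> - h \<xi>) * a \<xi>) \<longlonglongrightarrow> 0" if a: "a \<in> L2" for a
  proof -
    define c where "c = (\<lambda>\<xi>. cnj (nonneg_part a \<xi>))"
    have c: "c \<in> L2" unfolding c_def by (intro L2_cnj nonneg_part_L2 a)
    have "(LINT \<xi>|lborel. (1 + \<i> * of_real \<xi>) * (g (k n) \<xi> - h \<xi>) * a \<xi>) = L2_inner (u (k n)) c - L2_inner w c" for n
    proof -
      have "(1 + \<i> * of_real \<xi>) * (g (k n) \<xi> - h \<xi>) * a \<xi> = u (k n) \<xi> * cnj (c \<xi>) - w \<xi> * cnj (c \<xi>)" for \<xi>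
      proof (cases "\<xi> < 0")
        case True
        then have "g (k n) \<xi> = 0" "h \<xi> = 0" using g h by (auto simp: hardy_def)
        then show ?thesis using True by (simp add: u_def c_def nonneg_part_def)
      next
        case False
        then show ?thesis
          unfolding right_diff_distrib h1 by (simp add: u_def c_def nonneg_part_def left_diff_distrib)
      qed
      then show ?thesis
        unfolding L2_inner_def by (simp add: L2_integrable_mult_cnj u w c)
    qed
    moreover have "(\<lambda>n. L2_inner (u (k n)) c - L2_inner w c) \<longlonglongrightarrow> L2_inner w c - L2_inner w c"
      by (intro tendsto_diff lim[OF c] tendsto_const)
    ultimately show ?thesis by simp
  qed
  with k h show thesis by (rule that)
qed

text \<open>Up to a factor, evaluating \<open>inv_ft\<close> at \<open>x\<close> is the weighted
  pairing with \<open>cis (x * \<xi>) / (1 + \<i> * \<xi>)\<close>, which is square integrable. On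
  the line, weak convergence in \<open>H1\<close> thus gives convergence at every point.\<close>

lemma weak_limit_pointwise:
  assumes r: "\<And>n::nat. r n \<in> hardy"
    and w: "\<And>a. a \<in> L2 \<Longrightarrow> (\<lambda>n. LINT \<xi>|lborel. (1 + \<i> * of_real \<xi>) * r n \<xi> * a \<xi>) \<longlonglongrightarrow> 0"
  shows "(\<lambda>n. inv_ft (r n) x) \<longlonglongrightarrow> 0"
proof -
  define a where "a = (\<lambda>\<xi>. cis (x * \<xi>) * inverse (1 + \<i> * complex_of_real \<xi>))"
  have a: "a \<in> L2" unfolding a_def by (rule L2_mult_bounded[OF L2_inverse_1_plus_i, of _ 1]) simp_all
  have eq: "(LINT \<xi>|lborel. (1 + \<i> * of_real \<xi>) * r n \<xi> * a \<xi>) = (LINT \<xi>|lborel. cis (x * \<xi>) * r n \<xi>)" for n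
    by (intro Bochner_Integration.integral_cong refl) (simp add: a_def one_plus_i_nonzero field_simps)
  have "(\<lambda>n. (LINT \<xi>|lborel. cis (x * \<xi>) * r n \<xi>) / (2 * pi)) \<longlonglongrightarrow> 0 / complex_of_real (2 * pi)"
    using w[OF a] unfolding eq by (intro tendsto_divide tendsto_const) simp_all
  then show ?thesis by (simp add: inv_ft_def)
qed

text \<open>A symbol of quadratic growth costs two powers of the weight; one is carried by
  \<open>r n\<close>, the other by \<open>h\<close>.\<close>

lemma weak_limit_quad_inner:
  assumes r: "\<And>n::nat. r n \<in> hardy" and h: "h \<in> hardy"
    and w: "\<And>a. a \<in> L2 \<Longrightarrow> (\<lambda>n. LINT \<xi>|lborel. (1 + \<i> * of_real \<xi>) * r n \<xi> * a \<xi>) \<longlonglongrightarrow> 0"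
    and b: "b \<in> borel_measurable borel" "\<And>\<xi>. \<bar>b \<xi>\<bar> \<le> C * (1 + \<xi>\<^sup>2)"
  shows "(\<lambda>n. quad_inner b h (r n)) \<longlonglongrightarrow> 0"
proof -
  have [measurable]: "h \<in> borel_measurable borel" "b \<in> borel_measurable borel" using h b hardy_borel_measurable by simp_all
  define a where "a \<xi> = of_real (b \<xi>) * cnj (h \<xi>) * inverse (1 + \<i> * complex_of_real \<xi>)" for \<xi>
  have a: "a \<in> L2"
  proof (rule L2_dominated[OF hardy_weighted_L2[OF h], of _ C])
    show "a \<in> borel_measurable lborel" unfolding a_def[abs_def] by measurable
    show "AE \<xi> in lborel. cmod (a \<xi>) \<le> C * cmod ((1 + \<i> * of_real \<xi>) * h \<xi>)"
    proof (rule AE_I2)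
      fix \<xi>
      let ?m = "cmod (1 + \<i> * complex_of_real \<xi>)"
      have m: "?m > 0" using one_plus_i_nonzero by simp
      have "\<bar>b \<xi>\<bar> \<le> C * (?m * ?m)" using b(2)[of \<xi>] norm_1_plus_i[of \<xi>] by (simp add: power2_eq_square)
      then have "\<bar>b \<xi>\<bar> / ?m \<le> C * ?m" using m by (simp add: pos_divide_le_eq mult.assoc)
      then have "\<bar>b \<xi>\<bar> / ?m * cmod (h \<xi>) \<le> C * ?m * cmod (h \<xi>)" by (rule mult_right_mono) simp
      then show "cmod (a \<xi>) \<le> C * cmod ((1 + \<i> * of_real \<xi>) * h \<xi>)"
        by (simp add: a_def norm_mult norm_inverse divide_inverse mult_ac)
    qed
  qed
  have eq: "quad_inner b h (r n) = Re (LINT \<xi>|lborel. (1 + \<i> * of_real \<xi>) * r n \<xi> * a \<xi>) / (2 * pi)" for n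
  proof -
    have "(LINT \<xi>|lborel. (1 + \<i> * of_real \<xi>) * r n \<xi> * a \<xi>) = (LINT \<xi>|lborel. cnj (of_real (b \<xi>) * h \<xi> * cnj (r n \<xi>)))"
      by (intro Bochner_Integration.integral_cong refl) (simp add: a_def one_plus_i_nonzero field_simps)
    also have "\<dots> = cnj (LINT \<xi>|lborel. of_real (b \<xi>) * h \<xi> * cnj (r n \<xi>))"
      by (rule Bochner_Integration.integral_cnj)
    finally show ?thesis by (simp add: quad_inner_def)
  qed
  have "(\<lambda>n. Re (LINT \<xi>|lborel. (1 + \<i> * of_real \<xi>) * r n \<xi> * a \<xi>) / (2 * pi)) \<longlonglongrightarrow> Re 0 / (2 * pi)"
    by (intro tendsto_divide tendsto_Re w a tendsto_const) simp
  then show ?thesis by (simp add: eq)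
qed

text \<open>Every term of the difference contains both \<open>z\<close> and \<open>w\<close>. In the
  symmetric quantities \<open>s\<close>, \<open>p\<close> and \<open>R\<close>, with
  \<open>\<bar>R\<bar> \<le> p\<close> and \<open>2 * p \<le> s\<close>, it is at most
  \<open>16 * p * s\<^sup>2\<close>, and \<open>s\<^sup>2\<close> is at most twice the sum of the
  fourth powers.\<close>

lemma power6_expansion_bound:
  fixes z w :: complex
  shows "\<bar>cmod (z + w) ^ 6 - cmod z ^ 6 - cmod w ^ 6\<bar> \<le> 32 * (cmod z * cmod w * (cmod z ^ 4 + cmod w ^ 4))"
proof -
  define x where "x = cmod z"
  define y where "y = cmod w"
  define R where "R = Re (z * cnj w)"
  define p where "p = x * y"
  define s where "s = x\<^sup>2 + y\<^sup>2"
  have xy: "0 \<le> x" "0 \<le> y" by (simp_all add: x_def y_def)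
  have p0: "0 \<le> p" and s0: "0 \<le> s" using xy by (simp_all add: p_def s_def)
  have Rp: "\<bar>R\<bar> \<le> p" using abs_Re_le_cmod[of "z * cnj w"] by (simp add: R_def p_def x_def y_def norm_mult)
  have "0 \<le> (x - y)\<^sup>2" by simp
  then have ps: "2 * p \<le> s" by (simp add: p_def s_def power2_diff)
  have zw: "(cmod (z + w))\<^sup>2 = s + 2 * R"
    unfolding s_def x_def y_def R_def cmod_power2 by (simp add: power2_eq_square algebra_simps)
  have "cmod (z + w) ^ 6 = ((cmod (z + w))\<^sup>2) ^ 3" by (simp flip: power_mult)
  moreover have "x ^ 6 + y ^ 6 = s ^ 3 - 3 * p\<^sup>2 * s"
    by (simp add: s_def p_def power2_eq_square power3_eq_cube numeral_eq_Suc algebra_simps)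
  ultimately have D: "cmod (z + w) ^ 6 - x ^ 6 - y ^ 6 = 6 * s\<^sup>2 * R + 12 * s * R\<^sup>2 + 8 * R ^ 3 + 3 * p\<^sup>2 * s"
    unfolding zw by (simp add: power2_eq_square power3_eq_cube algebra_simps)
  have R2: "R\<^sup>2 \<le> p\<^sup>2" using Rp p0 by (simp add: abs_le_square_iff[symmetric])
  have R3: "\<bar>R ^ 3\<bar> \<le> p ^ 3" using power_mono[OF Rp, of 3] by (simp add: power_abs)
  have "\<bar>6 * s\<^sup>2 * R + 12 * s * R\<^sup>2 + 8 * R ^ 3 + 3 * p\<^sup>2 * s\<bar>
      \<le> \<bar>6 * s\<^sup>2 * R\<bar> + \<bar>12 * s * R\<^sup>2\<bar> + \<bar>8 * R ^ 3\<bar> + \<bar>3 * p\<^sup>2 * s\<bar>" by linarith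
  also have "\<bar>6 * s\<^sup>2 * R\<bar> \<le> 6 * s\<^sup>2 * p" using Rp by (simp add: abs_mult mult_left_mono)
  also have "\<bar>12 * s * R\<^sup>2\<bar> \<le> 12 * s * p\<^sup>2" using R2 s0 by (simp add: abs_mult mult_left_mono)
  also have "\<bar>8 * R ^ 3\<bar> \<le> 8 * p ^ 3" using R3 by (simp add: abs_mult)
  also have "\<bar>3 * p\<^sup>2 * s\<bar> = 3 * p\<^sup>2 * s" using s0 by (simp add: abs_mult)
  finally have "\<bar>cmod (z + w) ^ 6 - x ^ 6 - y ^ 6\<bar> \<le> 6 * s\<^sup>2 * p + 12 * s * p\<^sup>2 + 8 * p ^ 3 + 3 * p\<^sup>2 * s"
    unfolding D by linarith
  also have "\<dots> = p * (6 * s\<^sup>2 + 15 * (s * p) + 8 * p\<^sup>2)" by (simp add: power2_eq_square power3_eq_cube algebra_simps)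
  also have "\<dots> \<le> p * (16 * s\<^sup>2)"
  proof (rule mult_left_mono[OF _ p0])
    have "s * p * 2 \<le> s * s" using mult_left_mono[OF ps s0] by (simp add: mult_ac)
    moreover have "(2 * p)\<^sup>2 \<le> s\<^sup>2" using ps p0 by (intro power_mono) auto
    moreover have "0 \<le> s * s" by simp
    ultimately show "6 * s\<^sup>2 + 15 * (s * p) + 8 * p\<^sup>2 \<le> 16 * s\<^sup>2" unfolding power2_eq_square by linarith
  qed
  also have "\<dots> \<le> p * (32 * (x ^ 4 + y ^ 4))"
  proof (rule mult_left_mono[OF _ p0])
    have "0 \<le> (x\<^sup>2 - y\<^sup>2)\<^sup>2" by simp
    then show "16 * s\<^sup>2 \<le> 32 * (x ^ 4 + y ^ 4)"
      by (simp add: s_def power2_eq_square numeral_eq_Suc algebra_simps)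
  qed
  finally show ?thesis by (simp add: p_def x_def y_def mult_ac)
qed

text \<open>With all profiles bounded by \<open>C\<close>, the error reduces to the integrals of
  |f|^2 |\<rho>| and |f| |\<rho>|^2. The first is dominated by a multiple of |f|^2. The second has
  no evident majorant, as \<open>\<rho> n\<close> need not be small in \<open>L2\<close>;
  Cauchy-Schwarz bounds it through the integral of |f \<rho>|^2, which is again dominated.\<close>

lemma brezis_lieb_six:
  assumes h: "h \<in> hardy" and r: "\<And>n::nat. r n \<in> hardy"
    and E: "\<And>n. ener (r n) \<le> E" and lim: "\<And>x. (\<lambda>n. inv_ft (r n) x) \<longlonglongrightarrow> 0"
  shows "(\<lambda>n. six (\<lambda>\<xi>. h \<xi> + r n \<xi>) - six h - six (r n)) \<longlonglongrightarrow> 0"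
proof -
  define f where "f = inv_ft h"
  define \<rho> where "\<rho> n = inv_ft (r n)" for n
  define C where "C = sqrt (Sob * ener h) + sqrt (Sob * E)"
  have fL: "f \<in> L2" and \<rho>L: "\<rho> n \<in> L2" for n unfolding f_def \<rho>_def by (intro inv_ft_hardy_L2 h r)+
  have [measurable]: "f \<in> borel_measurable borel" "\<rho> n \<in> borel_measurable borel" for n
    unfolding f_def \<rho>_def by (intro inv_ft_measurable_hardy h r)+
  have E0: "0 \<le> E" using E[of 0] ener_nonneg order_trans by blast
  have fC: "cmod (f x) \<le> C" for x
    using inv_ft_bound'[OF h, of x] Sob_nonneg E0 by (simp add: f_def C_def add_increasing2)
  have \<rho>C: "cmod (\<rho> n x) \<le> C" for n x
  proof -
    have "cmod (\<rho> n x) \<le> sqrt (Sob * ener (r n))" unfolding \<rho>_def by (rule inv_ft_bound'[OF r])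
    also have "\<dots> \<le> sqrt (Sob * E)" using E Sob_nonneg by (simp add: mult_left_mono)
    also have "\<dots> \<le> C" using Sob_nonneg ener_nonneg[of h] by (simp add: C_def)
    finally show ?thesis .
  qed
  have C0: "0 \<le> C" using fC[of 0] norm_ge_zero order_trans by blast
  have lim\<rho>: "(\<lambda>n. cmod (\<rho> n x)) \<longlonglongrightarrow> 0" for x
    using tendsto_norm[OF lim[of x]] by (simp add: \<rho>_def)
  define I1 where "I1 n = (LINT x|lborel. (cmod (f x))\<^sup>2 * cmod (\<rho> n x))" for n
  define I2 where "I2 n = (LINT x|lborel. (cmod (of_real (cmod (f x)) * \<rho> n x))\<^sup>2)" for n
  have pL: "(\<lambda>x. complex_of_real (cmod (f x)) * \<rho> n x) \<in> L2" for n
    by (rule L2_mult_bounded[OF \<rho>L, of _ C]) (use fC in auto)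
  have i1: "integrable lborel (\<lambda>x. (cmod (f x))\<^sup>2 * cmod (\<rho> n x))" for n
  proof (rule Bochner_Integration.integrable_bound)
    show "integrable lborel (\<lambda>x. C * (cmod (f x))\<^sup>2)" by (intro integrable_mult_right L2_integrable_power2 fL)
    show "AE x in lborel. norm ((cmod (f x))\<^sup>2 * cmod (\<rho> n x)) \<le> norm (C * (cmod (f x))\<^sup>2)"
      using \<rho>C[of n] C0 by (intro AE_I2) (simp add: abs_mult mult.commute[of C] mult_left_mono)
  qed measurable
  have L1: "I1 \<longlonglongrightarrow> 0"
  proof -
    have "I1 \<longlonglongrightarrow> (LINT x::real|lborel. 0)"
      unfolding I1_def
    proof (rule integral_dominated_convergence)
      show "integrable lborel (\<lambda>x. C * (cmod (f x))\<^sup>2)" by (intro integrable_mult_right L2_integrable_power2 fL)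
      show "AE x in lborel. norm ((cmod (f x))\<^sup>2 * cmod (\<rho> n x)) \<le> C * (cmod (f x))\<^sup>2" for n
        using \<rho>C[of n] C0 by (intro AE_I2) (simp add: abs_mult mult.commute[of C] mult_left_mono)
      show "AE x in lborel. (\<lambda>n. (cmod (f x))\<^sup>2 * cmod (\<rho> n x)) \<longlonglongrightarrow> 0"
        using tendsto_mult[OF tendsto_const lim\<rho>] by (intro AE_I2) simp
    qed simp_all
    then show ?thesis by simp
  qed
  have L2: "I2 \<longlonglongrightarrow> 0"
  proof -
    have "I2 \<longlonglongrightarrow> (LINT x::real|lborel. 0)"
      unfolding I2_def
    proof (rule integral_dominated_convergence)
      show "integrable lborel (\<lambda>x. C\<^sup>2 * (cmod (f x))\<^sup>2)" by (intro integrable_mult_right L2_integrable_power2 fL)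
      show "AE x in lborel. norm ((cmod (of_real (cmod (f x)) * \<rho> n x))\<^sup>2) \<le> C\<^sup>2 * (cmod (f x))\<^sup>2" for n
        using power_mono[OF \<rho>C[of n] norm_ge_zero, of _ 2]
        by (intro AE_I2) (simp add: norm_mult power_mult_distrib mult.commute[of "C\<^sup>2"] mult_left_mono)
      show "AE x in lborel. (\<lambda>n. (cmod (of_real (cmod (f x)) * \<rho> n x))\<^sup>2) \<longlonglongrightarrow> 0"
      proof (rule AE_I2)
        fix x
        have "(\<lambda>n. (cmod (f x) * cmod (\<rho> n x))\<^sup>2) \<longlonglongrightarrow> (cmod (f x) * 0)\<^sup>2"
          by (intro tendsto_power tendsto_mult tendsto_const lim\<rho>)
        then show "(\<lambda>n. (cmod (of_real (cmod (f x)) * \<rho> n x))\<^sup>2) \<longlonglongrightarrow> 0" by (simp add: norm_mult)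
      qed
    qed simp_all
    then show ?thesis by simp
  qed
  define I3 where "I3 n = (LINT x|lborel. cmod (f x) * (cmod (\<rho> n x))\<^sup>2)" for n
  have i3: "integrable lborel (\<lambda>x. cmod (f x) * (cmod (\<rho> n x))\<^sup>2)" for n
  proof (rule Bochner_Integration.integrable_bound)
    show "integrable lborel (\<lambda>x. C * (cmod (\<rho> n x))\<^sup>2)" by (intro integrable_mult_right L2_integrable_power2 \<rho>L)
    show "AE x in lborel. norm (cmod (f x) * (cmod (\<rho> n x))\<^sup>2) \<le> norm (C * (cmod (\<rho> n x))\<^sup>2)"
      using fC C0 by (intro AE_I2) (simp add: abs_mult mult_right_mono)
  qed measurable
  have I3_le: "I3 n \<le> sqrt (I2 n) * sqrt E" for n
  proof -
    have "complex_of_real (I3 n) = (LINT x|lborel. complex_of_real (cmod (f x) * (cmod (\<rho> n x))\<^sup>2))"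
      unfolding I3_def by (rule integral_complex_of_real[symmetric])
    also have "\<dots> = L2_inner (\<lambda>x. of_real (cmod (f x)) * \<rho> n x) (\<rho> n)"
      unfolding L2_inner_def
      by (intro Bochner_Integration.integral_cong refl) (simp add: complex_norm_square[symmetric] mult.assoc)
    finally have "\<bar>I3 n\<bar> \<le> lp_norm 2 (\<lambda>x. of_real (cmod (f x)) * \<rho> n x) * lp_norm 2 (\<rho> n)"
      using L2_Cauchy_Schwarz[OF pL \<rho>L, of n n] by (metis norm_of_real)
    also have "lp_norm 2 (\<rho> n) \<le> sqrt E"
    proof (rule real_le_rsqrt)
      show "(lp_norm 2 (\<rho> n))\<^sup>2 \<le> E"
        unfolding \<rho>_def lp_norm_2_inv_ft[OF r] using mass_le_ener[OF r, of n] E[of n] by linarith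
    qed
    finally show ?thesis by (simp add: lp_norm_2 I2_def mult_left_mono)
  qed
  have L3: "I3 \<longlonglongrightarrow> 0"
  proof -
    have "(\<lambda>n. sqrt (I2 n) * sqrt E) \<longlonglongrightarrow> sqrt 0 * sqrt E" by (intro tendsto_mult tendsto_real_sqrt L2 tendsto_const)
    then have lim0: "(\<lambda>n. sqrt (I2 n) * sqrt E) \<longlonglongrightarrow> 0" by simp
    have "0 \<le> I3 n" for n unfolding I3_def by (intro Bochner_Integration.integral_nonneg) simp
    then have "\<forall>\<^sub>F n in sequentially. norm (I3 n) \<le> sqrt (I2 n) * sqrt E"
      using I3_le by (intro always_eventually) simp
    from Lim_null_comparison[OF this lim0] show ?thesis .
  qed
  have bound: "\<bar>six (\<lambda>\<xi>. h \<xi> + r n \<xi>) - six h - six (r n)\<bar> \<le> 32 * C ^ 3 * I1 n + 32 * C ^ 3 * I3 n" for n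
  proof -
    have sum: "inv_ft (\<lambda>\<xi>. h \<xi> + r n \<xi>) x = f x + \<rho> n x" for x unfolding f_def \<rho>_def by (rule inv_ft_add[OF h r])
    have i6: "integrable lborel (\<lambda>x. cmod (f x + \<rho> n x) ^ 6)" "integrable lborel (\<lambda>x. cmod (f x) ^ 6)"
        "integrable lborel (\<lambda>x. cmod (\<rho> n x) ^ 6)"
      using integrable_six[OF hardy_add[OF h r[of n]]] integrable_six[OF h] integrable_six[OF r[of n]]
      unfolding sum f_def[symmetric] \<rho>_def[symmetric] by simp_all
    have eq: "six (\<lambda>\<xi>. h \<xi> + r n \<xi>) - six h - six (r n) = (LINT x|lborel. cmod (f x + \<rho> n x) ^ 6 - cmod (f x) ^ 6 - cmod (\<rho> n x) ^ 6)"
      using i6 unfolding six_def sum f_def[symmetric] \<rho>_def[symmetric] by simp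
    have "norm (LINT x|lborel. cmod (f x + \<rho> n x) ^ 6 - cmod (f x) ^ 6 - cmod (\<rho> n x) ^ 6) \<le> (LINT x|lborel. 32 * C ^ 3 * ((cmod (f x))\<^sup>2 * cmod (\<rho> n x)) + 32 * C ^ 3 * (cmod (f x) * (cmod (\<rho> n x))\<^sup>2))"
    proof (rule Bochner_Integration.integral_norm_bound_integral)
      show "integrable lborel (\<lambda>x. cmod (f x + \<rho> n x) ^ 6 - cmod (f x) ^ 6 - cmod (\<rho> n x) ^ 6)" using i6 by simp
      show "integrable lborel (\<lambda>x. 32 * C ^ 3 * ((cmod (f x))\<^sup>2 * cmod (\<rho> n x)) + 32 * C ^ 3 * (cmod (f x) * (cmod (\<rho> n x))\<^sup>2))"
        using i1[of n] i3[of n] by simp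
      fix x
      let ?a = "cmod (f x)" and ?b = "cmod (\<rho> n x)"
      have "?a ^ 3 \<le> C ^ 3" "?b ^ 3 \<le> C ^ 3" by (intro power_mono fC \<rho>C norm_ge_zero)+
      then have "?a ^ 3 * (?a\<^sup>2 * ?b) \<le> C ^ 3 * (?a\<^sup>2 * ?b)" "?b ^ 3 * (?a * ?b\<^sup>2) \<le> C ^ 3 * (?a * ?b\<^sup>2)"
        by (intro mult_right_mono; simp)+
      moreover have "?a * ?b * (?a ^ 4 + ?b ^ 4) = ?a ^ 3 * (?a\<^sup>2 * ?b) + ?b ^ 3 * (?a * ?b\<^sup>2)"
        by (simp add: numeral_eq_Suc algebra_simps)
      ultimately show "norm (cmod (f x + \<rho> n x) ^ 6 - ?a ^ 6 - ?b ^ 6) \<le> 32 * C ^ 3 * (?a\<^sup>2 * ?b) + 32 * C ^ 3 * (?a * ?b\<^sup>2)"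
        using power6_expansion_bound[of "f x" "\<rho> n x"] unfolding real_norm_def by linarith
    qed
    also have "\<dots> = 32 * C ^ 3 * I1 n + 32 * C ^ 3 * I3 n"
      unfolding I1_def I3_def using i1[of n] i3[of n] by simp
    finally show ?thesis unfolding eq real_norm_def .
  qed
  have "(\<lambda>n. 32 * C ^ 3 * I1 n + 32 * C ^ 3 * I3 n) \<longlonglongrightarrow> 32 * C ^ 3 * 0 + 32 * C ^ 3 * 0"
    by (intro tendsto_add tendsto_mult tendsto_const L1 L3)
  then have lim0: "(\<lambda>n. 32 * C ^ 3 * I1 n + 32 * C ^ 3 * I3 n) \<longlonglongrightarrow> 0" by simp
  have "\<forall>\<^sub>F n in sequentially. norm (six (\<lambda>\<xi>. h \<xi> + r n \<xi>) - six h - six (r n)) \<le> 32 * C ^ 3 * I1 n + 32 * C ^ 3 * I3 n"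
    using bound by (intro always_eventually) simp
  from Lim_null_comparison[OF this lim0] show ?thesis .
qed

section \<open>Existence of a minimiser\<close>

lemma quad_add_one:
  assumes "g \<in> hardy" "h \<in> hardy" "b \<in> borel_measurable borel" "\<And>\<xi>. \<bar>b \<xi>\<bar> \<le> C * (1 + \<xi>\<^sup>2)"
  shows "quad b (\<lambda>\<xi>. g \<xi> + h \<xi>) = quad b g + 2 * quad_inner b g h + quad b h"
  using quad_add[OF assms, of 1] by simp

lemma ener_diff_le:
  assumes "g \<in> hardy" "h \<in> hardy"
  shows "ener (\<lambda>\<xi>. g \<xi> - h \<xi>) \<le> 2 * ener g + 2 * ener h"
proof -
  have "ener (\<lambda>\<xi>. g \<xi> + of_real 1 * h \<xi>) + ener (\<lambda>\<xi>. g \<xi> + of_real (-1) * h \<xi>) = 2 * ener g + 2 * ener h"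
    using quad_add[OF assms _ symbol_bounds(4), of 1] quad_add[OF assms _ symbol_bounds(4), of "-1"] by simp
  then show ?thesis using ener_nonneg[of "\<lambda>\<xi>. g \<xi> + of_real 1 * h \<xi>"] by simp
qed

text \<open>Homogeneous of degree six, like \<open>six\<close>, so that minimising under
  \<open>six g = 1\<close> is minimising the quotient.\<close>

definition act :: "(real \<Rightarrow> complex) \<Rightarrow> real" where
  "act g = quad qsym g * (mass g)\<^sup>2"

lemma act_nonneg: "g \<in> hardy \<Longrightarrow> 0 \<le> act g"
  unfolding act_def by (intro mult_nonneg_nonneg qsym_nonneg) simp_all

lemma act_cmult: "act (\<lambda>\<xi>. c * g \<xi>) = cmod c ^ 6 * act g"
  unfolding act_def quad_cmult by (simp add: power_mult_distrib numeral_eq_Suc algebra_simps)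

text \<open>Coercivity of \<open>qsym\<close>, multiplied by the squared mass. It keeps the masses
  of a minimising sequence bounded above.\<close>

lemma mass_cube_le:
  assumes g: "g \<in> hardy"
  shows "mass g ^ 3 \<le> 8 * act g"
proof -
  have "mass g * (mass g)\<^sup>2 \<le> 8 * quad qsym g * (mass g)\<^sup>2"
    using mass_le_ener[OF g] ener_le_qsym[OF g] by (intro mult_right_mono) (linarith, simp)
  then show ?thesis by (simp add: act_def power2_eq_square power3_eq_cube mult_ac)
qed

text \<open>Pointwise, \<open>\<xi>\<close> is at most
  \<open>e * \<xi>\<^sup>2 + 1 / (4 * e)\<close>. When the mass is small the error is negligible and
  \<open>act\<close> is hardly below the kinetic expression; this keeps the masses of a minimising
  sequence away from 0.\<close>

lemma kin_le_act:
  assumes g: "g \<in> hardy" and e: "0 < e" "e \<le> 1"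
  shows "(1 - e) * (kin g * (mass g)\<^sup>2) - mass g ^ 3 / (4 * e) \<le> act g"
proof -
  define C where "C = 1 + 1 / (4 * e)"
  have pt: "(1 - e) * \<xi>\<^sup>2 + (- (1 / (4 * e))) * 1 \<le> qsym \<xi>" for \<xi>
  proof -
    have "qsym \<xi> - ((1 - e) * \<xi>\<^sup>2 + (- (1 / (4 * e))) * 1) = e * (\<xi> - 1 / (2 * e))\<^sup>2 + 1 / 2"
      using e by (simp add: power2_eq_square field_simps)
    then have "0 \<le> qsym \<xi> - ((1 - e) * \<xi>\<^sup>2 + (- (1 / (4 * e))) * 1)" using e by (simp only:) simp
    then show ?thesis unfolding diff_ge_0_iff_ge .
  qed
  have b: "\<bar>(1 - e) * \<xi>\<^sup>2 + (- (1 / (4 * e))) * 1\<bar> \<le> C * (1 + \<xi>\<^sup>2)" for \<xi>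
  proof -
    have 1: "\<bar>(1 - e) * \<xi>\<^sup>2\<bar> \<le> 1 * (1 + \<xi>\<^sup>2)"
      unfolding abs_mult using e by (intro mult_mono) simp_all
    have "1 / (4 * e) * 1 \<le> 1 / (4 * e) * (1 + \<xi>\<^sup>2)" using e by (intro mult_left_mono) simp_all
    then have 2: "\<bar>(- (1 / (4 * e))) * 1\<bar> \<le> 1 / (4 * e) * (1 + \<xi>\<^sup>2)" using e by simp
    show ?thesis using order_trans[OF abs_triangle_ineq add_mono[OF 1 2]] unfolding C_def by (simp only: distrib_right)
  qed
  have "(1 - e) * kin g + (- (1 / (4 * e))) * mass g = quad (\<lambda>\<xi>. (1 - e) * \<xi>\<^sup>2 + (- (1 / (4 * e))) * 1) g"
    by (rule quad_linear[OF g _ _ symbol_bounds(2) symbol_bounds(1), symmetric]) simp_all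
  also have "\<dots> \<le> quad qsym g" by (rule quad_mono[OF g _ _ b symbol_bounds(5) pt]) simp_all
  finally have "((1 - e) * kin g + (- (1 / (4 * e))) * mass g) * (mass g)\<^sup>2 \<le> act g"
    unfolding act_def by (rule mult_right_mono) simp
  then show ?thesis by (simp add: power2_eq_square power3_eq_cube algebra_simps)
qed

text \<open>The competitor \<open>g0\<close> makes the infimum \<open>s\<close> strictly smaller
  than \<open>J\<close>, whereas small masses would push \<open>act\<close> up to nearly
  \<open>J\<close>. With masses bounded on both sides, translations centre the sequence where its
  profile is large, so the weak limit \<open>h\<close> is not 0. If mass were lost in the limit, the
  remainders would themselves be competitors, and the two pieces together would cost more than
  \<open>s\<close>.\<close>

lemma hardy_minimiser:
  assumes J: "J > 0" "\<And>g. g \<in> hardy \<Longrightarrow> J * six g \<le> kin g * (mass g)\<^sup>2"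
    and g0: "g0 \<in> hardy" "act g0 < J * six g0"
  shows "\<exists>h\<in>hardy. six h = 1 \<and> act h < J \<and> (\<forall>w\<in>hardy. act h * six w \<le> act w)"
proof -
  define S where "S = {g \<in> hardy. six g = 1}"
  define s where "s = Inf (act ` S)"
  have normalise: "\<exists>c. (\<lambda>\<xi>. c * w \<xi>) \<in> S \<and> cmod c ^ 6 = 1 / six w" if "w \<in> hardy" "six w > 0" for w
  proof -
    define c where "c = complex_of_real (root 6 (1 / six w))"
    have "cmod c ^ 6 = 1 / six w" using that by (simp add: c_def)
    then show ?thesis using that by (intro exI[of _ c]) (simp add: S_def hardy_cmult six_cmult)
  qed
  have bdd: "bdd_below (act ` S)" using act_nonneg by (intro bdd_belowI2[of _ 0]) (auto simp: S_def)
  have "0 < J * six g0" using g0 act_nonneg[OF g0(1)] by linarith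
  then have "six g0 > 0" using J(1) by (simp add: zero_less_mult_iff)
  then have S0: "S \<noteq> {}" using normalise[OF g0(1)] by blast
  have s0: "0 \<le> s" unfolding s_def using S0 act_nonneg by (intro cINF_greatest) (auto simp: S_def)
  have s_le: "s * six w \<le> act w" if w: "w \<in> hardy" for w
  proof (cases "six w = 0")
    case False
    then have pos: "six w > 0" using six_nonneg[of w] by simp
    obtain c where c: "(\<lambda>\<xi>. c * w \<xi>) \<in> S" "cmod c ^ 6 = 1 / six w" using normalise[OF w pos] by blast
    have "s \<le> act (\<lambda>\<xi>. c * w \<xi>)" unfolding s_def by (rule cINF_lower[OF bdd c(1)])
    then show ?thesis using pos by (simp add: act_cmult c(2) pos_le_divide_eq)
  qed (use act_nonneg[OF w] in simp)
  have "s * six g0 < J * six g0" using s_le[OF g0(1)] g0(2) by linarith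
  then have sJ: "s < J" using \<open>six g0 > 0\<close> by simp
  \<comment> \<open>A quarter of the gap: the midpoint of \<open>s\<close> and \<open>J\<close> is
    \<open>s + 2 * d\<close>, while the whole sequence stays within \<open>s + d\<close>.\<close>
  define d where "d = (J - s) / 4"
  have d: "d > 0" using sJ by (simp add: d_def)
  have "\<exists>g\<in>S. act g < s + d / real (Suc n)" for n
    using cINF_less_iff[OF S0 bdd, of "s + d / real (Suc n)"] d by (auto simp: s_def)
  then obtain g where gS: "\<And>n. g n \<in> S" and gA: "\<And>n. act (g n) < s + d / real (Suc n)" by metis
  have g: "g n \<in> hardy" "six (g n) = 1" for n using gS by (auto simp: S_def)
  have gd: "act (g n) \<le> s + d" for n
  proof -
    have "d / real (Suc n) \<le> d / 1" using d by (intro divide_left_mono) simp_all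
    then show ?thesis using gA[of n] by simp
  qed
  \<comment> \<open>\<open>8 * (s + d)\<close> bounds the cube of the mass, hence also any mass
    exceeding 1; adding 1 covers the other masses.\<close>
  define B where "B = 8 * (s + d) + 1"
  have B: "B \<ge> 1" using s0 d by (simp add: B_def)
  have MB: "mass (g n) \<le> B" for n
  proof (rule ccontr)
    assume "\<not> mass (g n) \<le> B"
    then have gt: "mass (g n) > B" by simp
    then have "1 * mass (g n) \<le> (mass (g n))\<^sup>2 * mass (g n)"
      using B by (intro mult_right_mono one_le_power) simp_all
    then have "mass (g n) \<le> mass (g n) ^ 3" by (simp add: power2_eq_square power3_eq_cube)
    then show False using gt mass_cube_le[OF g(1), of n] gd[of n] by (simp add: B_def)
  qed
  \<comment> \<open>Chosen to make \<open>(1 - e) * J\<close> the midpoint of \<open>s\<close> and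
    \<open>J\<close>.\<close>
  define e where "e = (J - s) / (2 * J)"
  have e: "0 < e" "e \<le> 1" using sJ s0 J by (simp_all add: e_def)
  define m0 where "m0 = 4 * e * d"
  have m0: "m0 > 0" using e d by (simp add: m0_def)
  have Mm: "m0 \<le> mass (g n) ^ 3" for n
  proof -
    have "(1 - e) * J = (J + s) / 2" using J by (simp add: e_def field_simps)
    moreover have "(1 - e) * J \<le> (1 - e) * (kin (g n) * (mass (g n))\<^sup>2)"
      using J(2)[OF g(1)[of n]] g(2)[of n] e by (intro mult_left_mono) simp_all
    ultimately have "(J + s) / 2 - mass (g n) ^ 3 / (4 * e) \<le> s + d"
      using kin_le_act[OF g(1)[of n] e] gd[of n] by linarith
    moreover have "(J + s) / 2 = s + 2 * d" by (simp add: d_def field_simps)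
    ultimately have "d \<le> mass (g n) ^ 3 / (4 * e)" by linarith
    then show ?thesis using e by (simp add: m0_def field_simps)
  qed
  define q0 where "q0 = (s + d) * B / m0"
  have q0: "quad qsym (g n) \<le> q0" for n
  proof -
    have "quad qsym (g n) * m0 \<le> quad qsym (g n) * mass (g n) ^ 3"
      using Mm qsym_nonneg[OF g(1)] by (rule mult_left_mono)
    also have "\<dots> = act (g n) * mass (g n)" by (simp add: act_def power2_eq_square power3_eq_cube)
    also have "\<dots> \<le> (s + d) * B" using gd MB s0 d mass_nonneg by (intro mult_mono) simp_all
    finally show ?thesis using m0 by (simp add: q0_def pos_le_divide_eq)
  qed
  \<comment> \<open>If the fourth power of the profile never exceeded \<open>c\<close>, then
    \<open>six\<close> would be at most \<open>c * B = 1 / 2\<close>.\<close>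
  define c where "c = 1 / (2 * B)"
  have c: "c > 0" using B by (simp add: c_def)
  have "\<exists>x. c < cmod (inv_ft (g n) x) ^ 4" for n
  proof (rule ccontr)
    assume "\<not> (\<exists>x. c < cmod (inv_ft (g n) x) ^ 4)"
    then have "six (g n) \<le> c * mass (g n)" by (intro six_le g(1)) (simp add: not_less)
    also have "\<dots> \<le> c * B" using MB c by (intro mult_left_mono) simp_all
    also have "\<dots> < 1" using B by (simp add: c_def)
    finally show False using g(2) by simp
  qed
  then obtain x where x: "\<And>n. c < cmod (inv_ft (g n) (x n)) ^ 4" by metis
  \<comment> \<open>The phase translates the profile so that the point \<open>x n\<close> becomes
    the origin; \<open>act\<close> and \<open>six\<close> keep their values.\<close>
  define G where "G n = (\<lambda>\<xi>. cis (x n * \<xi>) * g n \<xi>)" for n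
  have G: "G n \<in> hardy" "six (G n) = 1" for n
    unfolding G_def by (rule hardy_translate[OF g(1)], simp add: six_translate g(2))
  have Gq: "quad b (G n) = quad b (g n)" for b n unfolding G_def by (rule quad_translate)
  have Gx: "c < cmod (inv_ft (G n) 0) ^ 4" for n using x[of n] by (simp add: G_def inv_ft_translate)
  \<comment> \<open>The two factors of \<open>act\<close> must converge separately, since the
    splitting below compares them one by one.\<close>
  have "bounded (range (\<lambda>n. (quad qsym (G n), mass (G n))))"
  proof -
    have "range (\<lambda>n. (quad qsym (G n), mass (G n))) \<subseteq> {0..q0} \<times> {0..B}"
      using q0 MB mass_nonneg qsym_nonneg[OF g(1)] by (auto simp: Gq)
    then show ?thesis by (rule bounded_subset[OF bounded_Times[OF bounded_closed_interval bounded_closed_interval]])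
  qed
  then obtain p l where l: "strict_mono (l :: nat \<Rightarrow> nat)" and lp: "((\<lambda>n. (quad qsym (G n), mass (G n))) \<circ> l) \<longlonglongrightarrow> p"
    using bounded_imp_convergent_subsequence by blast
  have limp: "(\<lambda>n. quad qsym (G (l n))) \<longlonglongrightarrow> fst p" "(\<lambda>n. mass (G (l n))) \<longlonglongrightarrow> snd p"
    using tendsto_fst[OF lp] tendsto_snd[OF lp] by (simp_all add: o_def)
  have Eb: "ener (G (l n)) \<le> 8 * q0" for n
    using ener_le_qsym[OF G(1)[of "l n"]] q0[of "l n"] by (simp add: Gq)
  obtain k h where k: "strict_mono (k :: nat \<Rightarrow> nat)" and h: "h \<in> hardy"
    and wk: "\<And>a. a \<in> L2 \<Longrightarrow> (\<lambda>n. LINT \<xi>|lborel. (1 + \<i> * of_real \<xi>) * (G (l (k n)) \<xi> - h \<xi>) * a \<xi>) \<longlonglongrightarrow> 0"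
  proof -
    have "\<exists>k h. strict_mono (k :: nat \<Rightarrow> nat) \<and> h \<in> hardy
        \<and> (\<forall>a\<in>L2. (\<lambda>n. LINT \<xi>|lborel. (1 + \<i> * of_real \<xi>) * (G (l (k n)) \<xi> - h \<xi>) * a \<xi>) \<longlonglongrightarrow> 0)"
      by (rule hardy_weakly_compact[of "\<lambda>n. G (l n)", OF G(1) Eb]) blast
    then show thesis using that by blast
  qed
  define F where "F n = G (l (k n))" for n
  define r where "r n = (\<lambda>\<xi>. F n \<xi> - h \<xi>)" for n
  have F: "F n \<in> hardy" "six (F n) = 1" for n by (simp_all add: F_def G)
  have r: "r n \<in> hardy" for n unfolding r_def by (rule hardy_diff[OF F(1) h])
  have hr: "(\<lambda>\<xi>. h \<xi> + r n \<xi>) = F n" for n by (simp add: r_def)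
  have wr: "(\<lambda>n. LINT \<xi>|lborel. (1 + \<i> * of_real \<xi>) * r n \<xi> * a \<xi>) \<longlonglongrightarrow> 0" if "a \<in> L2" for a
    using wk[OF that] by (simp add: r_def F_def)
  have pw: "(\<lambda>n. inv_ft (r n) y) \<longlonglongrightarrow> 0" for y by (rule weak_limit_pointwise[OF r wr])
  have limF: "(\<lambda>n. quad qsym (F n)) \<longlonglongrightarrow> fst p" "(\<lambda>n. mass (F n)) \<longlonglongrightarrow> snd p"
    unfolding F_def using LIMSEQ_subseq_LIMSEQ[OF limp(1) k] LIMSEQ_subseq_LIMSEQ[OF limp(2) k] by (simp_all add: o_def)
  have limA: "(\<lambda>n. act (F n)) \<longlonglongrightarrow> s"
  proof (rule real_tendsto_sandwich)
    show "\<forall>\<^sub>F n in sequentially. s \<le> act (F n)"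
      using s_le[OF F(1)] F(2) by (intro always_eventually) simp
    show "\<forall>\<^sub>F n in sequentially. act (F n) \<le> s + d / real (Suc n)"
    proof (intro always_eventually allI)
      fix n
      have "n \<le> l (k n)" using strict_mono_imp_increasing[OF l] strict_mono_imp_increasing[OF k] order_trans by blast
      then have "d / real (Suc (l (k n))) \<le> d / real (Suc n)" using d by (intro divide_left_mono) simp_all
      then show "act (F n) \<le> s + d / real (Suc n)" using gA[of "l (k n)"] by (simp add: F_def act_def Gq)
    qed
    have "(\<lambda>n. s + d * inverse (real (Suc n))) \<longlonglongrightarrow> s + d * 0"
      by (intro tendsto_add tendsto_mult tendsto_const LIMSEQ_inverse_real_of_nat)
    then show "(\<lambda>n. s + d / real (Suc n)) \<longlonglongrightarrow> s" by (simp add: divide_inverse)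
  qed simp
  have "(\<lambda>n. act (F n)) \<longlonglongrightarrow> fst p * (snd p)\<^sup>2"
    unfolding act_def by (intro tendsto_mult tendsto_power limF)
  then have ps: "fst p * (snd p)\<^sup>2 = s" using LIMSEQ_unique limA by blast
  define a where "a = quad qsym h"
  define m where "m = mass h"
  have split: "quad b (F n) = quad b h + 2 * quad_inner b h (r n) + quad b (r n)"
    if "b \<in> borel_measurable borel" "\<And>\<xi>. \<bar>b \<xi>\<bar> \<le> C * (1 + \<xi>\<^sup>2)" for b C n
    using quad_add_one[OF h r that, of n] unfolding hr .
  have lim\<alpha>: "(\<lambda>n. quad qsym (r n)) \<longlonglongrightarrow> fst p - a"
  proof -
    have "(\<lambda>n. quad qsym (F n) - a - 2 * quad_inner qsym h (r n)) \<longlonglongrightarrow> fst p - a - 2 * 0"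
      by (intro tendsto_diff tendsto_mult limF tendsto_const weak_limit_quad_inner[OF r h wr _ symbol_bounds(5)]) simp_all
    then show ?thesis using split[OF _ symbol_bounds(5)] by (simp add: a_def)
  qed
  have lim\<beta>: "(\<lambda>n. mass (r n)) \<longlonglongrightarrow> snd p - m"
  proof -
    have "(\<lambda>n. mass (F n) - m - 2 * quad_inner (\<lambda>\<xi>. 1) h (r n)) \<longlonglongrightarrow> snd p - m - 2 * 0"
      by (intro tendsto_diff tendsto_mult limF tendsto_const weak_limit_quad_inner[OF r h wr _ symbol_bounds(1)]) simp_all
    then show ?thesis using split[OF _ symbol_bounds(1)] by (simp add: m_def)
  qed
  define \<alpha> where "\<alpha> = fst p - a"
  define \<beta> where "\<beta> = snd p - m"
  have \<alpha>0: "0 \<le> \<alpha>" unfolding \<alpha>_def by (rule LIMSEQ_le_const[OF lim\<alpha>]) (use qsym_nonneg[OF r] in blast)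
  have \<beta>0: "0 \<le> \<beta>" unfolding \<beta>_def by (rule LIMSEQ_le_const[OF lim\<beta>]) (use mass_nonneg in blast)
  define E where "E = 2 * (8 * q0) + 2 * ener h"
  have Er: "ener (r n) \<le> E" for n
    using ener_diff_le[OF F(1) h, of n] Eb[of "k n"] by (simp add: r_def E_def F_def)
  have "(\<lambda>n. 1 - six h - (six (\<lambda>\<xi>. h \<xi> + r n \<xi>) - six h - six (r n))) \<longlonglongrightarrow> 1 - six h - 0"
    by (intro tendsto_diff tendsto_const brezis_lieb_six[OF h r Er pw])
  then have lim\<nu>: "(\<lambda>n. six (r n)) \<longlonglongrightarrow> 1 - six h" unfolding hr by (simp add: F(2))
  \<comment> \<open>The remainders compete for the same infimum; this is the limit of that
    inequality.\<close>
  have \<alpha>\<beta>: "s * (1 - six h) \<le> \<alpha> * \<beta>\<^sup>2"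
  proof (rule LIMSEQ_le)
    show "(\<lambda>n. s * six (r n)) \<longlonglongrightarrow> s * (1 - six h)" by (intro tendsto_mult tendsto_const lim\<nu>)
    show "(\<lambda>n. act (r n)) \<longlonglongrightarrow> \<alpha> * \<beta>\<^sup>2"
      unfolding act_def \<alpha>_def \<beta>_def by (intro tendsto_mult tendsto_power lim\<alpha> lim\<beta>)
    show "\<exists>N. \<forall>n\<ge>N. s * six (r n) \<le> act (r n)" using s_le[OF r] by blast
  qed
  have am: "s * six h \<le> a * m\<^sup>2" using s_le[OF h] by (simp add: act_def a_def m_def)
  have m0': "0 \<le> m" unfolding m_def by (rule mass_nonneg)
  \<comment> \<open>After the recentring the fourth powers of all profiles exceed \<open>c\<close>
    at 0, and weak convergence passes point values to the limit.\<close>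
  have apos: "0 < a"
  proof -
    have "(\<lambda>n. cmod (inv_ft h 0 + inv_ft (r n) 0) ^ 4) \<longlonglongrightarrow> cmod (inv_ft h 0 + 0) ^ 4"
      by (intro tendsto_power tendsto_norm tendsto_add tendsto_const pw)
    moreover have "inv_ft h 0 + inv_ft (r n) 0 = inv_ft (F n) 0" for n
      using inv_ft_add[OF h r, of n 0] unfolding hr by simp
    ultimately have "(\<lambda>n. cmod (inv_ft (F n) 0) ^ 4) \<longlonglongrightarrow> cmod (inv_ft h 0) ^ 4" by simp
    then have "c \<le> cmod (inv_ft h 0) ^ 4"
      by (rule LIMSEQ_le_const) (use Gx in \<open>auto simp: F_def intro: less_imp_le\<close>)
    then have "0 < cmod (inv_ft h 0) ^ 4" using c by linarith
    then have "0 < (cmod (inv_ft h 0))\<^sup>2" by (simp add: zero_less_power_eq)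
    then have "0 < Sob * ener h" using inv_ft_bound[OF h, of 0] by linarith
    then have "0 < ener h" using Sob_nonneg by (simp add: zero_less_mult_iff)
    then show ?thesis using ener_le_qsym[OF h] by (simp add: a_def)
  qed
  have "(a + \<alpha>) * (m + \<beta>)\<^sup>2 = s" using ps by (simp add: \<alpha>_def \<beta>_def)
  \<comment> \<open>The first two terms on the right already account for all of \<open>s\<close>.
    The third, \<open>a * \<beta>\<^sup>2\<close>, is a surplus that must vanish, and with it the
    lost mass.\<close>
  moreover have "(a + \<alpha>) * (m + \<beta>)\<^sup>2 \<ge> a * m\<^sup>2 + \<alpha> * \<beta>\<^sup>2 + a * \<beta>\<^sup>2"
  proof -
    have "(a + \<alpha>) * (m + \<beta>)\<^sup>2 - (a * m\<^sup>2 + \<alpha> * \<beta>\<^sup>2 + a * \<beta>\<^sup>2) = 2 * a * m * \<beta> + \<alpha> * m\<^sup>2 + 2 * \<alpha> * m * \<beta>"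
      by (simp add: power2_eq_square algebra_simps)
    moreover have "0 \<le> 2 * a * m * \<beta> + \<alpha> * m\<^sup>2 + 2 * \<alpha> * m * \<beta>"
      using apos \<alpha>0 \<beta>0 m0' by (intro add_nonneg_nonneg mult_nonneg_nonneg) simp_all
    ultimately show ?thesis by linarith
  qed
  moreover have "s * six h + s * (1 - six h) = s" by (simp add: algebra_simps)
  ultimately have "a * \<beta>\<^sup>2 \<le> 0" using am \<alpha>\<beta> by linarith
  then have \<beta>z: "\<beta> = 0" using apos by (simp add: mult_le_0_iff)
  \<comment> \<open>A remainder without mass has no sixth power either, its supremum being bounded.
    So nothing of the constraint is lost and \<open>six h = 1\<close>.\<close>
  have "(\<lambda>n. six (r n)) \<longlonglongrightarrow> 0"
  proof -
    have le: "six (r n) \<le> (Sob * E)\<^sup>2 * mass (r n)" for n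
    proof (rule six_le[OF r])
      fix y
      have "(cmod (inv_ft (r n) y))\<^sup>2 \<le> Sob * ener (r n)" by (rule inv_ft_bound[OF r])
      also have "\<dots> \<le> Sob * E" using Er Sob_nonneg by (rule mult_left_mono)
      finally have "((cmod (inv_ft (r n) y))\<^sup>2)\<^sup>2 \<le> (Sob * E)\<^sup>2" by (intro power_mono) simp_all
      then show "cmod (inv_ft (r n) y) ^ 4 \<le> (Sob * E)\<^sup>2" by (simp flip: power_mult)
    qed
    have "(\<lambda>n. (Sob * E)\<^sup>2 * mass (r n)) \<longlonglongrightarrow> (Sob * E)\<^sup>2 * (snd p - m)" by (intro tendsto_mult tendsto_const lim\<beta>)
    then have lim0: "(\<lambda>n. (Sob * E)\<^sup>2 * mass (r n)) \<longlonglongrightarrow> 0" using \<beta>z by (simp add: \<beta>_def)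
    have "\<forall>\<^sub>F n in sequentially. norm (six (r n)) \<le> (Sob * E)\<^sup>2 * mass (r n)"
      using le six_nonneg by (intro always_eventually) simp
    from Lim_null_comparison[OF this lim0] show ?thesis .
  qed
  from LIMSEQ_unique[OF lim\<nu> this] have six1: "six h = 1" by simp
  have "a * m\<^sup>2 \<le> (a + \<alpha>) * m\<^sup>2" using \<alpha>0 by (intro mult_right_mono) simp_all
  then have "act h \<le> s" using \<open>(a + \<alpha>) * (m + \<beta>)\<^sup>2 = s\<close> \<beta>z by (simp add: act_def a_def m_def)
  show ?thesis
  proof (intro bexI[of _ h] conjI ballI)
    show "act h < J" using \<open>act h \<le> s\<close> sJ by simp
    show "act h * six w \<le> act w" if "w \<in> hardy" for w
      using mult_right_mono[OF \<open>act h \<le> s\<close> six_nonneg[of w]] s_le[OF that] by linarith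
  qed (use h six1 in simp_all)
qed

section \<open>The Euler--Lagrange equation\<close>

definition nonlin :: "(real \<Rightarrow> complex) \<Rightarrow> real \<Rightarrow> complex" where
  "nonlin f x = of_real (cmod (f x) ^ 4) * f x"

text \<open>The tangent line of the cube at \<open>A\<close>, combined with
  \<open>A + 2 * R \<le> B\<close>, where \<open>A\<close> and \<open>B\<close> are the squared
  moduli.\<close>

lemma power6_convex:
  fixes z w :: complex
  shows "cmod z ^ 6 + 6 * Re (of_real (cmod z ^ 4) * z * cnj w) \<le> cmod (z + w) ^ 6"
proof -
  define A where "A = (cmod z)\<^sup>2"
  define B where "B = (cmod (z + w))\<^sup>2"
  have AB: "0 \<le> A" "0 \<le> B" by (simp_all add: A_def B_def)
  define R where "R = Re (z * cnj w)"
  have B: "A + 2 * R \<le> B"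
    unfolding A_def B_def R_def cmod_power2 by (simp add: power2_eq_square algebra_simps)
  have "B ^ 3 - A ^ 3 - 3 * A\<^sup>2 * (B - A) = (B - A)\<^sup>2 * (B + 2 * A)"
    by (simp add: power2_eq_square power3_eq_cube algebra_simps)
  moreover have "0 \<le> (B - A)\<^sup>2 * (B + 2 * A)" using AB by (intro mult_nonneg_nonneg) simp_all
  ultimately have "A ^ 3 + 3 * A\<^sup>2 * (B - A) \<le> B ^ 3" by linarith
  moreover have "3 * A\<^sup>2 * (2 * R) \<le> 3 * A\<^sup>2 * (B - A)" using B by (intro mult_left_mono) simp_all
  ultimately have "A ^ 3 + 6 * (A\<^sup>2 * R) \<le> B ^ 3" by linarith
  moreover have "A\<^sup>2 * R = Re (of_real (cmod z ^ 4) * z * cnj w)"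
    by (simp add: A_def R_def mult.assoc flip: power_mult)
  moreover have "A ^ 3 = cmod z ^ 6" "B ^ 3 = cmod (z + w) ^ 6" by (simp_all add: A_def B_def flip: power_mult)
  ultimately show ?thesis by simp
qed

lemma nonlin_L2:
  assumes "f \<in> L2" "\<And>x. cmod (f x) \<le> C"
  shows "nonlin f \<in> L2"
proof -
  have [measurable]: "f \<in> borel_measurable borel" using L2_measurable[OF assms(1)] by simp
  show ?thesis unfolding nonlin_def[abs_def]
    by (rule L2_mult_bounded[OF assms(1), of _ "C ^ 4"]) (simp_all add: power_mono assms(2) norm_power)
qed

lemma nonlin_inv_ft_L2: "g \<in> hardy \<Longrightarrow> nonlin (inv_ft g) \<in> L2"
  by (rule nonlin_L2[OF inv_ft_hardy_L2 inv_ft_bound'])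

lemma six_add_ge:
  assumes g: "g \<in> hardy" and w: "w \<in> hardy"
  shows "six g + 6 * (t * Re (L2_inner (nonlin (inv_ft g)) (inv_ft w))) \<le> six (\<lambda>\<xi>. g \<xi> + of_real t * w \<xi>)"
proof -
  let ?f = "inv_ft g" and ?v = "inv_ft w"
  have sum: "inv_ft (\<lambda>\<xi>. g \<xi> + of_real t * w \<xi>) x = ?f x + of_real t * ?v x" for x
    using inv_ft_add[OF g hardy_cmult[OF w]] by (simp add: inv_ft_cmult)
  have ii: "integrable lborel (\<lambda>x. nonlin ?f x * cnj (?v x))"
    by (intro L2_integrable_mult_cnj nonlin_inv_ft_L2 inv_ft_hardy_L2 g w)
  have "six g + 6 * (t * Re (L2_inner (nonlin ?f) ?v)) = (LINT x|lborel. cmod (?f x) ^ 6 + 6 * (t * Re (nonlin ?f x * cnj (?v x))))"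
    unfolding six_def L2_inner_def using integrable_six[OF g] integrable_Re[OF ii] integral_Re[OF ii] by simp
  also have "\<dots> \<le> (LINT x|lborel. cmod (?f x + of_real t * ?v x) ^ 6)"
  proof (rule integral_mono)
    show "integrable lborel (\<lambda>x. cmod (?f x) ^ 6 + 6 * (t * Re (nonlin ?f x * cnj (?v x))))"
      using integrable_six[OF g] integrable_Re[OF ii] by simp
    show "integrable lborel (\<lambda>x. cmod (?f x + of_real t * ?v x) ^ 6)"
      using integrable_six[OF hardy_add[OF g hardy_cmult[OF w, of "of_real t"]]] unfolding sum .
    fix x
    have "of_real (cmod (?f x) ^ 4) * ?f x * cnj (of_real t * ?v x) = of_real t * (nonlin ?f x * cnj (?v x))"
      by (simp add: nonlin_def mult_ac)
    moreover have "Re (of_real t * z) = t * Re z" for z by simp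
    ultimately have "Re (of_real (cmod (?f x) ^ 4) * ?f x * cnj (of_real t * ?v x)) = t * Re (nonlin ?f x * cnj (?v x))"
      by (simp only:)
    then show "cmod (?f x) ^ 6 + 6 * (t * Re (nonlin ?f x * cnj (?v x))) \<le> cmod (?f x + of_real t * ?v x) ^ 6"
      using power6_convex[of "?f x" "of_real t * ?v x"] by (simp only:)
  qed
  finally show ?thesis by (simp add: six_def sum)
qed

text \<open>Convexity of \<open>z \<mapsto> |z|\<^sup>6\<close> bounds \<open>six\<close> from below by its linearisation; no differentiability of \<open>six\<close> is
  needed for the first-order condition.\<close>
lemma euler_lagrange_weak:
  assumes g: "g \<in> hardy" "six g = 1" and min: "\<And>w. w \<in> hardy \<Longrightarrow> act g * six w \<le> act w" and w: "w \<in> hardy"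
  shows "mass g * quad_inner qsym g w + 2 * quad qsym g * quad_inner (\<lambda>\<xi>. 1) g w
    = 3 * quad qsym g * mass g * Re (L2_inner (nonlin (inv_ft g)) (inv_ft w))"
proof -
  define q where "q = quad qsym g"
  define M where "M = mass g"
  define q1 where "q1 = quad_inner qsym g w"
  define m1 where "m1 = quad_inner (\<lambda>\<xi>. 1) g w"
  define q2 where "q2 = quad qsym w"
  define m2 where "m2 = mass w"
  define V where "V = Re (L2_inner (nonlin (inv_ft g)) (inv_ft w))"
  \<comment> \<open>A polynomial in \<open>t\<close> that is nonnegative, by minimality and the
    linear lower bound for \<open>six\<close>, and vanishes at 0; so its derivative at 0
    vanishes.\<close>
  define P where "P t = (q + 2 * t * q1 + t\<^sup>2 * q2) * (M + 2 * t * m1 + t\<^sup>2 * m2)\<^sup>2 - q * M\<^sup>2 * (1 + 6 * (t * V))" for t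
  have P0: "P 0 = 0" by (simp add: P_def)
  have Ppos: "0 \<le> P t" for t
  proof -
    let ?w = "\<lambda>\<xi>. g \<xi> + of_real t * w \<xi>"
    have wh: "?w \<in> hardy" by (intro hardy_add hardy_cmult g w)
    have "act g * (1 + 6 * (t * V)) \<le> act g * six ?w"
      using six_add_ge[OF g(1) w, of t] act_nonneg[OF g(1)] by (intro mult_left_mono) (simp_all add: V_def g(2))
    also have "\<dots> \<le> act ?w" by (rule min[OF wh])
    also have "act ?w = (q + 2 * t * q1 + t\<^sup>2 * q2) * (M + 2 * t * m1 + t\<^sup>2 * m2)\<^sup>2"
      using quad_add[OF g(1) w _ symbol_bounds(5), of t] quad_add[OF g(1) w _ symbol_bounds(1), of t]
      by (simp add: act_def q_def M_def q1_def m1_def q2_def m2_def)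
    finally show ?thesis by (simp add: P_def act_def q_def M_def)
  qed
  have "(P has_field_derivative (2 * q1 * M\<^sup>2 + q * (2 * M * (2 * m1)) - q * M\<^sup>2 * (6 * V))) (at 0)"
    unfolding P_def[abs_def] by (auto intro!: derivative_eq_intros simp: power2_eq_square algebra_simps)
  then have "2 * q1 * M\<^sup>2 + q * (2 * M * (2 * m1)) - q * M\<^sup>2 * (6 * V) = 0"
    by (rule DERIV_local_min[of _ _ _ 1]) (use P0 Ppos in simp_all)
  then have "2 * M * (M * q1 + 2 * q * m1 - 3 * q * M * V) = 0" by (simp add: power2_eq_square algebra_simps)
  moreover have "M \<noteq> 0"
  proof
    assume "M = 0"
    have "six g \<le> (Sob * ener g)\<^sup>2 * mass g"
    proof (rule six_le[OF g(1)])
      fix x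
      have "((cmod (inv_ft g x))\<^sup>2)\<^sup>2 \<le> (Sob * ener g)\<^sup>2" by (intro power_mono inv_ft_bound g(1)) simp
      then show "cmod (inv_ft g x) ^ 4 \<le> (Sob * ener g)\<^sup>2" by (simp flip: power_mult)
    qed
    then show False using \<open>M = 0\<close> g(2) by (simp add: M_def)
  qed
  ultimately show ?thesis by (simp add: q_def M_def q1_def m1_def V_def)
qed

text \<open>The weak equation says that \<open>D\<close> is orthogonal to the Hardy space. As
  \<open>qsym\<close> grows, \<open>D\<close> is not known to be square integrable, so it cannot
  itself serve as a test function.\<close>

lemma euler_lagrange:
  assumes g: "g \<in> hardy" "six g = 1" and min: "\<And>w. w \<in> hardy \<Longrightarrow> act g * six w \<le> act w"
  shows "AE \<xi> in lborel. 0 \<le> \<xi> \<longrightarrow>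
    of_real (mass g * qsym \<xi> + 2 * quad qsym g) * g \<xi> = of_real (3 * quad qsym g * mass g) * fourier (nonlin (inv_ft g)) \<xi>"
proof -
  define V where "V = fourier (nonlin (inv_ft g))"
  define D where "D \<xi> = of_real (mass g * qsym \<xi> + 2 * quad qsym g) * g \<xi> - of_real (3 * quad qsym g * mass g) * V \<xi>" for \<xi>
  have VL: "V \<in> L2" unfolding V_def by (intro fourier_L2 nonlin_inv_ft_L2 g)
  have [measurable]: "g \<in> borel_measurable borel" "V \<in> borel_measurable borel"
    using hardy_borel_measurable[OF g(1)] L2_measurable[OF VL] by simp_all
  have Dm [measurable]: "D \<in> borel_measurable borel" unfolding D_def[abs_def] by measurable
  have orth: "(LINT \<xi>|lborel. Re (D \<xi> * cnj (w \<xi>))) = 0" and orth_int: "integrable lborel (\<lambda>\<xi>. Re (D \<xi> * cnj (w \<xi>)))" if w: "w \<in> hardy" for w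
  proof -
    have i1: "integrable lborel (\<lambda>\<xi>. of_real (qsym \<xi>) * g \<xi> * cnj (w \<xi>))"
      by (rule integrable_quad_inner[OF g(1) w _ symbol_bounds(5)]) simp
    have i2: "integrable lborel (\<lambda>\<xi>. of_real 1 * g \<xi> * cnj (w \<xi>))"
      by (rule integrable_quad_inner[OF g(1) w _ symbol_bounds(1)]) simp
    have i3: "integrable lborel (\<lambda>\<xi>. V \<xi> * cnj (w \<xi>))" by (intro L2_integrable_mult_cnj VL hardy_L2 w)
    have eq: "D \<xi> * cnj (w \<xi>) = of_real (mass g) * (of_real (qsym \<xi>) * g \<xi> * cnj (w \<xi>))
        + of_real (2 * quad qsym g) * (of_real 1 * g \<xi> * cnj (w \<xi>)) - of_real (3 * quad qsym g * mass g) * (V \<xi> * cnj (w \<xi>))" for \<xi>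
      unfolding D_def of_real_add of_real_mult[of "mass g" "qsym \<xi>"] by (simp add: algebra_simps)
    have iD: "integrable lborel (\<lambda>\<xi>. D \<xi> * cnj (w \<xi>))"
      unfolding eq
      by (intro Bochner_Integration.integrable_diff Bochner_Integration.integrable_add integrable_mult_right i1 i2 i3)
    then show "integrable lborel (\<lambda>\<xi>. Re (D \<xi> * cnj (w \<xi>)))" by (rule integrable_Re)
    have "(LINT \<xi>|lborel. D \<xi> * cnj (w \<xi>)) = of_real (mass g) * (LINT \<xi>|lborel. of_real (qsym \<xi>) * g \<xi> * cnj (w \<xi>))
        + of_real (2 * quad qsym g) * (LINT \<xi>|lborel. of_real 1 * g \<xi> * cnj (w \<xi>)) - of_real (3 * quad qsym g * mass g) * (LINT \<xi>|lborel. V \<xi> * cnj (w \<xi>))"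
      unfolding eq
      by (subst Bochner_Integration.integral_diff Bochner_Integration.integral_add;
          (intro Bochner_Integration.integrable_diff Bochner_Integration.integrable_add integrable_mult_right i1 i2 i3)?)+
        (simp only: integral_mult_right_zero)
    then have "Re (LINT \<xi>|lborel. D \<xi> * cnj (w \<xi>)) = mass g * (2 * pi * quad_inner qsym g w)
        + 2 * quad qsym g * (2 * pi * quad_inner (\<lambda>\<xi>. 1) g w) - 3 * quad qsym g * mass g * Re (L2_inner V w)"
      by (simp add: quad_inner_def L2_inner_def)
    also have "L2_inner V w = 2 * pi * L2_inner (nonlin (inv_ft g)) (inv_ft w)"
    proof -
      have "L2_inner V w = L2_inner V (fourier (inv_ft w))"
        by (rule L2_inner_cong_AE) (use fourier_inv_ft_hardy[OF w] VL hardy_L2[OF w] fourier_L2[OF inv_ft_hardy_L2[OF w]] in \<open>auto elim: eventually_mono\<close>)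
      also have "\<dots> = 2 * pi * L2_inner (nonlin (inv_ft g)) (inv_ft w)"
        unfolding V_def by (intro parseval nonlin_inv_ft_L2 inv_ft_hardy_L2 g w)
      finally show ?thesis .
    qed
    also have "mass g * (2 * pi * quad_inner qsym g w) + 2 * quad qsym g * (2 * pi * quad_inner (\<lambda>\<xi>. 1) g w)
        - 3 * quad qsym g * mass g * Re (2 * pi * L2_inner (nonlin (inv_ft g)) (inv_ft w))
      = 2 * pi * (mass g * quad_inner qsym g w + 2 * quad qsym g * quad_inner (\<lambda>\<xi>. 1) g w
        - 3 * quad qsym g * mass g * Re (L2_inner (nonlin (inv_ft g)) (inv_ft w)))"
      by (simp add: algebra_simps)
    also have "\<dots> = 0" using euler_lagrange_weak[OF g min w] by simp
    finally show "(LINT \<xi>|lborel. Re (D \<xi> * cnj (w \<xi>))) = 0" using integral_Re[OF iD] by simp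
  qed
  have "AE \<xi> in lborel. \<xi> \<in> {0..real n} \<longrightarrow> D \<xi> = 0" for n
  proof -
    \<comment> \<open>Bounded by 1 and compactly supported, hence in \<open>hardy\<close>, and a
      positive multiple of \<open>D\<close> on \<open>{0..real n}\<close>: the pairing integrates
      \<open>(cmod (D \<xi>))\<^sup>2 / (1 + cmod (D \<xi>))\<close> over this interval.\<close>
    define w where "w \<xi> = indicator {0..real n} \<xi> * (D \<xi> / of_real (1 + cmod (D \<xi>)))" for \<xi>
    have pos: "0 < 1 + cmod (D \<xi>)" for \<xi> using norm_ge_zero[of "D \<xi>"] by linarith
    have w1: "cmod (D \<xi> / of_real (1 + cmod (D \<xi>))) \<le> 1" for \<xi>
    proof -
      have "cmod (D \<xi> / of_real (1 + cmod (D \<xi>))) = cmod (D \<xi>) / (1 + cmod (D \<xi>))"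
        unfolding norm_divide norm_of_real abs_of_pos[OF pos] ..
      also have "\<dots> \<le> 1" using divide_le_eq_1_pos[OF pos] by simp
      finally show ?thesis .
    qed
    have wm: "w \<in> borel_measurable borel" unfolding w_def[abs_def] by measurable
    have "w \<in> L2"
    proof (rule L2_dominated[OF L2_indicator_Icc[of 0 "real n"], of _ 1])
      show "AE \<xi> in lborel. cmod (w \<xi>) \<le> 1 * cmod (indicator {0..real n} \<xi>)"
      proof (rule AE_I2)
        fix \<xi>
        show "cmod (w \<xi>) \<le> 1 * cmod (indicator {0..real n} \<xi>)"
          using mult_left_mono[OF w1[of \<xi>] norm_ge_zero[of "indicator {0..real n} \<xi> :: complex"]]
          unfolding w_def norm_mult by (simp only: mult_1_left mult_1_right)
      qed
    qed (use wm in simp)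
    moreover have "(\<lambda>\<xi>. of_real \<xi> * w \<xi>) \<in> L2"
    proof (rule L2_dominated[OF \<open>w \<in> L2\<close>, of _ "real n"])
      show "AE \<xi> in lborel. cmod (of_real \<xi> * w \<xi>) \<le> real n * cmod (w \<xi>)"
      proof (rule AE_I2)
        fix \<xi>
        show "cmod (of_real \<xi> * w \<xi>) \<le> real n * cmod (w \<xi>)"
        proof (cases "\<xi> \<in> {0..real n}")
          case True
          then show ?thesis unfolding norm_mult norm_of_real by (intro mult_right_mono) simp_all
        next
          case False
          then have "w \<xi> = 0" by (simp add: w_def)
          then show ?thesis by simp
        qed
      qed
    qed (use wm in simp)
    ultimately have w: "w \<in> hardy" by (simp add: hardy_def) (simp add: w_def)
    have Dw: "Re (D \<xi> * cnj (w \<xi>)) = indicator {0..real n} \<xi> * ((cmod (D \<xi>))\<^sup>2 / (1 + cmod (D \<xi>)))" for \<xi>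
    proof -
      have "D \<xi> * cnj (w \<xi>) = of_real (indicator {0..real n} \<xi> * ((cmod (D \<xi>))\<^sup>2 / (1 + cmod (D \<xi>))))"
        using complex_norm_square[of "D \<xi>"] by (simp add: w_def indicator_def)
      then show ?thesis by (simp only: Re_complex_of_real)
    qed
    have nn: "0 \<le> Re (D \<xi> * cnj (w \<xi>))" for \<xi>
      unfolding Dw by (rule mult_nonneg_nonneg[OF _ divide_nonneg_pos[OF _ pos]]) simp_all
    have "AE \<xi> in lborel. Re (D \<xi> * cnj (w \<xi>)) = 0"
      using integral_nonneg_eq_0_iff_AE[OF orth_int[OF w] AE_I2[OF nn]] orth[OF w] by simp
    then show ?thesis
    proof eventually_elim
      case (elim \<xi>)
      have "1 + cmod (D \<xi>) \<noteq> 0" using norm_ge_zero[of "D \<xi>"] by linarith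
      then show ?case using elim unfolding Dw by (auto simp: indicator_def)
    qed
  qed
  then have "AE \<xi> in lborel. \<forall>n. \<xi> \<in> {0..real n} \<longrightarrow> D \<xi> = 0" unfolding AE_all_countable by (rule allI)
  then show ?thesis
  proof eventually_elim
    case (elim \<xi>)
    obtain n :: nat where "\<xi> \<le> n" using real_arch_simple by blast
    then have "0 \<le> \<xi> \<Longrightarrow> D \<xi> = 0" using elim[rule_format, of n] by simp
    then show ?case by (simp add: D_def V_def)
  qed
qed

text \<open>The Euler-Lagrange equation is divided by \<open>M\<close>, and the remaining factor
  \<open>3 * q\<close> is absorbed into the amplitude, the nonlinearity being of degree five. This
  fixes the mass: its square is \<open>3 * q * M\<^sup>2 = 3 * act h\<close>, below
  \<open>3 * J\<close>.\<close>

lemma soliton_profile: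
  assumes J: "J > 0" "\<And>g. g \<in> hardy \<Longrightarrow> J * six g \<le> kin g * (mass g)\<^sup>2"
    and g0: "g0 \<in> hardy" "act g0 < J * six g0"
  obtains g \<omega> where "g \<in> hardy" "mass g > 0" "(mass g)\<^sup>2 < 3 * J"
    "AE \<xi> in lborel. 0 \<le> \<xi> \<longrightarrow> of_real (\<xi>\<^sup>2 - \<xi> + \<omega>) * g \<xi> = fourier (nonlin (inv_ft g)) \<xi>"
proof -
  obtain h where h: "h \<in> hardy" "six h = 1" "act h < J" "\<And>w. w \<in> hardy \<Longrightarrow> act h * six w \<le> act w"
    using hardy_minimiser[OF J g0] by blast
  define q where "q = quad qsym h"
  define M where "M = mass h"
  have "0 < J * 1" using J by simp
  then have "kin h * M\<^sup>2 > 0" using J(2)[OF h(1)] J(1) by (simp add: h(2) M_def)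
  then have M: "M > 0" using mass_nonneg[of h] by (cases "M = 0") (simp_all add: M_def)
  have q: "q > 0" using mass_le_ener[OF h(1)] ener_le_qsym[OF h(1)] M by (simp add: q_def M_def)
  define \<kappa> where "\<kappa> = root 4 (3 * q)"
  have \<kappa>: "\<kappa> > 0" "\<kappa> ^ 4 = 3 * q" using q by (simp_all add: \<kappa>_def)
  define g where "g = (\<lambda>\<xi>. of_real \<kappa> * h \<xi>)"
  \<comment> \<open>The constant 1 / 2 of \<open>qsym\<close> plus the multiplier
    \<open>2 * q / M\<close> that comes from varying the squared mass.\<close>
  define \<omega> where "\<omega> = 1 / 2 + 2 * q / M"
  have g: "g \<in> hardy" unfolding g_def by (rule hardy_cmult[OF h(1)])
  have mg: "mass g = \<kappa>\<^sup>2 * M" unfolding g_def quad_cmult by (simp add: M_def)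
  have "(mass g)\<^sup>2 = \<kappa> ^ 4 * M\<^sup>2" by (simp add: mg power_mult_distrib flip: power_mult)
  also have "\<dots> = 3 * act h" by (simp add: \<kappa>(2) act_def q_def M_def)
  finally have m2: "(mass g)\<^sup>2 < 3 * J" using h(3) by simp
  have nl: "nonlin (inv_ft g) = (\<lambda>x. of_real (\<kappa> ^ 5) * nonlin (inv_ft h) x)"
    using \<kappa>(1) by (simp add: fun_eq_iff nonlin_def g_def inv_ft_cmult norm_mult power_mult_distrib numeral_eq_Suc)
  have EL: "AE \<xi> in lborel. 0 \<le> \<xi> \<longrightarrow>
      of_real (mass h * qsym \<xi> + 2 * quad qsym h) * h \<xi> = of_real (3 * quad qsym h * mass h) * fourier (nonlin (inv_ft h)) \<xi>"
    by (rule euler_lagrange[OF h(1,2)]) (rule h(4))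
  have "AE \<xi> in lborel. 0 \<le> \<xi> \<longrightarrow> of_real (\<xi>\<^sup>2 - \<xi> + \<omega>) * g \<xi> = fourier (nonlin (inv_ft g)) \<xi>"
    using EL fourier_cmult[OF nonlin_inv_ft_L2[OF h(1)], of "of_real (\<kappa> ^ 5)"]
    unfolding nl
  proof eventually_elim
    case (elim \<xi>)
    show ?case
    proof
      assume "0 \<le> \<xi>"
      then have el: "of_real (M * qsym \<xi> + 2 * q) * h \<xi> = of_real (3 * q * M) * fourier (nonlin (inv_ft h)) \<xi>"
        using elim(1) by (simp only: q_def M_def)
      have "M * (\<xi>\<^sup>2 - \<xi> + \<omega>) = M * qsym \<xi> + 2 * q" using M by (simp add: \<omega>_def field_simps)
      then have "of_real M * (of_real (\<xi>\<^sup>2 - \<xi> + \<omega>) * g \<xi>) = of_real \<kappa> * (of_real (M * qsym \<xi> + 2 * q) * h \<xi>)"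
        unfolding g_def by (metis (no_types, lifting) of_real_mult mult.assoc mult.left_commute)
      also have "\<dots> = of_real M * (of_real (\<kappa> * \<kappa> ^ 4) * fourier (nonlin (inv_ft h)) \<xi>)"
        unfolding el \<kappa>(2) by (simp add: mult_ac)
      also have "\<kappa> * \<kappa> ^ 4 = \<kappa> ^ 5" by (simp add: numeral_eq_Suc)
      finally show "of_real (\<xi>\<^sup>2 - \<xi> + \<omega>) * g \<xi> = fourier (\<lambda>x. of_real (\<kappa> ^ 5) * nonlin (inv_ft h) x) \<xi>"
        using M elim(2) by simp
    qed
  qed
  moreover have "mass g > 0" using \<kappa> M by (simp add: mg)
  ultimately show thesis using that[OF g _ m2] by blast
qed

section \<open>Dilations\<close>

text \<open>The amplitude 1 / \<mu> makes the profile at \<open>x\<close> that of \<open>g\<close>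
  at \<open>\<mu> * x\<close>; large \<open>\<mu>\<close> concentrates in space and spreads in
  frequency.\<close>

definition dil :: "real \<Rightarrow> (real \<Rightarrow> complex) \<Rightarrow> real \<Rightarrow> complex" where
  "dil \<mu> g \<xi> = g (\<xi> / \<mu>) / of_real \<mu>"

lemma integral_dilate:
  fixes f :: "real \<Rightarrow> 'a::{banach,second_countable_topology}"
  assumes "\<mu> > 0"
  shows "(LINT x|lborel. f (x / \<mu>)) = \<mu> *\<^sub>R (LINT x|lborel. f x)"
  using lborel_integral_real_affine[of \<mu> "\<lambda>x. f (x / \<mu>)" 0] assms by simp

lemma dil_hardy:
  assumes g: "g \<in> hardy" and \<mu>: "\<mu> > 0"
  shows "dil \<mu> g \<in> hardy"
proof -
  have scale: "(\<lambda>\<xi>. f (\<xi> / \<mu>)) \<in> L2" if f: "f \<in> L2" for f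
  proof -
    have [measurable]: "f \<in> borel_measurable borel" using L2_measurable[OF f] by simp
    have "integrable lborel (\<lambda>\<xi>. (cmod (f (0 + 1 / \<mu> * \<xi>)))\<^sup>2)"
      by (rule lborel_integrable_real_affine[OF L2_integrable_power2[OF f]]) (use \<mu> in simp)
    then show ?thesis by (simp add: L2_def)
  qed
  have "dil \<mu> g = (\<lambda>\<xi>. (1 / of_real \<mu>) * g (\<xi> / \<mu>))" by (simp add: fun_eq_iff dil_def)
  then have "dil \<mu> g \<in> L2" by (simp only: L2_cmult[OF scale[OF hardy_L2(1)[OF g]]])
  moreover have "(\<lambda>\<xi>. of_real \<xi> * dil \<mu> g \<xi>) \<in> L2"
    using scale[OF hardy_L2(2)[OF g]] \<mu> by (simp add: dil_def)
  moreover have "dil \<mu> g \<xi> = 0" if "\<xi> < 0" for \<xi>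
    using g \<mu> that by (simp add: hardy_def dil_def divide_neg_pos)
  ultimately show ?thesis by (simp add: hardy_def)
qed

lemma quad_dil:
  assumes "\<mu> > 0"
  shows "quad b (dil \<mu> g) = quad (\<lambda>\<xi>. b (\<mu> * \<xi>)) g / \<mu>"
proof -
  have "(LINT \<xi>|lborel. b \<xi> * (cmod (dil \<mu> g \<xi>))\<^sup>2) = (LINT \<xi>|lborel. (\<lambda>\<eta>. b (\<mu> * \<eta>) * (cmod (g \<eta>))\<^sup>2 / \<mu>\<^sup>2) (\<xi> / \<mu>))"
    using assms by (simp add: dil_def norm_divide power_divide)
  also have "\<dots> = \<mu> *\<^sub>R (LINT \<eta>|lborel. b (\<mu> * \<eta>) * (cmod (g \<eta>))\<^sup>2 / \<mu>\<^sup>2)" by (rule integral_dilate[OF assms])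
  also have "\<dots> = (LINT \<eta>|lborel. b (\<mu> * \<eta>) * (cmod (g \<eta>))\<^sup>2) / \<mu>"
    using assms by (simp add: power2_eq_square)
  finally show ?thesis by (simp add: quad_def)
qed

lemma six_dil:
  assumes "\<mu> > 0"
  shows "six (dil \<mu> g) = six g / \<mu>"
proof -
  have "inv_ft (dil \<mu> g) x = inv_ft g (x * \<mu>)" for x
  proof -
    have "(LINT \<xi>|lborel. cis (x * \<xi>) * dil \<mu> g \<xi>) = (LINT \<xi>|lborel. (\<lambda>\<eta>. cis (x * \<mu> * \<eta>) * g \<eta> / of_real \<mu>) (\<xi> / \<mu>))"
      using assms by (simp add: dil_def)
    also have "\<dots> = \<mu> *\<^sub>R (LINT \<eta>|lborel. cis (x * \<mu> * \<eta>) * g \<eta> / of_real \<mu>)" by (rule integral_dilate[OF assms])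
    also have "\<dots> = (LINT \<eta>|lborel. cis (x * \<mu> * \<eta>) * g \<eta>)" using assms by (simp add: scaleR_conv_of_real)
    finally show ?thesis by (simp add: inv_ft_def)
  qed
  then have "six (dil \<mu> g) = (LINT x|lborel. (\<lambda>y. cmod (inv_ft g y) ^ 6) (x / (1 / \<mu>)))"
    by (simp add: six_def)
  also have "\<dots> = (1 / \<mu>) *\<^sub>R six g"
    unfolding six_def by (rule integral_dilate) (use assms in simp)
  finally show ?thesis by simp
qed

text \<open>Positivity of the symbol is asked at positive frequencies only: negative ones are absent
  and 0 is a null set. For the symbol \<open>\<xi>\<close> this is the positivity of the momentum,
  which fails for functions with negative frequencies.\<close>

lemma quad_pos:
  assumes g: "g \<in> hardy" and nz: "\<not> (AE \<xi> in lborel. g \<xi> = 0)"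
    and b: "b \<in> borel_measurable borel" "\<And>\<xi>. \<bar>b \<xi>\<bar> \<le> C * (1 + \<xi>\<^sup>2)" "\<And>\<xi>. \<xi> > 0 \<Longrightarrow> b \<xi> > 0"
  shows "0 < quad b g"
proof -
  have i: "integrable lborel (\<lambda>\<xi>. b \<xi> * (cmod (g \<xi>))\<^sup>2)" by (rule integrable_quad[OF g b(1,2)])
  have nn: "AE \<xi> in lborel. 0 \<le> b \<xi> * (cmod (g \<xi>))\<^sup>2"
    using AE_lborel_singleton[of 0]
  proof eventually_elim
    case (elim \<xi>)
    show ?case
    proof (cases "\<xi> < 0")
      case True
      then show ?thesis using g by (simp add: hardy_def)
    next
      case False
      then have "0 < b \<xi>" using elim b(3) by simp
      then show ?thesis by simp
    qed
  qed
  have "(LINT \<xi>|lborel. b \<xi> * (cmod (g \<xi>))\<^sup>2) \<noteq> 0"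
  proof
    assume "(LINT \<xi>|lborel. b \<xi> * (cmod (g \<xi>))\<^sup>2) = 0"
    then have "AE \<xi> in lborel. b \<xi> * (cmod (g \<xi>))\<^sup>2 = 0" using integral_nonneg_eq_0_iff_AE[OF i nn] by simp
    with AE_lborel_singleton[of 0] have "AE \<xi> in lborel. g \<xi> = 0"
    proof eventually_elim
      case (elim \<xi>)
      show ?case
      proof (cases "\<xi> < 0")
        case True
        then show ?thesis using g by (simp add: hardy_def)
      next
        case False
        then have "0 < b \<xi>" using elim b(3) by simp
        then show ?thesis using elim by simp
      qed
    qed
    with nz show False by simp
  qed
  moreover have "0 \<le> (LINT \<xi>|lborel. b \<xi> * (cmod (g \<xi>))\<^sup>2)" by (rule integral_nonneg_AE[OF nn])
  ultimately have "0 < (LINT \<xi>|lborel. b \<xi> * (cmod (g \<xi>))\<^sup>2)" by simp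
  then show ?thesis by (simp add: quad_def)
qed

lemma I2_inv_ft:
  assumes f: "f \<in> H1_plus" and g: "g \<in> hardy" "AE \<xi> in lborel. fourier f \<xi> = g \<xi>" "AE x in lborel. f x = inv_ft g x"
  shows "I2 f = kin g * (mass g)\<^sup>2 / six g" "(lp_norm 2 f)\<^sup>2 = mass g"
proof -
  have fH: "f \<in> H1" and fL: "f \<in> L2" using f by (simp_all add: H1_plus_def H1_iff)
  have [measurable]: "fourier f \<in> borel_measurable borel" "g \<in> borel_measurable borel" "f \<in> borel_measurable borel"
    "inv_ft g \<in> borel_measurable borel"
    using L2_measurable[OF fourier_L2[OF fL]] hardy_borel_measurable[OF g(1)] L2_measurable[OF fL] inv_ft_measurable_hardy[OF g(1)]
    by simp_all
  have k: "(lp_norm 2 (weak_deriv f))\<^sup>2 = kin g"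
    unfolding lp_norm_2_weak_deriv[OF fH] by (rule quad_cong_AE[OF g(2)]) simp_all
  show m: "(lp_norm 2 f)\<^sup>2 = mass g"
    unfolding lp_norm_2_fourier[OF fL] by (rule quad_cong_AE[OF g(2)]) simp_all
  have "(LINT x|lborel. cmod (f x) ^ 6) = six g"
    unfolding six_def by (rule integral_cong_AE) (use g(3) in auto)
  then have s: "lp_norm 6 f ^ 6 = six g"
    using six_nonneg[of g] by (simp add: lp_norm_def)
  have "lp_norm 2 f ^ 4 = (mass g)\<^sup>2" unfolding m[symmetric] by (simp flip: power_mult)
  then show "I2 f = kin g * (mass g)\<^sup>2 / six g" by (simp add: I2_def k s)
qed

lemma minimiser_consequences:
  assumes "is_arg_min I2 (\<lambda>f. f \<in> H1_plus_nonzero) Q"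
  shows "J2 > 0" "\<And>g. g \<in> hardy \<Longrightarrow> J2 * six g \<le> kin g * (mass g)\<^sup>2"
    "\<exists>g0\<in>hardy. act g0 < J2 * six g0"
proof -
  have Q: "Q \<in> H1_plus_nonzero" and Qmin: "\<And>f. f \<in> H1_plus_nonzero \<Longrightarrow> I2 Q \<le> I2 f"
    using assms by (auto simp: is_arg_min_linorder)
  have J2: "J2 = I2 Q"
    unfolding J2_def by (rule cInf_eq_minimum) (use Q Qmin in auto)
  have QH: "Q \<in> H1_plus" using Q by (simp add: H1_plus_nonzero_def)
  obtain g where g: "g \<in> hardy" "AE \<xi> in lborel. fourier Q \<xi> = g \<xi>" "AE x in lborel. Q x = inv_ft g x"
    by (rule H1_plus_representation[OF QH])
  have nz: "\<not> (AE \<xi> in lborel. g \<xi> = 0)"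
  proof
    assume "AE \<xi> in lborel. g \<xi> = 0"
    then have "inv_ft g x = 0" for x
    proof -
      have "(LINT \<xi>|lborel. cis (x * \<xi>) * g \<xi>) = (LINT \<xi>::real|lborel. 0)"
        by (rule integral_cong_AE) (use \<open>AE \<xi> in lborel. g \<xi> = 0\<close> hardy_borel_measurable[OF g(1)] in auto)
      then show ?thesis by (simp add: inv_ft_def)
    qed
    then have "AE x in lborel. Q x = 0" using g(3) by simp
    then show False using Q by (simp add: H1_plus_nonzero_def)
  qed
  have K: "kin g > 0" by (rule quad_pos[OF g(1) nz _ symbol_bounds(2)]) simp_all
  have P: "mom g > 0" by (rule quad_pos[OF g(1) nz _ symbol_bounds(3)]) simp_all
  have M: "mass g > 0" by (rule quad_pos[OF g(1) nz _ symbol_bounds(1)]) simp_all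
  have S: "six g > 0"
  proof (rule ccontr)
    assume "\<not> six g > 0"
    then have "six g = 0" using six_nonneg[of g] by simp
    then have "(LINT x|lborel. cmod (inv_ft g x) ^ 6) = 0" by (simp only: six_def)
    then have "AE x in lborel. cmod (inv_ft g x) ^ 6 = 0"
      using integral_nonneg_eq_0_iff_AE[OF integrable_six[OF g(1)]] by simp
    then have "AE x in lborel. Q x = 0" using g(3) by eventually_elim simp
    then show False using Q by (simp add: H1_plus_nonzero_def)
  qed
  have JQ: "J2 = kin g * (mass g)\<^sup>2 / six g" unfolding J2 by (rule I2_inv_ft(1)[OF QH g])
  show "J2 > 0" unfolding JQ using K M S by simp
  show "J2 * six w \<le> kin w * (mass w)\<^sup>2" if w: "w \<in> hardy" for w
  proof (cases "six w = 0")
    case True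
    then show ?thesis using kin_nonneg[of w] by simp
  next
    case False
    then have pos: "six w > 0" using six_nonneg[of w] by simp
    have "\<not> (AE x in lborel. inv_ft w x = 0)"
    proof
      assume "AE x in lborel. inv_ft w x = 0"
      then have "six w = (LINT x::real|lborel. 0)"
        unfolding six_def by (intro integral_cong_AE) (use inv_ft_measurable_hardy[OF w] in auto)
      then show False using pos by simp
    qed
    then have "inv_ft w \<in> H1_plus_nonzero" using inv_ft_H1_plus[OF w] by (simp add: H1_plus_nonzero_def)
    then have "J2 \<le> I2 (inv_ft w)" unfolding J2 by (rule Qmin)
    also have "\<dots> = kin w * (mass w)\<^sup>2 / six w"
      by (rule I2_inv_ft(1)[OF inv_ft_H1_plus[OF w] w fourier_inv_ft_hardy[OF w]]) simp
    finally show ?thesis using pos by (simp add: pos_le_divide_eq)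
  qed
  \<comment> \<open>After dilation by \<open>\<mu>\<close> the quotient of \<open>act\<close> and
    \<open>six\<close> has \<open>kin g - mom g / \<mu> + mass g / (2 * \<mu>\<^sup>2)\<close> where
    \<open>I2\<close> has \<open>kin g\<close>. This choice makes it smallest, the gain being
    \<open>(mom g)\<^sup>2 / (2 * mass g)\<close>.\<close>
  define \<mu> where "\<mu> = mass g / mom g"
  have \<mu>: "\<mu> > 0" using M P by (simp add: \<mu>_def)
  have P\<mu>: "\<mu> * mom g = mass g" using P by (simp add: \<mu>_def)
  have qd: "quad qsym (dil \<mu> g) = (\<mu>\<^sup>2 * kin g - \<mu> * mom g + mass g / 2) / \<mu>"
  proof -
    have "quad (\<lambda>\<xi>. 1 * (\<mu>\<^sup>2 * \<xi>\<^sup>2 + (- \<mu>) * \<xi>) + 1 / 2 * 1) g = 1 * quad (\<lambda>\<xi>. \<mu>\<^sup>2 * \<xi>\<^sup>2 + (- \<mu>) * \<xi>) g + 1 / 2 * mass g"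
    proof (rule quad_linear[OF g(1) _ _ _ symbol_bounds(1)])
      show "\<bar>\<mu>\<^sup>2 * \<xi>\<^sup>2 + (- \<mu>) * \<xi>\<bar> \<le> (\<mu>\<^sup>2 + \<mu>) * (1 + \<xi>\<^sup>2)" for \<xi>
      proof -
        have "\<bar>\<mu>\<^sup>2 * \<xi>\<^sup>2\<bar> \<le> \<mu>\<^sup>2 * (1 + \<xi>\<^sup>2)" "\<bar>(- \<mu>) * \<xi>\<bar> \<le> \<mu> * (1 + \<xi>\<^sup>2)"
          unfolding abs_mult using \<mu> abs_le_1_plus_power2[of \<xi>] by (intro mult_mono; simp)+
        then show ?thesis using order_trans[OF abs_triangle_ineq add_mono] by (simp only: distrib_right)
      qed
    qed simp_all
    also have "quad (\<lambda>\<xi>. \<mu>\<^sup>2 * \<xi>\<^sup>2 + (- \<mu>) * \<xi>) g = \<mu>\<^sup>2 * kin g + (- \<mu>) * mom g"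
      by (rule quad_linear[OF g(1) _ _ symbol_bounds(2) symbol_bounds(3)]) simp_all
    finally show ?thesis unfolding quad_dil[OF \<mu>] by (simp add: power_mult_distrib)
  qed
  have md: "mass (dil \<mu> g) = mass g / \<mu>" by (rule quad_dil[OF \<mu>])
  have "act (dil \<mu> g) = (\<mu>\<^sup>2 * kin g - mass g / 2) / \<mu> * (mass g / \<mu>)\<^sup>2"
    unfolding act_def qd md P\<mu> by simp
  also have "\<dots> < \<mu>\<^sup>2 * kin g / \<mu> * (mass g / \<mu>)\<^sup>2"
    using M \<mu> by (intro mult_strict_right_mono divide_strict_right_mono) simp_all
  also have "\<dots> = J2 * six (dil \<mu> g)"
    unfolding six_dil[OF \<mu>] JQ using S \<mu> by (simp add: power2_eq_square)
  finally show "\<exists>g0\<in>hardy. act g0 < J2 * six g0" using dil_hardy[OF g(1) \<mu>] by blast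
qed

section \<open>The travelling wave\<close>

lemma lp_norm_2_fourier_eq:
  assumes "f \<in> L2" "AE \<xi> in lborel. fourier f \<xi> = g \<xi>" "g \<in> borel_measurable borel"
  shows "lp_norm 2 g = sqrt (2 * pi) * lp_norm 2 f"
proof -
  have "(LINT \<xi>|lborel. (cmod (g \<xi>))\<^sup>2) = (LINT \<xi>|lborel. (cmod (fourier f \<xi>))\<^sup>2)"
    by (rule integral_cong_AE) (use assms L2_measurable[OF fourier_L2[OF assms(1)]] in auto)
  then show ?thesis using lp_norm_fourier[OF assms(1)] by (simp add: lp_norm_2)
qed

lemma H1_norm_inv_ft:
  assumes "g \<in> hardy"
  shows "H1_norm (inv_ft g) = sqrt (ener g)"
proof -
  have "fourier (inv_ft g) \<in> borel_measurable borel" using L2_measurable[OF fourier_L2[OF inv_ft_hardy_L2[OF assms]]] by simp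
  then have "(lp_norm 2 (weak_deriv (inv_ft g)))\<^sup>2 = kin g"
    using inv_ft_H1_plus[OF assms] hardy_borel_measurable[OF assms]
    by (subst lp_norm_2_weak_deriv) (auto simp: H1_plus_def intro!: quad_cong_AE fourier_inv_ft_hardy assms)
  moreover have "mass g + kin g = ener g"
    using quad_linear[OF assms _ _ symbol_bounds(1) symbol_bounds(2), of 1 1] by simp
  ultimately show ?thesis by (simp add: H1_norm_def lp_norm_2_inv_ft[OF assms])
qed

text \<open>Dominated convergence, a difference of two phases having modulus at most 2. It gives
  continuity in time of the wave with values in \<open>H1\<close>.\<close>

lemma ener_multiplier_tendsto:
  assumes g: "g \<in> hardy" and \<theta>: "\<theta> \<in> borel_measurable borel"
  shows "((\<lambda>s. ener (\<lambda>\<xi>. (cis (s * \<theta> \<xi>) - cis (t * \<theta> \<xi>)) * g \<xi>)) \<longlongrightarrow> 0) (at t)"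
  unfolding tendsto_at_iff_sequentially o_def
proof (intro allI impI)
  fix s assume "s \<longlonglongrightarrow> t"
  have [measurable]: "g \<in> borel_measurable borel" "\<theta> \<in> borel_measurable borel" using hardy_borel_measurable[OF g] \<theta> by simp_all
  let ?F = "\<lambda>n \<xi>. (1 + \<xi>\<^sup>2) * (cmod ((cis (s n * \<theta> \<xi>) - cis (t * \<theta> \<xi>)) * g \<xi>))\<^sup>2"
  have "(\<lambda>n. LINT \<xi>|lborel. ?F n \<xi>) \<longlonglongrightarrow> (LINT \<xi>::real|lborel. 0)"
  proof (rule integral_dominated_convergence)
    show "integrable lborel (\<lambda>\<xi>. 4 * ((1 + \<xi>\<^sup>2) * (cmod (g \<xi>))\<^sup>2))"
      by (intro integrable_mult_right integrable_quad[OF g _ symbol_bounds(4)]) simp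
    show "AE \<xi> in lborel. (\<lambda>n. ?F n \<xi>) \<longlonglongrightarrow> 0"
    proof (rule AE_I2)
      fix \<xi>
      have "(\<lambda>n. ?F n \<xi>) \<longlonglongrightarrow> (1 + \<xi>\<^sup>2) * (cmod ((cis (t * \<theta> \<xi>) - cis (t * \<theta> \<xi>)) * g \<xi>))\<^sup>2"
        by (intro tendsto_intros tendsto_cis \<open>s \<longlonglongrightarrow> t\<close>)
      then show "(\<lambda>n. ?F n \<xi>) \<longlonglongrightarrow> 0" by simp
    qed
    show "AE \<xi> in lborel. norm (?F n \<xi>) \<le> 4 * ((1 + \<xi>\<^sup>2) * (cmod (g \<xi>))\<^sup>2)" for n
    proof (rule AE_I2)
      fix \<xi>
      have "cmod (cis (s n * \<theta> \<xi>) - cis (t * \<theta> \<xi>)) \<le> 2"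
        using norm_triangle_ineq4[of "cis (s n * \<theta> \<xi>)" "cis (t * \<theta> \<xi>)"] by simp
      then have "(cmod (cis (s n * \<theta> \<xi>) - cis (t * \<theta> \<xi>)))\<^sup>2 \<le> 2\<^sup>2" by (rule power_mono) simp
      then have "(cmod (cis (s n * \<theta> \<xi>) - cis (t * \<theta> \<xi>)))\<^sup>2 * ((1 + \<xi>\<^sup>2) * (cmod (g \<xi>))\<^sup>2) \<le> 2\<^sup>2 * ((1 + \<xi>\<^sup>2) * (cmod (g \<xi>))\<^sup>2)"
        by (rule mult_right_mono) simp
      then show "norm (?F n \<xi>) \<le> 4 * ((1 + \<xi>\<^sup>2) * (cmod (g \<xi>))\<^sup>2)"
        by (simp add: norm_mult power_mult_distrib abs_mult mult_ac)
    qed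
  qed simp_all
  then have "(\<lambda>n. (LINT \<xi>|lborel. ?F n \<xi>) / (2 * pi)) \<longlonglongrightarrow> 0 / (2 * pi)" by (intro tendsto_divide tendsto_const) simp_all
  then show "(\<lambda>n. ener (\<lambda>\<xi>. (cis (s n * \<theta> \<xi>) - cis (t * \<theta> \<xi>)) * g \<xi>)) \<longlonglongrightarrow> 0" by (simp add: quad_def)
qed

lemma has_vector_derivative_quadratic:
  fixes f :: "real \<Rightarrow> 'a::real_normed_vector"
  assumes "\<And>s. norm (f s - f t - (s - t) *\<^sub>R D) \<le> C * (s - t)\<^sup>2"
  shows "(f has_vector_derivative D) (at t)"
  unfolding has_vector_derivative_def has_derivative_iff_norm
proof
  show "bounded_linear (\<lambda>x. x *\<^sub>R D)" by (rule bounded_linear_scaleR_left)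
  have ev: "\<forall>\<^sub>F s in at t. s \<noteq> t" by (simp add: eventually_at_filter)
  show "((\<lambda>s. norm (f s - f t - (s - t) *\<^sub>R D) / norm (s - t)) \<longlongrightarrow> 0) (at t)"
  proof (rule Lim_null_comparison)
    show "\<forall>\<^sub>F s in at t. norm (norm (f s - f t - (s - t) *\<^sub>R D) / norm (s - t)) \<le> C * \<bar>s - t\<bar>"
      using ev
    proof eventually_elim
      case (elim s)
      then have "\<bar>s - t\<bar> > 0" by auto
      moreover have "norm (f s - f t - (s - t) *\<^sub>R D) \<le> C * \<bar>s - t\<bar> * \<bar>s - t\<bar>"
        using assms[of s] by (simp add: power2_eq_square mult.assoc)
      ultimately show ?case by (simp add: pos_divide_le_eq)
    qed
    have "((\<lambda>s. C * \<bar>s - t\<bar>) \<longlongrightarrow> C * \<bar>t - t\<bar>) (at t)" by (intro tendsto_intros)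
    then show "((\<lambda>s. C * \<bar>s - t\<bar>) \<longlongrightarrow> 0) (at t)" by simp
  qed
qed

lemma cis_taylor: "cmod (cis (s * a) - cis (t * a) - (s - t) *\<^sub>R (\<i> * of_real a * cis (t * a))) \<le> (s - t)\<^sup>2 * a\<^sup>2"
proof -
  define y where "y = (s - t) * a"
  have "cmod (iexp y - (\<Sum>k\<le>1. (\<i> * y) ^ k / fact k)) \<le> \<bar>y\<bar> ^ Suc 1 / fact (Suc 1)" by (rule iexp_approx1)
  then have "cmod (cis y - (1 + \<i> * y)) \<le> y\<^sup>2 / 2" by (simp add: cis_conv_exp numeral_2_eq_2)
  also have "\<dots> \<le> y\<^sup>2" by simp
  finally have le: "cmod (cis y - (1 + \<i> * y)) \<le> y\<^sup>2" .
  have "cis (s * a) = cis (t * a) * cis y" by (simp add: cis_mult y_def algebra_simps)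
  then have "cis (s * a) - cis (t * a) - (s - t) *\<^sub>R (\<i> * of_real a * cis (t * a)) = cis (t * a) * (cis y - (1 + \<i> * y))"
    by (simp add: y_def scaleR_conv_of_real algebra_simps)
  then show ?thesis using le by (simp add: norm_mult y_def power_mult_distrib)
qed

text \<open>Differentiation under the integral sign by integrating a second-order Taylor bound,
  which is why two moments of \<open>\<theta>\<close> against \<open>G\<close> must be
  integrable.\<close>

lemma has_vector_derivative_oscillatory:
  fixes \<theta> :: "real \<Rightarrow> real" and G :: "real \<Rightarrow> complex"
  assumes [measurable]: "\<theta> \<in> borel_measurable borel"
    and G: "integrable lborel G" and G1: "integrable lborel (\<lambda>\<xi>. of_real (\<theta> \<xi>) * G \<xi>)"
    and G2: "integrable lborel (\<lambda>\<xi>. of_real ((\<theta> \<xi>)\<^sup>2) * G \<xi>)"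
  shows "((\<lambda>s. LINT \<xi>|lborel. cis (s * \<theta> \<xi>) * G \<xi>) has_vector_derivative
    (LINT \<xi>|lborel. \<i> * of_real (\<theta> \<xi>) * (cis (t * \<theta> \<xi>) * G \<xi>))) (at t)"
proof (rule has_vector_derivative_quadratic)
  fix s
  have i: "integrable lborel (\<lambda>\<xi>. cis (u * \<theta> \<xi>) * G \<xi>)" for u by (rule integrable_cis_mult[OF G]) simp
  have "integrable lborel (\<lambda>\<xi>. \<i> * (cis (t * \<theta> \<xi>) * (of_real (\<theta> \<xi>) * G \<xi>)))"
    by (intro integrable_mult_right integrable_cis_mult[OF G1]) simp
  then have i1: "integrable lborel (\<lambda>\<xi>. \<i> * of_real (\<theta> \<xi>) * (cis (t * \<theta> \<xi>) * G \<xi>))" by (simp add: mult_ac)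
  have eq: "(LINT \<xi>|lborel. cis (s * \<theta> \<xi>) * G \<xi>) - (LINT \<xi>|lborel. cis (t * \<theta> \<xi>) * G \<xi>)
      - (s - t) *\<^sub>R (LINT \<xi>|lborel. \<i> * of_real (\<theta> \<xi>) * (cis (t * \<theta> \<xi>) * G \<xi>))
      = (LINT \<xi>|lborel. (cis (s * \<theta> \<xi>) - cis (t * \<theta> \<xi>) - (s - t) *\<^sub>R (\<i> * of_real (\<theta> \<xi>) * cis (t * \<theta> \<xi>))) * G \<xi>)"
  proof -
    have "(LINT \<xi>|lborel. (cis (s * \<theta> \<xi>) - cis (t * \<theta> \<xi>) - (s - t) *\<^sub>R (\<i> * of_real (\<theta> \<xi>) * cis (t * \<theta> \<xi>))) * G \<xi>)
        = (LINT \<xi>|lborel. cis (s * \<theta> \<xi>) * G \<xi> - cis (t * \<theta> \<xi>) * G \<xi> - (s - t) *\<^sub>R (\<i> * of_real (\<theta> \<xi>) * (cis (t * \<theta> \<xi>) * G \<xi>)))"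
      by (intro Bochner_Integration.integral_cong refl) (simp add: scaleR_conv_of_real algebra_simps)
    then show ?thesis using i i1 by simp
  qed
  have "norm (LINT \<xi>|lborel. (cis (s * \<theta> \<xi>) - cis (t * \<theta> \<xi>) - (s - t) *\<^sub>R (\<i> * of_real (\<theta> \<xi>) * cis (t * \<theta> \<xi>))) * G \<xi>)
      \<le> (LINT \<xi>|lborel. (s - t)\<^sup>2 * cmod (of_real ((\<theta> \<xi>)\<^sup>2) * G \<xi>))"
  proof (rule Bochner_Integration.integral_norm_bound_integral)
    have "integrable lborel (\<lambda>\<xi>. cis (s * \<theta> \<xi>) * G \<xi> - cis (t * \<theta> \<xi>) * G \<xi> - (s - t) *\<^sub>R (\<i> * of_real (\<theta> \<xi>) * (cis (t * \<theta> \<xi>) * G \<xi>)))"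
      using i i1 by simp
    then show "integrable lborel (\<lambda>\<xi>. (cis (s * \<theta> \<xi>) - cis (t * \<theta> \<xi>) - (s - t) *\<^sub>R (\<i> * of_real (\<theta> \<xi>) * cis (t * \<theta> \<xi>))) * G \<xi>)"
      by (simp add: scaleR_conv_of_real algebra_simps)
    show "integrable lborel (\<lambda>\<xi>. (s - t)\<^sup>2 * cmod (of_real ((\<theta> \<xi>)\<^sup>2) * G \<xi>))"
      by (intro integrable_mult_right integrable_norm G2)
    fix \<xi>
    show "norm ((cis (s * \<theta> \<xi>) - cis (t * \<theta> \<xi>) - (s - t) *\<^sub>R (\<i> * of_real (\<theta> \<xi>) * cis (t * \<theta> \<xi>))) * G \<xi>)
        \<le> (s - t)\<^sup>2 * cmod (of_real ((\<theta> \<xi>)\<^sup>2) * G \<xi>)"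
      using mult_right_mono[OF cis_taylor[of s "\<theta> \<xi>" t] norm_ge_zero[of "G \<xi>"]]
      unfolding norm_mult norm_of_real abs_power2 by (simp only: mult.assoc)
  qed
  also have "\<dots> = (LINT \<xi>|lborel. cmod (of_real ((\<theta> \<xi>)\<^sup>2) * G \<xi>)) * (s - t)\<^sup>2" by simp
  finally show "norm ((LINT \<xi>|lborel. cis (s * \<theta> \<xi>) * G \<xi>) - (LINT \<xi>|lborel. cis (t * \<theta> \<xi>) * G \<xi>)
      - (s - t) *\<^sub>R (LINT \<xi>|lborel. \<i> * of_real (\<theta> \<xi>) * (cis (t * \<theta> \<xi>) * G \<xi>)))
      \<le> (LINT \<xi>|lborel. cmod (of_real ((\<theta> \<xi>)\<^sup>2) * G \<xi>)) * (s - t)\<^sup>2"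
    unfolding eq .
qed

text \<open>In Fourier variables the wave is \<open>exp(it(\<omega> - \<xi>)) g(\<xi>)\<close>, i.e. \<open>exp(i\<omega>t) f(x - t)\<close> with profile \<open>f = inv_ft g\<close>.\<close>
definition wave :: "real \<Rightarrow> (real \<Rightarrow> complex) \<Rightarrow> real \<Rightarrow> real \<Rightarrow> complex" where
  "wave \<omega> g t = inv_ft (\<lambda>\<xi>. cis (t * (\<omega> - \<xi>)) * g \<xi>)"

lemma wave_hardy: "g \<in> hardy \<Longrightarrow> (\<lambda>\<xi>. cis (t * (\<omega> - \<xi>)) * g \<xi>) \<in> hardy"
  by (rule hardy_mult_bounded[of _ _ 1]) simp_all

lemma wave_eq: "wave \<omega> g t x = cis (t * \<omega>) * inv_ft g (x - t)"
proof -
  have "(LINT \<xi>|lborel. cis (x * \<xi>) * (cis (t * (\<omega> - \<xi>)) * g \<xi>)) = (LINT \<xi>|lborel. cis (t * \<omega>) * (cis ((x - t) * \<xi>) * g \<xi>))"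
    by (intro Bochner_Integration.integral_cong refl) (simp add: mult.assoc[symmetric] cis_mult algebra_simps)
  then show ?thesis by (simp add: wave_def inv_ft_def)
qed

text \<open>The nonlinearity commutes with translations and constant phases, and so does the
  projector. At negative frequencies both sides are 0, so the profile equation enters on the
  half-line only.\<close>

lemma fourier_nonlin_wave:
  assumes g: "g \<in> hardy" and el: "AE \<xi> in lborel. 0 \<le> \<xi> \<longrightarrow> of_real (\<xi>\<^sup>2 - \<xi> + \<omega>) * g \<xi> = fourier (nonlin (inv_ft g)) \<xi>"
  shows "AE \<xi> in lborel. fourier (szego (nonlin (wave \<omega> g t))) \<xi> = of_real (\<xi>\<^sup>2 - \<xi> + \<omega>) * (cis (t * (\<omega> - \<xi>)) * g \<xi>)"
proof -
  have V: "nonlin (inv_ft g) \<in> L2" by (rule nonlin_inv_ft_L2[OF g])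
  have nw: "nonlin (wave \<omega> g t) = (\<lambda>x. cis (t * \<omega>) * nonlin (inv_ft g) (x - t))"
    by (simp add: fun_eq_iff nonlin_def wave_eq norm_mult mult.left_commute)
  have wL: "nonlin (wave \<omega> g t) \<in> L2" unfolding nw by (intro L2_cmult L2_translate V)
  show ?thesis
    using fourier_szego[OF wL] fourier_cmult[OF L2_translate(1)[OF V, of t], of "cis (t * \<omega>)"] fourier_translate[OF V, of t] el
    unfolding nw
  proof eventually_elim
    case (elim \<xi>)
    show ?case
    proof (cases "\<xi> < 0")
      case True
      then show ?thesis using g unfolding elim(1) by (simp add: nonneg_part_def hardy_def)
    next
      case False
      have "cis (t * \<omega>) * cis (- (t * \<xi>)) = cis (t * (\<omega> - \<xi>))" by (simp add: cis_mult algebra_simps)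
      then show ?thesis using False elim
        by (simp add: nonneg_part_def mult_ac flip: \<open>cis (t * \<omega>) * cis (- (t * \<xi>)) = cis (t * (\<omega> - \<xi>))\<close>)
    qed
  qed
qed

text \<open>On the Fourier side the time derivative multiplies by
  \<open>\<i> * (\<omega> - \<xi>)\<close> and the second space derivative by
  \<open>- \<xi>\<^sup>2\<close>. The left-hand side of the equation thus has the symbol
  \<open>- (\<xi>\<^sup>2 - \<xi> + \<omega>)\<close>, the negative of the one in the profile
  equation.\<close>

lemma wave_global_solution:
  assumes g: "g \<in> hardy" and el: "AE \<xi> in lborel. 0 \<le> \<xi> \<longrightarrow> of_real (\<xi>\<^sup>2 - \<xi> + \<omega>) * g \<xi> = fourier (nonlin (inv_ft g)) \<xi>"
  shows "global_solution (wave \<omega> g)"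
  unfolding global_solution_def
proof (intro conjI allI impI)
  note h = wave_hardy[OF g, of _ \<omega>]
  show "wave \<omega> g t \<in> H1_plus" for t unfolding wave_def by (rule inv_ft_H1_plus[OF h])
  have wL: "wave \<omega> g t \<in> L2" for t unfolding wave_def by (rule inv_ft_hardy_L2[OF h])
  have Fw: "AE \<xi> in lborel. fourier (wave \<omega> g t) \<xi> = cis (t * (\<omega> - \<xi>)) * g \<xi>" for t
    unfolding wave_def by (rule fourier_inv_ft_hardy[OF h])
  have [measurable]: "g \<in> borel_measurable borel" by (rule hardy_borel_measurable[OF g])
  show "((\<lambda>s. H1_norm (\<lambda>x. wave \<omega> g s x - wave \<omega> g t x)) \<longlongrightarrow> 0) (at t)" for t
  proof -
    have "H1_norm (\<lambda>x. wave \<omega> g s x - wave \<omega> g t x) = sqrt (ener (\<lambda>\<xi>. (cis (s * (\<omega> - \<xi>)) - cis (t * (\<omega> - \<xi>))) * g \<xi>))" for s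
    proof -
      let ?d = "\<lambda>\<xi>. (cis (s * (\<omega> - \<xi>)) - cis (t * (\<omega> - \<xi>))) * g \<xi>"
      have dh: "?d \<in> hardy" using hardy_diff[OF h h, of s t] by (simp add: left_diff_distrib)
      have "wave \<omega> g s x = wave \<omega> g t x + inv_ft ?d x" for x
        unfolding wave_def inv_ft_add[OF h dh, symmetric] by (simp add: algebra_simps)
      then have "(\<lambda>x. wave \<omega> g s x - wave \<omega> g t x) = inv_ft ?d" by (simp add: fun_eq_iff)
      then show ?thesis by (simp add: H1_norm_inv_ft[OF dh])
    qed
    moreover have "((\<lambda>s. sqrt (ener (\<lambda>\<xi>. (cis (s * (\<omega> - \<xi>)) - cis (t * (\<omega> - \<xi>))) * g \<xi>))) \<longlongrightarrow> sqrt 0) (at t)"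
      by (intro tendsto_real_sqrt ener_multiplier_tendsto g) simp
    ultimately show ?thesis by simp
  qed
  fix \<phi> t assume \<phi>: "test_function \<phi>"
  note \<phi>' = test_function_deriv[OF \<phi>] note \<phi>'' = test_function_deriv[OF \<phi>']
  define p where "p = fourier (\<lambda>x. complex_of_real (\<phi> x))"
  define p' where "p' = fourier (\<lambda>x. complex_of_real (deriv \<phi> x))"
  define p'' where "p'' = fourier (\<lambda>x. complex_of_real (deriv (deriv \<phi>) x))"
  have pL: "p \<in> L2" "p' \<in> L2" "p'' \<in> L2"
    unfolding p_def p'_def p''_def by (intro fourier_L2 test_function_L2 \<phi> \<phi>' \<phi>'')+
  have pm [measurable]: "p \<in> borel_measurable borel" "p' \<in> borel_measurable borel" "p'' \<in> borel_measurable borel"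
    using pL[THEN L2_measurable] by simp_all
  have pd: "AE \<xi> in lborel. p' \<xi> = \<i> * \<xi> * p \<xi>" "AE \<xi> in lborel. p'' \<xi> = - of_real (\<xi>\<^sup>2) * p \<xi>"
  proof -
    show A: "AE \<xi> in lborel. p' \<xi> = \<i> * \<xi> * p \<xi>" unfolding p_def p'_def by (rule fourier_deriv_test_function[OF \<phi>])
    have "AE \<xi> in lborel. p'' \<xi> = \<i> * \<xi> * p' \<xi>" unfolding p''_def p'_def by (rule fourier_deriv_test_function[OF \<phi>'])
    with A show "AE \<xi> in lborel. p'' \<xi> = - of_real (\<xi>\<^sup>2) * p \<xi>"
    proof eventually_elim
      case (elim \<xi>)
      have "\<i> * \<xi> * (\<i> * \<xi> * p \<xi>) = (\<i> * \<i>) * (of_real \<xi> * of_real \<xi>) * p \<xi>" by (simp only: mult_ac)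
      then show ?case unfolding elim by (simp add: power2_eq_square)
    qed
  qed
  define \<theta> where "\<theta> \<xi> = \<omega> - \<xi>" for \<xi> :: real
  define G where "G \<xi> = g \<xi> * cnj (p \<xi>)" for \<xi>
  have \<theta>m [measurable]: "\<theta> \<in> borel_measurable borel" unfolding \<theta>_def[abs_def] by measurable
  have Gm [measurable]: "G \<in> borel_measurable borel" unfolding G_def[abs_def] by measurable
  have iG: "integrable lborel G" unfolding G_def by (intro L2_integrable_mult_cnj hardy_L2 g pL)
  have iG1: "integrable lborel (\<lambda>\<xi>. of_real \<xi> * G \<xi>)"
    using L2_integrable_mult_cnj[OF hardy_L2(2)[OF g] pL(1)] by (simp add: G_def mult.assoc)
  \<comment> \<open>Membership in \<open>hardy\<close> provides one power of \<open>\<xi>\<close>;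
    the second moment is obtained by letting the second derivative fall on the test
    function.\<close>
  have iG2: "integrable lborel (\<lambda>\<xi>. of_real (\<xi>\<^sup>2) * G \<xi>)"
  proof -
    have "AE \<xi> in lborel. - (g \<xi> * cnj (p'' \<xi>)) = of_real (\<xi>\<^sup>2) * G \<xi>"
      using pd(2) by eventually_elim (simp add: G_def)
    moreover have "integrable lborel (\<lambda>\<xi>. - (g \<xi> * cnj (p'' \<xi>)))"
      by (intro Bochner_Integration.integrable_minus L2_integrable_mult_cnj hardy_L2 g pL)
    moreover have "(\<lambda>\<xi>. of_real (\<xi>\<^sup>2) * G \<xi>) \<in> borel_measurable lborel" by measurable
    ultimately show ?thesis by (rule integrable_cong_AE_imp[rotated 2])
  qed
  have i\<theta>: "integrable lborel (\<lambda>\<xi>. of_real (\<theta> \<xi>) * G \<xi>)"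
  proof -
    have "integrable lborel (\<lambda>\<xi>. of_real \<omega> * G \<xi> - of_real \<xi> * G \<xi>)" using iG iG1 by simp
    then show ?thesis by (simp add: \<theta>_def algebra_simps)
  qed
  have i\<theta>2: "integrable lborel (\<lambda>\<xi>. of_real ((\<theta> \<xi>)\<^sup>2) * G \<xi>)"
  proof -
    have "integrable lborel (\<lambda>\<xi>. of_real (\<omega>\<^sup>2) * G \<xi> - of_real (2 * \<omega>) * (of_real \<xi> * G \<xi>) + of_real (\<xi>\<^sup>2) * G \<xi>)"
      by (intro Bochner_Integration.integrable_add Bochner_Integration.integrable_diff integrable_mult_right iG iG1 iG2)
    then show ?thesis by (simp add: \<theta>_def power2_eq_square algebra_simps)
  qed
  \<comment> \<open>Parseval's identity with both transforms replaced by explicit functions that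
    equal them almost everywhere.\<close>
  have pair: "(LINT x|lborel. f x * of_real (\<psi> x)) = (LINT \<xi>|lborel. F \<xi> * cnj (P \<xi>)) / (2 * pi)"
    if "f \<in> L2" "test_function \<psi>" "AE \<xi> in lborel. fourier f \<xi> = F \<xi>" "AE \<xi> in lborel. fourier (\<lambda>x. complex_of_real (\<psi> x)) \<xi> = P \<xi>"
      "F \<in> borel_measurable borel" "P \<in> borel_measurable borel" for f \<psi> F P
  proof -
    have "L2_inner (fourier f) (fourier (\<lambda>x. complex_of_real (\<psi> x))) = (LINT \<xi>|lborel. F \<xi> * cnj (P \<xi>))"
      unfolding L2_inner_def
    proof (rule integral_cong_AE)
      show "AE \<xi> in lborel. fourier f \<xi> * cnj (fourier (\<lambda>x. complex_of_real (\<psi> x)) \<xi>) = F \<xi> * cnj (P \<xi>)"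
        using that(3,4) by eventually_elim simp
    qed (use that L2_measurable[OF fourier_L2[OF that(1)]] L2_measurable[OF fourier_L2[OF test_function_L2[OF that(2)]]] in simp_all)
    then show ?thesis using integral_mult_test_function[OF that(1,2)] by simp
  qed
  define D0 where "D0 = (LINT \<xi>|lborel. \<i> * of_real (\<theta> \<xi>) * (cis (t * \<theta> \<xi>) * G \<xi>))"
  have us: "(LINT x|lborel. wave \<omega> g s x * of_real (\<phi> x)) = (LINT \<xi>|lborel. cis (s * \<theta> \<xi>) * G \<xi>) / (2 * pi)" for s
  proof -
    have "(LINT x|lborel. wave \<omega> g s x * of_real (\<phi> x)) = (LINT \<xi>|lborel. (cis (s * (\<omega> - \<xi>)) * g \<xi>) * cnj (p \<xi>)) / (2 * pi)"
      by (rule pair[OF wL \<phi> Fw]) (simp_all add: p_def[symmetric])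
    then show ?thesis by (simp add: G_def \<theta>_def mult.assoc)
  qed
  have "((\<lambda>s. (LINT \<xi>|lborel. cis (s * \<theta> \<xi>) * G \<xi>) / (2 * pi)) has_vector_derivative D0 / (2 * pi)) (at t)"
    unfolding D0_def
    by (intro has_vector_derivative_divide has_vector_derivative_oscillatory \<theta>m iG i\<theta> i\<theta>2)
  then have deriv: "((\<lambda>s. LINT x|lborel. wave \<omega> g s x * of_real (\<phi> x)) has_vector_derivative D0 / (2 * pi)) (at t)"
    by (simp add: us)
  have u2: "(LINT x|lborel. wave \<omega> g t x * of_real (deriv (deriv \<phi>) x)) = (LINT \<xi>|lborel. - (of_real (\<xi>\<^sup>2) * (cis (t * \<theta> \<xi>) * G \<xi>))) / (2 * pi)"
  proof -
    have "(LINT x|lborel. wave \<omega> g t x * of_real (deriv (deriv \<phi>) x)) = (LINT \<xi>|lborel. (cis (t * (\<omega> - \<xi>)) * g \<xi>) * cnj (- of_real (\<xi>\<^sup>2) * p \<xi>)) / (2 * pi)"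
      by (rule pair[OF wL \<phi>'' Fw]) (use pd(2) in \<open>simp_all add: p''_def\<close>)
    then show ?thesis by (simp add: G_def \<theta>_def mult_ac)
  qed
  have nL: "nonlin (wave \<omega> g t) \<in> L2" unfolding wave_def by (rule nonlin_inv_ft_L2[OF h])
  have u3: "(LINT x|lborel. szego (\<lambda>y. of_real (cmod (wave \<omega> g t y) ^ 4) * wave \<omega> g t y) x * of_real (\<phi> x))
      = (LINT \<xi>|lborel. of_real (\<xi>\<^sup>2 - \<xi> + \<omega>) * (cis (t * \<theta> \<xi>) * G \<xi>)) / (2 * pi)"
  proof -
    have "(LINT x|lborel. szego (nonlin (wave \<omega> g t)) x * of_real (\<phi> x))
        = (LINT \<xi>|lborel. (of_real (\<xi>\<^sup>2 - \<xi> + \<omega>) * (cis (t * (\<omega> - \<xi>)) * g \<xi>)) * cnj (p \<xi>)) / (2 * pi)"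
      by (rule pair[OF szego_L2[OF nL] \<phi> fourier_nonlin_wave[OF g el]]) (simp_all add: p_def[symmetric])
    then show ?thesis by (simp add: nonlin_def[abs_def] G_def \<theta>_def mult.assoc)
  qed
  have icG: "integrable lborel (\<lambda>\<xi>. \<i> * of_real (\<theta> \<xi>) * (cis (t * \<theta> \<xi>) * G \<xi>))"
  proof -
    have "integrable lborel (\<lambda>\<xi>. \<i> * (cis (t * \<theta> \<xi>) * (of_real (\<theta> \<xi>) * G \<xi>)))"
      by (intro integrable_mult_right integrable_cis_mult i\<theta>) simp
    then show ?thesis by (simp add: mult_ac)
  qed
  have icG2: "integrable lborel (\<lambda>\<xi>. - (of_real (\<xi>\<^sup>2) * (cis (t * \<theta> \<xi>) * G \<xi>)))"
  proof -
    have "integrable lborel (\<lambda>\<xi>. - (cis (t * \<theta> \<xi>) * (of_real (\<xi>\<^sup>2) * G \<xi>)))"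
      by (intro Bochner_Integration.integrable_minus integrable_cis_mult iG2) simp
    then show ?thesis by (simp add: mult_ac)
  qed
  have "\<i> * D0 + (LINT \<xi>|lborel. - (of_real (\<xi>\<^sup>2) * (cis (t * \<theta> \<xi>) * G \<xi>)))
      = (LINT \<xi>|lborel. \<i> * (\<i> * of_real (\<theta> \<xi>) * (cis (t * \<theta> \<xi>) * G \<xi>)) + - (of_real (\<xi>\<^sup>2) * (cis (t * \<theta> \<xi>) * G \<xi>)))"
    unfolding D0_def using icG icG2 by simp
  also have "\<dots> = (LINT \<xi>|lborel. - (of_real (\<xi>\<^sup>2 - \<xi> + \<omega>) * (cis (t * \<theta> \<xi>) * G \<xi>)))"
    by (intro Bochner_Integration.integral_cong refl) (simp add: \<theta>_def mult.assoc[symmetric], simp add: algebra_simps)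
  also have "\<dots> = - (LINT \<xi>|lborel. of_real (\<xi>\<^sup>2 - \<xi> + \<omega>) * (cis (t * \<theta> \<xi>) * G \<xi>))" by simp
  finally have key: "\<i> * D0 + (LINT \<xi>|lborel. - (of_real (\<xi>\<^sup>2) * (cis (t * \<theta> \<xi>) * G \<xi>)))
      = - (LINT \<xi>|lborel. of_real (\<xi>\<^sup>2 - \<xi> + \<omega>) * (cis (t * \<theta> \<xi>) * G \<xi>))" .
  have arith: "\<i> * D + I = - K \<Longrightarrow> \<i> * (D / c) + I / c = - (K / c)" for D I K c :: complex
    by (simp add: add_divide_distrib[symmetric])
  show "\<exists>D. ((\<lambda>s. LINT x|lborel. wave \<omega> g s x * of_real (\<phi> x)) has_vector_derivative D) (at t) \<and>
             \<i> * D + (LINT x|lborel. wave \<omega> g t x * of_real (deriv (deriv \<phi>) x)) =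
             - (LINT x|lborel. szego (\<lambda>y. of_real (cmod (wave \<omega> g t y) ^ 4) * wave \<omega> g t y) x * of_real (\<phi> x))"
  proof (intro exI conjI)
    show "((\<lambda>s. LINT x|lborel. wave \<omega> g s x * of_real (\<phi> x)) has_vector_derivative D0 / (2 * pi)) (at t)" by (rule deriv)
    show "\<i> * (D0 / (2 * pi)) + (LINT x|lborel. wave \<omega> g t x * of_real (deriv (deriv \<phi>) x)) =
        - (LINT x|lborel. szego (\<lambda>y. of_real (cmod (wave \<omega> g t y) ^ 4) * wave \<omega> g t y) x * of_real (\<phi> x))"
      unfolding u2 u3 by (rule arith[OF key])
  qed
qed

lemma
  assumes v: "v \<in> L2"
  shows free_schroedinger_L2: "free_schroedinger t v \<in> L2"
    and fourier_free_schroedinger: "AE \<xi> in lborel. fourier (free_schroedinger t v) \<xi> = cis (- (t * \<xi>\<^sup>2)) * fourier v \<xi>"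
proof -
  have mL: "(\<lambda>\<xi>. cis (- (t * \<xi>\<^sup>2)) * fourier v \<xi>) \<in> L2"
    by (rule L2_mult_bounded[OF fourier_L2[OF v], of _ 1]) simp_all
  have "free_schroedinger t v \<in> L2 \<and> (AE \<xi> in lborel. fourier (free_schroedinger t v) \<xi> = cis (- (t * \<xi>\<^sup>2)) * fourier v \<xi>)"
    unfolding free_schroedinger_def
    using someI_ex[of "\<lambda>h. h \<in> L2 \<and> (AE \<xi> in lborel. fourier h \<xi> = cis (- (t * \<xi>\<^sup>2)) * fourier v \<xi>)"]
      inv_fourier_L2[OF mL] fourier_inv_fourier[OF mL] by blast
  then show "free_schroedinger t v \<in> L2" "AE \<xi> in lborel. fourier (free_schroedinger t v) \<xi> = cis (- (t * \<xi>\<^sup>2)) * fourier v \<xi>"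
    by blast+
qed

text \<open>For each integer multiple of \<open>2 * pi\<close> the exceptional frequencies are roots
  of a quadratic polynomial, so altogether they are countable.\<close>

lemma AE_cis_quadratic_neq_1: "AE \<xi> in lborel. cis (\<xi>\<^sup>2 - \<xi> + \<omega>) \<noteq> 1"
proof -
  have "finite {\<xi>::real. \<xi>\<^sup>2 - \<xi> + \<omega> = 2 * pi * of_int n}" for n
  proof -
    have "{\<xi>::real. \<xi>\<^sup>2 - \<xi> + \<omega> = 2 * pi * of_int n} = {\<xi>. poly [:\<omega> - 2 * pi * of_int n, -1, 1:] \<xi> = 0}"
      by (auto simp: power2_eq_square algebra_simps)
    moreover have "finite {\<xi>. poly [:\<omega> - 2 * pi * of_int n, -1, 1:] \<xi> = 0}" by (rule poly_roots_finite) simp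
    ultimately show ?thesis by (rule ssubst)
  qed
  then have "countable (\<Union>n::int. {\<xi>::real. \<xi>\<^sup>2 - \<xi> + \<omega> = 2 * pi * of_int n})"
    by (intro countable_UN) (simp_all add: countable_finite)
  then have "(\<Union>n::int. {\<xi>::real. \<xi>\<^sup>2 - \<xi> + \<omega> = 2 * pi * of_int n}) \<in> null_sets lborel"
    by (rule countable_imp_null_set_lborel)
  then have "AE \<xi> in lborel. \<xi> \<notin> (\<Union>n::int. {\<xi>::real. \<xi>\<^sup>2 - \<xi> + \<omega> = 2 * pi * of_int n})" by (rule AE_not_in)
  then show ?thesis
  proof eventually_elim
    case (elim \<xi>)
    show ?case
    proof
      assume "cis (\<xi>\<^sup>2 - \<xi> + \<omega>) = 1"
      then have "cos (\<xi>\<^sup>2 - \<xi> + \<omega>) = 1" by (simp add: complex_eq_iff)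
      then obtain n :: int where "\<xi>\<^sup>2 - \<xi> + \<omega> = of_int n * 2 * pi" using cos_one_2pi_int by blast
      then show False using elim by (auto simp: mult_ac)
    qed
  qed
qed

text \<open>If the wave approached a free solution, \<open>exp(it(\<xi>\<^sup>2 - \<xi> + \<omega>)) g\<close> would converge in \<open>L\<^sup>2\<close>; comparing times
  \<open>t\<close> and \<open>t + 1\<close> then forces \<open>(exp(i(\<xi>\<^sup>2 - \<xi> + \<omega>)) - 1) g = 0\<close>.\<close>
lemma wave_not_scattering:
  assumes g: "g \<in> hardy" and v: "v \<in> L2" and F: "F \<noteq> bot" and shift: "filterlim (\<lambda>t::real. t + 1) F F"
    and lim: "((\<lambda>t. lp_norm 2 (\<lambda>x. free_schroedinger t v x - wave \<omega> g t x)) \<longlongrightarrow> 0) F"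
  shows "mass g = 0"
proof -
  define \<psi> where "\<psi> \<xi> = \<xi>\<^sup>2 - \<xi> + \<omega>" for \<xi> :: real
  have [measurable]: "\<psi> \<in> borel_measurable borel" unfolding \<psi>_def[abs_def] by measurable
  have [measurable]: "g \<in> borel_measurable borel" by (rule hardy_borel_measurable[OF g])
  have vh: "fourier v \<in> L2" by (rule fourier_L2[OF v])
  have [measurable]: "fourier v \<in> borel_measurable borel" using L2_measurable[OF vh] by simp
  have wL: "wave \<omega> g t \<in> L2" for t unfolding wave_def by (rule inv_ft_hardy_L2[OF wave_hardy[OF g]])
  have cL: "(\<lambda>\<xi>. cis (t * \<psi> \<xi>) * g \<xi>) \<in> L2" for t
    by (rule L2_mult_bounded[OF hardy_L2(1)[OF g], of _ 1]) simp_all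
  \<comment> \<open>The common phase \<open>cis (- (t * \<xi>\<^sup>2))\<close> is factored out and
    drops from the norm.\<close>
  have eq: "sqrt (2 * pi) * lp_norm 2 (\<lambda>x. free_schroedinger t v x - wave \<omega> g t x) = lp_norm 2 (\<lambda>\<xi>. fourier v \<xi> - cis (t * \<psi> \<xi>) * g \<xi>)" for t
  proof -
    have "AE \<xi> in lborel. fourier (\<lambda>x. free_schroedinger t v x - wave \<omega> g t x) \<xi> = cis (- (t * \<xi>\<^sup>2)) * (fourier v \<xi> - cis (t * \<psi> \<xi>) * g \<xi>)"
      using fourier_diff[OF free_schroedinger_L2[OF v, of t] wL[of t]] fourier_free_schroedinger[OF v, of t]
        fourier_inv_ft_hardy[OF wave_hardy[OF g, of t \<omega>]] unfolding wave_def[symmetric]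
    proof eventually_elim
      case (elim \<xi>)
      have "cis (- (t * \<xi>\<^sup>2)) * cis (t * \<psi> \<xi>) = cis (t * (\<omega> - \<xi>))" by (simp add: cis_mult \<psi>_def algebra_simps)
      then show ?case unfolding elim right_diff_distrib by (simp add: mult.assoc[symmetric])
    qed
    then have "lp_norm 2 (\<lambda>\<xi>. cis (- (t * \<xi>\<^sup>2)) * (fourier v \<xi> - cis (t * \<psi> \<xi>) * g \<xi>)) = sqrt (2 * pi) * lp_norm 2 (\<lambda>x. free_schroedinger t v x - wave \<omega> g t x)"
      by (intro lp_norm_2_fourier_eq L2_diff free_schroedinger_L2 v wL) simp_all
    then show ?thesis by (simp add: lp_norm_2 norm_mult)
  qed
  have "((\<lambda>t. sqrt (2 * pi) * lp_norm 2 (\<lambda>x. free_schroedinger t v x - wave \<omega> g t x)) \<longlongrightarrow> sqrt (2 * pi) * 0) F"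
    by (intro tendsto_mult tendsto_const lim)
  then have "((\<lambda>t. lp_norm 2 (\<lambda>\<xi>. cis (t * \<psi> \<xi>) * g \<xi> - fourier v \<xi>)) \<longlongrightarrow> 0) F"
    unfolding eq by (simp add: lp_norm_2 norm_minus_commute)
  then have L: "((\<lambda>t. abs_l2 (\<lambda>\<xi>. cis (t * \<psi> \<xi>) * g \<xi>)) \<longlongrightarrow> abs_l2 (fourier v)) F"
    by (simp add: abs_l2_tendsto_iff cL vh)
  have "((\<lambda>t. abs_l2 (\<lambda>\<xi>. cis ((t + 1) * \<psi> \<xi>) * g \<xi>) - abs_l2 (\<lambda>\<xi>. cis (t * \<psi> \<xi>) * g \<xi>)) \<longlongrightarrow> abs_l2 (fourier v) - abs_l2 (fourier v)) F"
    by (intro tendsto_diff L filterlim_compose[OF L shift])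
  then have "((\<lambda>t. norm (abs_l2 (\<lambda>\<xi>. cis ((t + 1) * \<psi> \<xi>) * g \<xi>) - abs_l2 (\<lambda>\<xi>. cis (t * \<psi> \<xi>) * g \<xi>))) \<longlongrightarrow> 0) F"
    using tendsto_norm_zero by force
  \<comment> \<open>The difference between the two times has a norm independent of \<open>t\<close>,
    so the limit 0 is its value.\<close>
  moreover have "norm (abs_l2 (\<lambda>\<xi>. cis ((t + 1) * \<psi> \<xi>) * g \<xi>) - abs_l2 (\<lambda>\<xi>. cis (t * \<psi> \<xi>) * g \<xi>)) = lp_norm 2 (\<lambda>\<xi>. (cis (\<psi> \<xi>) - 1) * g \<xi>)" for t
  proof -
    have "cis ((t + 1) * \<psi> \<xi>) * g \<xi> - cis (t * \<psi> \<xi>) * g \<xi> = cis (t * \<psi> \<xi>) * ((cis (\<psi> \<xi>) - 1) * g \<xi>)" for \<xi>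
      by (simp add: distrib_right cis_mult[symmetric] algebra_simps)
    then have "norm (abs_l2 (\<lambda>\<xi>. cis ((t + 1) * \<psi> \<xi>) * g \<xi>) - abs_l2 (\<lambda>\<xi>. cis (t * \<psi> \<xi>) * g \<xi>))
        = lp_norm 2 (\<lambda>\<xi>. cis (t * \<psi> \<xi>) * ((cis (\<psi> \<xi>) - 1) * g \<xi>))"
      using norm_abs_l2[OF L2_diff[OF cL[of "t + 1"] cL[of t]]] by (simp add: abs_l2_diff cL)
    then show ?thesis by (simp add: lp_norm_2 norm_mult)
  qed
  ultimately have "((\<lambda>t. lp_norm 2 (\<lambda>\<xi>. (cis (\<psi> \<xi>) - 1) * g \<xi>)) \<longlongrightarrow> 0) F" by simp
  then have z: "lp_norm 2 (\<lambda>\<xi>. (cis (\<psi> \<xi>) - 1) * g \<xi>) = 0" using F tendsto_const_iff by blast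
  have dL: "(\<lambda>\<xi>. (cis (\<psi> \<xi>) - 1) * g \<xi>) \<in> L2"
    using L2_diff[OF cL[of 1] cL[of 0]] by (simp add: left_diff_distrib)
  have "AE \<xi> in lborel. g \<xi> = 0"
    using z[unfolded lp_norm_2_zero_iff[OF dL]] AE_cis_quadratic_neq_1[of \<omega>]
    by eventually_elim (simp add: \<psi>_def)
  then have "mass g = mass (\<lambda>\<xi>. 0)" by (rule quad_cong_AE) simp_all
  then show ?thesis by (simp add: quad_def)
qed

text \<open>The supremum is taken in the extended reals, where an unbounded set has infinite
  supremum and the empty set has supremum -\<infinity>, so the inequality means what it says in
  every case.\<close>

theorem corollary1p10:
  fixes Q :: "real \<Rightarrow> complex"
  assumes "is_arg_min I2 (\<lambda>f. f \<in> H1_plus_nonzero) Q"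
    and "lp_norm 2 Q = root 4 (3 * J2)"
  shows "Sup (ereal ` scattering_thresholds) < ereal (lp_norm 2 Q)
    \<and> lp_norm 2 Q = root 4 (3 * J2)
    \<and> (\<exists>u. global_solution u \<and> lp_norm 2 (u 0) < lp_norm 2 Q
          \<and> \<not> L2_scatters_forward u \<and> \<not> L2_scatters_backward u)"
proof -
  note J = minimiser_consequences[OF assms(1)]
  obtain g0 where g0: "g0 \<in> hardy" "act g0 < J2 * six g0" using J(3) by blast
  obtain g \<omega> where g: "g \<in> hardy" "mass g > 0" "(mass g)\<^sup>2 < 3 * J2"
    and el: "AE \<xi> in lborel. 0 \<le> \<xi> \<longrightarrow> of_real (\<xi>\<^sup>2 - \<xi> + \<omega>) * g \<xi> = fourier (nonlin (inv_ft g)) \<xi>"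
    by (rule soliton_profile[OF J(1,2) g0])
  define u where "u = wave \<omega> g"
  have sol: "global_solution u" unfolding u_def by (rule wave_global_solution[OF g(1) el])
  have u0: "(lp_norm 2 (u 0))\<^sup>2 = mass g" by (simp add: u_def wave_def lp_norm_2_inv_ft[OF g(1)])
  have less: "lp_norm 2 (u 0) < lp_norm 2 Q"
  proof -
    have "lp_norm 2 (u 0) ^ 4 = (mass g)\<^sup>2" unfolding u0[symmetric] by (simp flip: power_mult)
    then have "root 4 (lp_norm 2 (u 0) ^ 4) < root 4 (3 * J2)" using g(3) by (simp add: real_root_less_iff)
    then show ?thesis using assms(2) by (simp add: real_root_power_cancel)
  qed
  have plus_L2: "v \<in> L2_plus \<Longrightarrow> v \<in> L2" for v by (simp add: L2_plus_def)
  have fwd: "\<not> L2_scatters_forward u"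
  proof
    assume "L2_scatters_forward u"
    then obtain v where v: "v \<in> L2_plus" "((\<lambda>t. lp_norm 2 (\<lambda>x. free_schroedinger t v x - u t x)) \<longlongrightarrow> 0) at_top"
      by (auto simp: L2_scatters_forward_def)
    have "filterlim (\<lambda>t::real. t + 1) at_top at_top"
      by (rule filterlim_at_top_mono[OF filterlim_ident]) simp
    from wave_not_scattering[OF g(1) plus_L2[OF v(1)] _ this v(2)[unfolded u_def]] show False using g(2) by simp
  qed
  have bwd: "\<not> L2_scatters_backward u"
  proof
    assume "L2_scatters_backward u"
    then obtain v where v: "v \<in> L2_plus" "((\<lambda>t. lp_norm 2 (\<lambda>x. free_schroedinger t v x - u t x)) \<longlongrightarrow> 0) at_bot"
      by (auto simp: L2_scatters_backward_def)
    have "filterlim (\<lambda>t::real. t + 1) at_bot at_bot"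
      unfolding filterlim_at_bot
    proof
      fix Z :: real
      show "\<forall>\<^sub>F t in at_bot. t + 1 \<le> Z" using eventually_le_at_bot[of "Z - 1"] by eventually_elim simp
    qed
    from wave_not_scattering[OF g(1) plus_L2[OF v(1)] _ this v(2)[unfolded u_def]] show False using g(2) by simp
  qed
  \<comment> \<open>A threshold above the norm of \<open>u 0\<close> would apply to \<open>u\<close>
    itself and make it scatter.\<close>
  have "e \<le> lp_norm 2 (u 0)" if e: "e \<in> scattering_thresholds" for e
  proof (rule ccontr)
    assume "\<not> e \<le> lp_norm 2 (u 0)"
    moreover have "u 0 \<in> H1_plus" using sol by (simp add: global_solution_def)
    ultimately have "L2_scatters_forward u" using e sol unfolding scattering_thresholds_def by (simp add: not_le)
    with fwd show False by simp
  qed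
  then have "Sup (ereal ` scattering_thresholds) \<le> ereal (lp_norm 2 (u 0))" by (intro Sup_least) auto
  also have "\<dots> < ereal (lp_norm 2 Q)" using less by simp
  finally show ?thesis by (intro conjI exI[of _ u] assms(2) sol less fwd bwd)
qed

end
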